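(* Let $\Omega\subset\mathbb R^n$ ($n\ge3$) be a smooth bounded open set. There exists $\rho>0$ such that the set $\{\theta\in\mathfrak B_\rho:\psi_{\Omega_\theta}\text{ is a Morse function}\}$ is a residual (hence dense) subset of $\mathfrak B_\rho$.
   Context: $\mathfrak C^2$ is the Banach space of $C^2$ maps $\theta:\mathbb R^n\to\mathbb R^n$ with $\|\theta\|_2=\max_{i}\max_{0\le|\ell|\le2}\sup_{x\in\mathbb R^n}|\partial^\ell\theta_i(x)|<\infty$; $\mathfrak B_\rho=\{\theta\in\mathfrak C^2:\|\theta\|_2\le\rho\}$. For $\theta\in\mathfrak C^2$, $\Omega_\theta=\{x+\theta(x):x\in\Omega\}$. For an open bounded set $D$, $\psi_D:D\to\mathbb R$, $\psi_D(x)=\int_{\mathbb R^n\setminus D}|x-y|^{-2n}dy$. A $C^2$ function is a Morse function if all its critical points are nondegenerate (nonsingular Hessian). A subset $A\subset B$ is residual if $B\setminus A$ is a countable union of closed subsets of $B$ with empty interior. *)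

theory Defs
  imports "HOL-Analysis.Analysis"
begin

definition has_partial :: "'n::finite \<Rightarrow> (real^'n \<Rightarrow> real) \<Rightarrow> real^'n \<Rightarrow> bool" where
  "has_partial i f x \<longleftrightarrow> (\<lambda>t. f (x + t *\<^sub>R axis i 1)) differentiable (at 0)"

definition partial :: "'n::finite \<Rightarrow> (real^'n \<Rightarrow> real) \<Rightarrow> real^'n \<Rightarrow> real" where
  "partial i f x = deriv (\<lambda>t. f (x + t *\<^sub>R axis i 1)) 0"

fun iter_partial :: "'n::finite list \<Rightarrow> (real^'n \<Rightarrow> real) \<Rightarrow> real^'n \<Rightarrow> real" where
  "iter_partial [] f = f"
| "iter_partial (i # is) f = partial i (iter_partial is f)"

definition Ck_on :: "nat \<Rightarrow> (real^'n::finite) set \<Rightarrow> (real^'n \<Rightarrow> real) \<Rightarrow> bool" where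
  "Ck_on k U f \<longleftrightarrow>
     (\<forall>is i. length is < k \<longrightarrow> (\<forall>x\<in>U. has_partial i (iter_partial is f) x)) \<and>
     (\<forall>is. length is \<le> k \<longrightarrow> continuous_on U (iter_partial is f))"

definition smooth_on :: "(real^'n::finite) set \<Rightarrow> (real^'n \<Rightarrow> real) \<Rightarrow> bool" where
  "smooth_on U f \<longleftrightarrow> (\<forall>k. Ck_on k U f)"

definition smooth_boundary :: "(real^'n::finite) set \<Rightarrow> bool" where
  "smooth_boundary \<Omega> \<longleftrightarrow>
     (\<forall>p\<in>frontier \<Omega>. \<exists>U g. open U \<and> p \<in> U \<and> smooth_on U g \<and>
        (\<forall>x\<in>U. \<exists>i. partial i g x \<noteq> 0) \<and>
        \<Omega> \<inter> U = {x\<in>U. g x < 0})"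

definition C2_vals :: "(real^'n::finite \<Rightarrow> real^'n) \<Rightarrow> real set" where
  "C2_vals \<theta> = {\<bar>iter_partial is (\<lambda>y. \<theta> y $ k) x\<bar> | is k x. length is \<le> 2}"

definition C2_space :: "(real^'n::finite \<Rightarrow> real^'n) set" where
  "C2_space = {\<theta>. (\<forall>k. Ck_on 2 UNIV (\<lambda>y. \<theta> y $ k)) \<and> bdd_above (C2_vals \<theta>)}"

definition C2_norm :: "(real^'n::finite \<Rightarrow> real^'n) \<Rightarrow> real" where
  "C2_norm \<theta> = Sup (C2_vals \<theta>)"

definition C2_ball :: "real \<Rightarrow> (real^'n::finite \<Rightarrow> real^'n) set" where
  "C2_ball \<rho> = {\<theta>\<in>C2_space. C2_norm \<theta> \<le> \<rho>}"

definition C2_dist :: "(real^'n::finite \<Rightarrow> real^'n) \<Rightarrow> (real^'n \<Rightarrow> real^'n) \<Rightarrow> real" where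
  "C2_dist \<theta> \<eta> = C2_norm (\<lambda>x. \<theta> x - \<eta> x)"

definition closed_in_C2 :: "(real^'n::finite \<Rightarrow> real^'n) set \<Rightarrow> (real^'n \<Rightarrow> real^'n) set \<Rightarrow> bool" where
  "closed_in_C2 B F \<longleftrightarrow> F \<subseteq> B \<and>
     (\<forall>\<theta>\<in>B. (\<forall>\<epsilon>>0. \<exists>\<eta>\<in>F. C2_dist \<theta> \<eta> < \<epsilon>) \<longrightarrow> \<theta> \<in> F)"

definition empty_interior_in_C2 :: "(real^'n::finite \<Rightarrow> real^'n) set \<Rightarrow> (real^'n \<Rightarrow> real^'n) set \<Rightarrow> bool" where
  "empty_interior_in_C2 B F \<longleftrightarrow>
     \<not> (\<exists>\<theta>\<in>B. \<exists>\<epsilon>>0. {\<eta>\<in>B. C2_dist \<theta> \<eta> < \<epsilon>} \<subseteq> F)"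

definition residual_in_C2 :: "(real^'n::finite \<Rightarrow> real^'n) set \<Rightarrow> (real^'n \<Rightarrow> real^'n) set \<Rightarrow> bool" where
  "residual_in_C2 B A \<longleftrightarrow> A \<subseteq> B \<and>
     (\<exists>F::nat \<Rightarrow> (real^'n \<Rightarrow> real^'n) set.
        (\<forall>m. closed_in_C2 B (F m) \<and> empty_interior_in_C2 B (F m)) \<and> B - A = (\<Union>m. F m))"

definition deform :: "(real^'n::finite) set \<Rightarrow> (real^'n \<Rightarrow> real^'n) \<Rightarrow> (real^'n) set" where
  "deform \<Omega> \<theta> = (\<lambda>x. x + \<theta> x) ` \<Omega>"

text \<open>psi_D(x) = integral over R^n - D of |x-y|^(-2n) (Lebesgue measure); only used for x in D.\<close>
definition psi :: "(real^'n::finite) set \<Rightarrow> real^'n \<Rightarrow> real" where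
  "psi D x = integral (- D) (\<lambda>y. 1 / norm (x - y) ^ (2 * CARD('n)))"

definition hessian :: "(real^'n::finite \<Rightarrow> real) \<Rightarrow> real^'n \<Rightarrow> real^'n^'n" where
  "hessian f x = (\<chi> i j. partial i (partial j f) x)"

definition critical_point :: "(real^'n::finite \<Rightarrow> real) \<Rightarrow> real^'n \<Rightarrow> bool" where
  "critical_point f x \<longleftrightarrow> (\<forall>i. partial i f x = 0)"

definition morse_on :: "(real^'n::finite) set \<Rightarrow> (real^'n \<Rightarrow> real) \<Rightarrow> bool" where
  "morse_on D f \<longleftrightarrow> Ck_on 2 D f \<and>
     (\<forall>x\<in>D. critical_point f x \<longrightarrow> det (hessian f x) \<noteq> 0)"

end

theory Submission
  imports Defs
begin

text \<open>
  For small \<open>\<rho>\<close> every \<open>x \<mapsto> x + \<theta> x\<close> is a bi-Lipschitz bijection, and substituting it in the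
  integrals defining the gradient and the Hessian of \<open>psi\<close> makes them jointly continuous in \<open>x\<close>
  and \<open>\<theta>\<close>.  Hence the deformations with a degenerate critical point at the image of some point of
  a compact set \<open>C \<subseteq> \<Omega>\<close> form a closed set, and countably many closed balls \<open>C\<close> cover \<open>\<Omega>\<close>.

  Such a set has empty interior when \<open>C\<close> is a small ball around \<open>x\<^sub>0\<close>.  Let \<open>D\<close> be the deformed
  domain, \<open>a\<close> the image of \<open>x\<^sub>0\<close>, and compose the deformation with the radial maps
  \<open>Y \<mapsto> Y + (t \<bullet> z) z / (1 + \<bar>z\<bar>\<^sup>2)\<^sup>2\<close>, \<open>z = Y - a\<close>, with a parameter \<open>t\<close> in \<open>n\<close>-space.  The derivative
  at \<open>t = 0\<close> of the gradient of \<open>psi\<close> at \<open>a\<close> has the quadratic form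
  \<open>\<tau> \<mapsto> - 2 n \<integral> (\<tau> \<bullet> z)\<^sup>2 (n + 4 \<bar>z\<bar>\<^sup>2 / (1 + \<bar>z\<bar>\<^sup>2)) / ((1 + \<bar>z\<bar>\<^sup>2)\<^sup>2 \<bar>z\<bar>\<^sup>2\<^sup>n\<^sup>+\<^sup>2)\<close> over the complement of \<open>D\<close>,
  which is negative definite.  So the gradient is strictly monotone in \<open>t\<close> near \<open>(a, 0)\<close>, and
  Sard's theorem shows that almost every small \<open>t\<close> removes the degenerate critical points near \<open>a\<close>.
\<close>

section \<open>Transfer to arbitrary finite index types\<close>

text \<open>The direction of the perturbation is dictated by the sign of the quadratic form. The
  integrand of the gradient at \<open>a\<close> is a multiple of z, and a radial displacement u z
  rescales it by (1 + u)^(- 2 n - 1) times the Jacobian (1 + u)^(n - 1) (1 + u + z \<bullet> grad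
  u). With u = (t \<bullet> z) w(|z|) the first variation tested against \<tau> is (t \<bullet> z)
  (\<tau> \<bullet> z) times a function of |z| alone, which is a square for \<tau> = t; hence no
  cancellation between different parts of the complement can occur. The weight w = 1 / (1 + |z|^2)^2
  turns u z into (t \<bullet> P) P with P = z / (1 + |z|^2), a field with bounded derivatives.

  Two obstacles shape the density argument. The set of base points must be fixed before the
  deformation is known, so every constant may depend on the deformed set only through two radii,
  which the bi-Lipschitz bounds provide. And \<open>C2_ball \<rho>\<close> is closed, so a
  deformation on its boundary is first shrunk slightly to leave room for the perturbation.\<close>

text \<open>
  The change-of-variables theorem and Sard's theorem of HOL-Analysis are stated for well-ordered
  index types only; \<open>'a idx\<close> is a well-ordered copy of an arbitrary finite type \<open>'a\<close>.
\<close>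

typedef ('a::finite) idx = "{..<CARD('a)}"
  by (rule exI[of _ 0]) simp

instantiation idx :: (finite) linorder
begin
definition "x \<le> y \<longleftrightarrow> Rep_idx x \<le> Rep_idx y"
definition "x < y \<longleftrightarrow> Rep_idx x < Rep_idx y"
instance
  by standard (auto simp: less_eq_idx_def less_idx_def Rep_idx_inject)
end

instance idx :: (finite) wellorder
proof
  fix P :: "'a idx \<Rightarrow> bool" and a
  assume step: "\<And>x. (\<And>y. y < x \<Longrightarrow> P y) \<Longrightarrow> P x"
  have "wfP (\<lambda>x y. Rep_idx (x::'a idx) < Rep_idx y)"
    by (rule wfp_if_convertible_to_nat[of _ Rep_idx]) simp
  then show "P a"
    by (induct a rule: wfp_induct_rule) (use step less_idx_def in blast)
qed

instance idx :: (finite) finite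
proof
  have "(UNIV :: 'a idx set) = Abs_idx ` {..<CARD('a)}"
    by (simp add: type_definition.Abs_image[OF type_definition_idx])
  then show "finite (UNIV :: 'a idx set)"
    by (metis finite_imageI finite_lessThan)
qed

lemma card_idx: "CARD('a::finite idx) = CARD('a)"
  by (simp add: type_definition.card[OF type_definition_idx])

definition idx_bij :: "'a::finite idx \<Rightarrow> 'a" where
  "idx_bij = (SOME f. bij f)"

lemma bij_idx_bij: "bij (idx_bij :: 'a::finite idx \<Rightarrow> 'a)"
proof -
  have "\<exists>f :: 'a idx \<Rightarrow> 'a. bij f"
    by (rule finite_same_card_bij) (auto simp: card_idx)
  then show ?thesis
    unfolding idx_bij_def by (rule someI_ex)
qed

definition reindex :: "('k::finite \<Rightarrow> 'm::finite) \<Rightarrow> real^'m \<Rightarrow> real^'k" where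
  "reindex \<sigma> x = (\<chi> i. x $ \<sigma> i)"

lemma reindex_component [simp]: "reindex \<sigma> x $ i = x $ \<sigma> i"
  by (simp add: reindex_def)

lemma reindex_inverse:
  assumes "bij \<sigma>"
  shows "reindex (inv \<sigma>) (reindex \<sigma> x) = x" "reindex \<sigma> (reindex (inv \<sigma>) y) = y"
  using assms by (auto simp: vec_eq_iff bij_is_surj surj_f_inv_f bij_is_inj)

lemma linear_reindex: "linear (reindex \<sigma>)"
  by (rule linearI) (auto simp: vec_eq_iff)

lemmas bounded_linear_reindex = linear_conv_bounded_linear[THEN iffD1, OF linear_reindex]

lemma norm_reindex:
  assumes "bij (\<sigma> :: 'k::finite \<Rightarrow> 'm::finite)"
  shows "norm (reindex \<sigma> x) = norm x"
  unfolding norm_vec_def L2_set_def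
  using sum.reindex_bij_betw[OF assms, of "\<lambda>i. (norm (x $ i))\<^sup>2"] by simp

lemma reindex_cbox:
  assumes "bij (\<sigma> :: 'k::finite \<Rightarrow> 'm::finite)"
  shows "reindex \<sigma> ` cbox a b = cbox (reindex \<sigma> a) (reindex \<sigma> b)"
proof -
  have "x \<in> reindex \<sigma> ` cbox a b" if "x \<in> cbox (reindex \<sigma> a) (reindex \<sigma> b)" for x
  proof
    show "x = reindex \<sigma> (reindex (inv \<sigma>) x)"
      by (simp add: reindex_inverse assms)
    show "reindex (inv \<sigma>) x \<in> cbox a b"
      using that assms unfolding mem_box_cart
      by (auto simp: mem_box_cart) (metis assms bij_is_surj surj_f_inv_f)+
  qed
  then show ?thesis
    by (auto simp: mem_box_cart)
qed

lemma content_reindex_cbox: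
  assumes "bij (\<sigma> :: 'k::finite \<Rightarrow> 'm::finite)"
  shows "measure lborel (reindex \<sigma> ` cbox a b) = measure lborel (cbox a b)"
proof (cases "cbox a b = {}")
  case False
  then have "cbox (reindex \<sigma> a) (reindex \<sigma> b) \<noteq> {}"
    using reindex_cbox[OF assms] by (metis image_is_empty)
  then show ?thesis
    using False prod.reindex_bij_betw[OF assms, of "\<lambda>i. b $ i - a $ i"]
    by (simp add: reindex_cbox[OF assms] content_cbox_cart)
qed auto

text \<open>Coordinate permutations map boxes to boxes of the same volume, which settles integrals
  over boxes. For other sets the integral is a limit over large boxes; since the permutation is an
  isometry, a box containing a ball about the origin pulls back to a box containing the same
  ball.\<close>

lemma has_integral_reindex:
  fixes f :: "real^'m::finite \<Rightarrow> 'b::real_normed_vector" and \<sigma> :: "'k::finite \<Rightarrow> 'm"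
  assumes \<sigma>: "bij \<sigma>" and f: "(f has_integral y) S"
  shows "((\<lambda>x. f (reindex (inv \<sigma>) x)) has_integral y) (reindex \<sigma> ` S)"
proof -
  have inv: "bij (inv \<sigma>)"
    using \<sigma> by (rule bij_imp_bij_inv)
  have cbox: "((\<lambda>x. F (reindex (inv \<sigma>) x)) has_integral i) (reindex \<sigma> ` cbox a b)"
    if "(F has_integral i) (cbox a b)" for F :: "real^'m \<Rightarrow> 'b" and i a b
  proof -
    have "((\<lambda>x. F (reindex (inv \<sigma>) x)) has_integral (1/1) *\<^sub>R i) (reindex \<sigma> ` cbox a b)"
    proof (rule has_integral_twiddle)
      show "continuous (at x) (reindex (inv \<sigma>))" for x :: "real^'k"
        by (intro linear_continuous_at bounded_linear_reindex)
    qed (use \<sigma> inv that in \<open>auto simp: reindex_inverse reindex_cbox[OF \<sigma>] reindex_cbox[OF inv] content_reindex_cbox[OF inv, unfolded reindex_cbox[OF inv]]\<close>)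
    then show ?thesis by simp
  qed
  show ?thesis
  proof (cases "\<exists>a b. S = cbox a b")
    case True
    then show ?thesis using cbox f by auto
  next
    case False
    \<comment> \<open>\<open>has_integral_alt\<close> unfolds to the limit over large boxes only for
      a set that is not itself a box, so this is needed for the image as well.\<close>
    have ncbox: "\<nexists>a b. reindex \<sigma> ` S = cbox a b"
    proof
      assume "\<exists>a b. reindex \<sigma> ` S = cbox a b"
      then obtain a b where "reindex \<sigma> ` S = cbox a b" by auto
      then have "S = reindex (inv \<sigma>) ` cbox a b"
        using \<sigma> by (force simp: image_iff reindex_inverse)
      then show False using False reindex_cbox[OF inv] by metis
    qed
    have mem: "x \<in> reindex \<sigma> ` S \<longleftrightarrow> reindex (inv \<sigma>) x \<in> S" for x
      using reindex_inverse[OF \<sigma>] by (metis image_iff)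
    have "\<exists>B>0. \<forall>a b. ball 0 B \<subseteq> cbox a b \<longrightarrow>
        (\<exists>z. ((\<lambda>x. if x \<in> reindex \<sigma> ` S then f (reindex (inv \<sigma>) x) else 0) has_integral z) (cbox a b) \<and> norm (z - y) < e)"
      if e: "e > 0" for e
    proof -
      obtain B where B: "B > 0" "\<And>a b. ball 0 B \<subseteq> cbox a b \<Longrightarrow>
          \<exists>z. ((\<lambda>x. if x \<in> S then f x else 0) has_integral z) (cbox a b) \<and> norm (z - y) < e"
        using has_integral_altD[OF f False e] by metis
      have "\<exists>z. ((\<lambda>x. if x \<in> reindex \<sigma> ` S then f (reindex (inv \<sigma>) x) else 0) has_integral z) (cbox a b) \<and> norm (z - y) < e"
        if ab: "ball 0 B \<subseteq> cbox a b" for a b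
      proof -
        have "ball 0 B \<subseteq> reindex (inv \<sigma>) ` ball 0 B"
        proof
          fix x :: "real^'m" assume "x \<in> ball 0 B"
          then show "x \<in> reindex (inv \<sigma>) ` ball 0 B"
            using reindex_inverse(1)[OF \<sigma>, of x] norm_reindex[OF \<sigma>, of x]
            by (intro image_eqI[of _ _ "reindex \<sigma> x"]) auto
        qed
        also have "\<dots> \<subseteq> reindex (inv \<sigma>) ` cbox a b"
          using ab by blast
        also have "\<dots> = cbox (reindex (inv \<sigma>) a) (reindex (inv \<sigma>) b)"
          by (rule reindex_cbox[OF inv])
        finally obtain z where z: "((\<lambda>x. if x \<in> S then f x else 0) has_integral z) (cbox (reindex (inv \<sigma>) a) (reindex (inv \<sigma>) b))"
          "norm (z - y) < e"
          using B(2) by blast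
        have "((\<lambda>x. if reindex (inv \<sigma>) x \<in> S then f (reindex (inv \<sigma>) x) else 0) has_integral z) (cbox a b)"
          using cbox[OF z(1)] by (simp add: reindex_cbox[OF \<sigma>] reindex_inverse[OF \<sigma>])
        then show ?thesis
          using z(2) unfolding mem by blast
      qed
      then show ?thesis using B(1) by blast
    qed
    then show ?thesis
      by (subst has_integral_alt) (simp only: ncbox if_False, blast)
  qed
qed

lemma has_integral_reindex_iff:
  fixes f :: "real^'m::finite \<Rightarrow> 'b::real_normed_vector" and \<sigma> :: "'k::finite \<Rightarrow> 'm"
  assumes \<sigma>: "bij \<sigma>"
  shows "((\<lambda>x. f (reindex (inv \<sigma>) x)) has_integral y) (reindex \<sigma> ` S) \<longleftrightarrow> (f has_integral y) S"
proof
  assume "((\<lambda>x. f (reindex (inv \<sigma>) x)) has_integral y) (reindex \<sigma> ` S)"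
  from has_integral_reindex[OF bij_imp_bij_inv[OF \<sigma>] this]
  show "(f has_integral y) S"
    using \<sigma> by (simp add: inv_inv_eq image_image reindex_inverse)
qed (rule has_integral_reindex[OF \<sigma>])

lemma integral_reindex:
  fixes f :: "real^'m::finite \<Rightarrow> 'b::euclidean_space" and \<sigma> :: "'k::finite \<Rightarrow> 'm"
  assumes \<sigma>: "bij \<sigma>"
  shows "integral (reindex \<sigma> ` S) (\<lambda>x. f (reindex (inv \<sigma>) x)) = integral S f"
  unfolding integral_def integrable_on_def has_integral_reindex_iff[OF \<sigma>] ..

lemma absolutely_integrable_reindex_iff:
  fixes f :: "real^'m::finite \<Rightarrow> 'b::euclidean_space" and \<sigma> :: "'k::finite \<Rightarrow> 'm"
  assumes \<sigma>: "bij \<sigma>"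
  shows "(\<lambda>x. f (reindex (inv \<sigma>) x)) absolutely_integrable_on (reindex \<sigma> ` S) \<longleftrightarrow> f absolutely_integrable_on S"
  unfolding absolutely_integrable_on_def integrable_on_def
  using has_integral_reindex_iff[OF \<sigma>, of f] has_integral_reindex_iff[OF \<sigma>, of "\<lambda>x. norm (f x)"] by simp

section \<open>Change of variables and Sard's theorem over an arbitrary finite index type\<close>

definition jac_det :: "(real^'n::finite \<Rightarrow> real^'n) \<Rightarrow> real" where
  "jac_det L = det (\<chi> i j. L (axis (idx_bij j) 1) $ idx_bij i :: real^('n idx)^('n idx))"

text \<open>Conjugation by \<open>reindex\<close> moves the problem to \<open>'n idx\<close>.
  \<open>jac_det\<close> is the usual determinant, written in the coordinates in which the
  conjugated derivative appears; a simultaneous permutation of rows and columns leaves its value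
  unchanged. A closed \<open>S\<close> stays closed, hence measurable, under the coordinate
  permutation.\<close>

lemma has_absolute_integral_change_of_variables_closed:
  fixes f :: "real^'n::finite \<Rightarrow> real^'m::finite" and g :: "real^'n \<Rightarrow> real^'n"
  assumes S: "closed S"
    and der_g: "\<And>x. x \<in> S \<Longrightarrow> (g has_derivative g' x) (at x within S)"
    and inj: "inj_on g S"
  shows "(\<lambda>x. \<bar>jac_det (g' x)\<bar> *\<^sub>R f (g x)) absolutely_integrable_on S \<and>
           integral S (\<lambda>x. \<bar>jac_det (g' x)\<bar> *\<^sub>R f (g x)) = b
     \<longleftrightarrow> f absolutely_integrable_on (g ` S) \<and> integral (g ` S) f = b"
proof -
  let ?s = "idx_bij :: 'n idx \<Rightarrow> 'n"
  let ?R = "reindex ?s" and ?Q = "reindex (inv ?s)"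
  note s = bij_idx_bij[where 'a='n]
  note inv = reindex_inverse[OF s]
  let ?g = "\<lambda>x. ?R (g (?Q x))" and ?g' = "\<lambda>x h. ?R (g' (?Q x) (?Q h))"
  have "?R ` S = ?Q -` S"
    using inv by (auto simp: image_iff) metis
  then have "closed (?R ` S)"
    using S by (simp add: continuous_closed_vimage linear_continuous_at[OF bounded_linear_reindex])
  then have leb: "?R ` S \<in> sets lebesgue"
    by (simp add: borel_closed)
  have der: "(?g has_derivative ?g' x) (at x within ?R ` S)" if "x \<in> ?R ` S" for x
  proof -
    from that obtain y where y: "y \<in> S" "x = ?R y" by auto
    have Q: "(?Q has_derivative ?Q) (at x within ?R ` S)"
      by (rule bounded_linear_imp_has_derivative[OF bounded_linear_reindex])
    have img: "?Q ` ?R ` S = S"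
      by (simp add: image_image inv)
    have "((\<lambda>x. g (?Q x)) has_derivative (\<lambda>h. g' (?Q x) (?Q h))) (at x within ?R ` S)"
      by (rule has_derivative_in_compose[OF Q]) (use y der_g[of y] in \<open>simp add: img inv\<close>)
    then show ?thesis
      by (rule bounded_linear.has_derivative[OF bounded_linear_reindex])
  qed
  have inj': "inj_on ?g (?R ` S)"
    using inj inv by (auto simp: inj_on_def) metis+
  have mat: "det (matrix (?g' x)) = jac_det (g' (?Q x))" for x
  proof -
    have "?Q (axis j 1) = axis (?s j) 1" for j
      using s by (auto simp: vec_eq_iff axis_def bij_is_surj surj_f_inv_f bij_is_inj)
    then show ?thesis
      by (simp add: jac_det_def matrix_def)
  qed
  have "(\<lambda>x. \<bar>det (matrix (?g' x))\<bar> *\<^sub>R f (?Q (?g x))) absolutely_integrable_on ?R ` S \<and>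
      integral (?R ` S) (\<lambda>x. \<bar>det (matrix (?g' x))\<bar> *\<^sub>R f (?Q (?g x))) = b
     \<longleftrightarrow> (\<lambda>x. f (?Q x)) absolutely_integrable_on (?g ` ?R ` S) \<and> integral (?g ` ?R ` S) (\<lambda>x. f (?Q x)) = b"
    by (rule has_absolute_integral_change_of_variables[OF leb der inj'])
  moreover have "?g ` ?R ` S = ?R ` g ` S"
    by (simp add: image_image inv)
  ultimately show ?thesis
    using integral_reindex[OF s, of S "\<lambda>x. \<bar>jac_det (g' x)\<bar> *\<^sub>R f (g x)"]
      absolutely_integrable_reindex_iff[OF s, of S "\<lambda>x. \<bar>jac_det (g' x)\<bar> *\<^sub>R f (g x)"]
      integral_reindex[OF s, of "g ` S" f] absolutely_integrable_reindex_iff[OF s, of "g ` S" f]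
    by (simp add: mat inv)
qed

text \<open>Sard's theorem between spaces of equal dimension, again by conjugation. The derivatives
  are relative to an arbitrary set \<open>S\<close>, as required for a map known only where an
  equation has a solution.\<close>

lemma negligible_singular_image:
  fixes f :: "real^'n::finite \<Rightarrow> real^'n"
  assumes der: "\<And>x. x \<in> S \<Longrightarrow> (f has_derivative f' x) (at x within S)"
    and sing: "\<And>x. x \<in> S \<Longrightarrow> \<not> inj (f' x)"
  shows "negligible (f ` S)"
proof -
  let ?s = "idx_bij :: 'n idx \<Rightarrow> 'n"
  let ?R = "reindex ?s" and ?Q = "reindex (inv ?s)"
  note s = bij_idx_bij[where 'a='n]
  note inv = reindex_inverse[OF s]
  let ?g = "\<lambda>x. ?R (f (?Q x))" and ?g' = "\<lambda>x h. ?R (f' (?Q x) (?Q h))"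
  have der: "(?g has_derivative ?g' x) (at x within ?R ` S)" if "x \<in> ?R ` S" for x
  proof -
    from that obtain y where y: "y \<in> S" "x = ?R y" by auto
    have Q: "(?Q has_derivative ?Q) (at x within ?R ` S)"
      by (rule bounded_linear_imp_has_derivative[OF bounded_linear_reindex])
    have img: "?Q ` ?R ` S = S"
      by (simp add: image_image inv)
    have "((\<lambda>x. f (?Q x)) has_derivative (\<lambda>h. f' (?Q x) (?Q h))) (at x within ?R ` S)"
      by (rule has_derivative_in_compose[OF Q]) (use y der[of y] in \<open>simp add: img inv\<close>)
    then show ?thesis
      by (rule bounded_linear.has_derivative[OF bounded_linear_reindex])
  qed
  have "negligible (?g ` ?R ` S)"
  proof (rule baby_Sard[OF _ der])
    fix x assume x: "x \<in> ?R ` S"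
    have lin: "linear (?g' x)"
      using der[OF x] has_derivative_linear by blast
    have "\<not> inj (f' (?Q x))"
      using x sing by (auto simp: inv)
    then obtain a b where "f' (?Q x) a = f' (?Q x) b" "a \<noteq> b"
      by (auto simp: inj_def)
    then have "?g' x (?R a) = ?g' x (?R b)" "?R a \<noteq> ?R b"
      by (auto simp: inv dest: arg_cong[where f="?Q"])
    then have "\<not> inj (?g' x)"
      by (auto simp: inj_def)
    then show "rank (matrix (?g' x)) < CARD('n idx)"
      by (simp add: less_rank_noninjective matrix_vector_mul(2)[OF lin])
  qed auto
  then have "negligible (?Q ` ?g ` ?R ` S)"
    by (rule negligible_differentiable_image_negligible[rotated])
       (auto simp: card_idx intro!: linear_imp_differentiable_on linear_reindex)
  then show ?thesis
    by (simp add: image_image inv)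
qed

section \<open>Integration and the parametric Sard theorem\<close>

text \<open>Dyadic shells: for r 2^k <= |y - a| <= r 2^(k+1) the integrand is at most (r 2^k)^(-2n),
  the ball of radius r 2^(k+1) has volume of order (r 2^k)^n, and the products are dominated by a
  geometric series.\<close>

lemma absolutely_integrable_inverse_power:
  fixes a :: "real^'n::finite"
  assumes r: "r > 0"
  shows "(\<lambda>y. 1 / norm (y - a) ^ (2 * CARD('n))) absolutely_integrable_on {y. r \<le> norm (y - a)}"
proof -
  let ?n = "CARD('n)"
  let ?S = "{y. r \<le> norm (y - a)}"
  define f where "f y = indicator ?S y *\<^sub>R (1 / norm (y - a) ^ (2 * ?n))" for y
  define c where "c k = 1 / (r * 2 ^ k) ^ (2 * ?n)" for k :: nat
  let ?B = "\<lambda>k::nat. cball a (r * 2 ^ Suc k)"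
  have clS: "closed ?S"
    by (intro closed_Collect_le continuous_intros)
  have meas: "f \<in> borel_measurable borel"
    unfolding f_def using clS by (intro borel_measurable_scaleR borel_measurable_indicator) (auto intro!: borel_closed)
  have c0: "c k \<ge> 0" for k
    using r by (simp add: c_def)
  have le: "ennreal (norm (f y)) \<le> (\<Sum>k. ennreal (c k) * indicator (?B k) y)" for y
  proof (cases "y \<in> ?S")
    case True
    then have y: "r \<le> norm (y - a)" by simp
    \<comment> \<open>The least such \<open>k\<close> is positive because r <= |y - a|, so its
      predecessor indexes a shell containing \<open>y\<close>.\<close>
    have "\<exists>k. norm (y - a) / r < 2 ^ k"
      by (rule real_arch_pow) simp
    then obtain k where k: "norm (y - a) / r < 2 ^ k" "\<And>m. m < k \<Longrightarrow> \<not> norm (y - a) / r < 2 ^ m"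
      using exists_least_iff[of "\<lambda>k. norm (y - a) / r < 2 ^ k"] by blast
    have "k \<noteq> 0"
    proof
      assume "k = 0" then show False using k(1) y r by (simp add: field_simps)
    qed
    then obtain m where m: "k = Suc m" by (cases k) auto
    have lo: "r * 2 ^ m \<le> norm (y - a)" and hi: "norm (y - a) \<le> r * 2 ^ Suc m"
      using k(2)[of m] k(1) r unfolding m by (auto simp: field_simps)
    have pos: "0 < r * 2 ^ m" using r by simp
    have "norm (f y) = 1 / norm (y - a) ^ (2 * ?n)"
      using True by (simp add: f_def)
    moreover have "norm (y - a) > 0" using lo pos by linarith
    then have "1 / norm (y - a) ^ (2 * ?n) \<le> c m"
      unfolding c_def using lo pos r
      by (intro divide_left_mono power_mono mult_pos_pos zero_less_power) auto
    ultimately have "ennreal (norm (f y)) \<le> ennreal (c m) * indicator (?B m) y"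
      using hi by (simp add: dist_norm norm_minus_commute ennreal_leI)
    also have "\<dots> = (\<Sum>k\<in>{m}. ennreal (c k) * indicator (?B k) y)"
      by (subst sum.insert) auto
    also have "\<dots> \<le> (\<Sum>k. ennreal (c k) * indicator (?B k) y)"
      by (rule sum_le_suminf) auto
    finally show ?thesis .
  qed (simp add: f_def)
  have vol: "(\<integral>\<^sup>+ y. ennreal (c k) * indicator (?B k) y \<partial>lborel)
      \<le> ennreal (unit_ball_vol ?n * 2 ^ ?n / r ^ ?n * (1/2) ^ k)" for k
  proof -
    have eq: "c k * (unit_ball_vol ?n * (r * 2 ^ Suc k) ^ ?n) = unit_ball_vol ?n * 2 ^ ?n / r ^ ?n * (1 / 2 ^ k) ^ ?n"
    proof -
      define q where "q = (r * 2 ^ k) ^ ?n"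
      have q: "q \<noteq> 0" using r by (simp add: q_def)
      have "(r * 2 ^ Suc k) ^ ?n = 2 ^ ?n * q"
        by (simp add: q_def power_mult_distrib)
      moreover have "(r * 2 ^ k) ^ (2 * ?n) = q * q"
        unfolding q_def mult_2[of ?n] power_add ..
      moreover have "unit_ball_vol ?n * 2 ^ ?n / r ^ ?n * (1 / 2 ^ k) ^ ?n = unit_ball_vol ?n * 2 ^ ?n / q"
        by (simp add: q_def power_mult_distrib power_divide)
      ultimately show ?thesis
        using q by (simp only: c_def) (simp add: divide_simps)
    qed
    \<comment> \<open>As n >= 1, the ratio 2^(-n) of the series may be replaced by 1/2.\<close>
    have "(1 / 2 ^ k :: real) ^ ?n \<le> (1 / 2 ^ k) ^ 1"
      by (rule power_decreasing) (auto simp: Suc_le_eq)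
    then have "c k * (unit_ball_vol ?n * (r * 2 ^ Suc k) ^ ?n) \<le> unit_ball_vol ?n * 2 ^ ?n / r ^ ?n * (1/2) ^ k"
      unfolding eq using r by (intro mult_left_mono) (auto simp: power_divide)
    moreover have "(\<integral>\<^sup>+ y. ennreal (c k) * indicator (?B k) y \<partial>lborel) = ennreal (c k * (unit_ball_vol ?n * (r * 2 ^ Suc k) ^ ?n))"
      using r c0 by (simp add: nn_integral_cmult_indicator emeasure_cball ennreal_mult)
    ultimately show ?thesis by (simp add: ennreal_leI)
  qed
  have "(\<integral>\<^sup>+ y. ennreal (norm (f y)) \<partial>lborel) \<le> (\<integral>\<^sup>+ y. (\<Sum>k. ennreal (c k) * indicator (?B k) y) \<partial>lborel)"
    by (rule nn_integral_mono) (use le in auto)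
  also have "\<dots> = (\<Sum>k. \<integral>\<^sup>+ y. ennreal (c k) * indicator (?B k) y \<partial>lborel)"
    by (rule nn_integral_suminf) (simp add: borel_measurable_times_ennreal borel_measurable_indicator)
  also have "\<dots> \<le> (\<Sum>k. ennreal (unit_ball_vol ?n * 2 ^ ?n / r ^ ?n * (1/2) ^ k))"
    by (rule suminf_le) (use vol in auto)
  also have "\<dots> = ennreal (\<Sum>k. unit_ball_vol ?n * 2 ^ ?n / r ^ ?n * (1/2) ^ k)"
    using r by (intro suminf_ennreal2 summable_mult summable_geometric) auto
  also have "\<dots> < \<infinity>" by simp
  finally have "integrable lborel f"
    using meas by (intro integrableI_bounded) auto
  then have "integrable lebesgue f"
    using meas by (subst integrable_completion) auto
  then show ?thesis
    unfolding set_integrable_def f_def .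
qed

text \<open>By the mean value theorem on the convex set \<open>U\<close>, the normalized remainder
  of the linearization of \<open>f\<close> at \<open>a\<close> is bounded by \<open>2 * g y\<close>.
  It tends to zero pointwise, so its integral does by dominated convergence.\<close>

lemma has_derivative_integral_dominated:
  fixes f :: "'a::euclidean_space \<Rightarrow> 'b::euclidean_space \<Rightarrow> 'c::euclidean_space"
  assumes U: "open U" "convex U" "a \<in> U"
    and der: "\<And>x y. x \<in> U \<Longrightarrow> y \<in> S \<Longrightarrow> ((\<lambda>x. f x y) has_derivative f' x y) (at x)"
    and bnd: "\<And>x y h. x \<in> U \<Longrightarrow> y \<in> S \<Longrightarrow> norm (f' x y h) \<le> g y * norm h"
    and g: "g integrable_on S"
    and int: "\<And>x. x \<in> U \<Longrightarrow> f x integrable_on S"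
    and int': "\<And>h. (\<lambda>y. f' a y h) integrable_on S"
  shows "((\<lambda>x. integral S (f x)) has_derivative (\<lambda>h. integral S (\<lambda>y. f' a y h))) (at a)"
proof -
  let ?D = "\<lambda>h. integral S (\<lambda>y. f' a y h)"
  have lin: "linear (f' a y)" if "y \<in> S" for y
    using der[OF U(3) that] by (rule has_derivative_linear)
  have "linear ?D"
  proof (rule linearI)
    fix b c
    have "?D (b + c) = integral S (\<lambda>y. f' a y b + f' a y c)"
      by (rule integral_cong) (simp add: lin linear_add)
    then show "?D (b + c) = ?D b + ?D c"
      by (simp add: integral_add int')
  next
    fix r b
    have "?D (r *\<^sub>R b) = integral S (\<lambda>y. r *\<^sub>R f' a y b)"
      by (rule integral_cong) (simp add: lin linear_scale)
    then show "?D (r *\<^sub>R b) = r *\<^sub>R ?D b" by simp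
  qed
  then have bl: "bounded_linear ?D"
    by (simp add: linear_conv_bounded_linear)
  let ?E = "\<lambda>x. norm (integral S (f x) - integral S (f a) - ?D (x - a)) / norm (x - a)"
  have "(?E \<longlongrightarrow> 0) (at a within U)"
    unfolding tendsto_at_iff_sequentially
  proof (intro allI impI)
    fix X :: "nat \<Rightarrow> 'a"
    assume X: "\<forall>i. X i \<in> U - {a}" and lim: "X \<longlonglongrightarrow> a"
    define q where "q k y = (1 / norm (X k - a)) *\<^sub>R (f (X k) y - f a y - f' a y (X k - a))" for k y
    have intq: "q k integrable_on S" for k
      unfolding q_def using X U(3) by (intro integrable_cmul integrable_diff int int') auto
    have E: "(?E \<circ> X) k = norm (integral S (q k))" for k
    proof -
      have "integral S (q k) = (1 / norm (X k - a)) *\<^sub>R (integral S (f (X k)) - integral S (f a) - ?D (X k - a))"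
        unfolding q_def using X U(3) by (simp add: integral_diff int int' integrable_diff)
      then show ?thesis by simp
    qed
    have "(\<lambda>k. integral S (q k)) \<longlonglongrightarrow> integral S (\<lambda>y. 0)"
    proof (rule dominated_convergence(2)[OF intq])
      show "(\<lambda>y. 2 * g y) integrable_on S"
        using integrable_cmul[OF g, of 2] by simp
    next
      fix k y assume y: "y \<in> S"
      have "norm (f (X k) y - f a y) \<le> g y * norm (X k - a)"
        by (rule differentiable_bound[OF U(2), of _ "\<lambda>x. f' x y"])
           (use X U y der bnd in \<open>auto intro: has_derivative_at_withinI onorm_le\<close>)
      moreover have "norm (f' a y (X k - a)) \<le> g y * norm (X k - a)"
        using bnd U y by blast
      ultimately have "norm (f (X k) y - f a y - f' a y (X k - a)) \<le> 2 * g y * norm (X k - a)"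
        using norm_triangle_ineq4[of "f (X k) y - f a y" "f' a y (X k - a)"] by simp
      moreover have "norm (X k - a) > 0" using X by auto
      ultimately show "norm (q k y) \<le> 2 * g y"
        unfolding q_def norm_scaleR by (simp add: divide_le_eq)
    next
      fix y assume y: "y \<in> S"
      have "((\<lambda>x. f x y) has_derivative f' a y) (at a within U)"
        using der[OF U(3) y] by (rule has_derivative_at_withinI)
      then have "((\<lambda>x. (1 / norm (x - a)) *\<^sub>R (f x y - (f a y + f' a y (x - a)))) \<longlongrightarrow> 0) (at a within U)"
        unfolding has_derivative_within by simp
      then have "(\<lambda>k. (1 / norm (X k - a)) *\<^sub>R (f (X k) y - (f a y + f' a y (X k - a)))) \<longlonglongrightarrow> 0"
        unfolding tendsto_at_iff_sequentially comp_def using X lim by blast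
      then show "(\<lambda>k. q k y) \<longlonglongrightarrow> 0"
        by (simp add: q_def algebra_simps)
    qed
    then have "(\<lambda>k. norm (integral S (q k))) \<longlonglongrightarrow> 0"
      by (simp add: tendsto_norm_zero)
    then show "(?E \<circ> X) \<longlonglongrightarrow> 0"
      unfolding E[abs_def, symmetric] by (simp add: comp_def)
  qed
  then show ?thesis
    unfolding has_derivative_iff_norm using bl by (simp add: at_within_open[OF U(3) U(1)])
qed

text \<open>The matrix determinant lemma, by adding the rank-one term to one row after another.
  Linearity in row \<open>k\<close> leaves the previous determinant plus \<open>u $ k\<close> times
  a determinant whose row \<open>k\<close> is \<open>v\<close>.\<close>

lemma det_identity_plus_rank_one:
  fixes u v :: "real^'n::finite"
  shows "det (\<chi> i j. (if i = j then 1 else 0) + u $ i * v $ j) = 1 + u \<bullet> v"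
proof -
  have "det (\<chi> i. if i \<in> S then axis i 1 + u $ i *s v else axis i 1) = 1 + (\<Sum>i\<in>S. u $ i * v $ i)"
    if "finite S" for S :: "'n set"
    using that
  proof (induction S)
    case empty
    have "(\<chi> i. axis i 1) = (mat 1 :: real^'n^'n)"
      by (auto simp: vec_eq_iff axis_def mat_def)
    then show ?case by simp
  next
    case (insert k S)
    let ?R = "\<lambda>i. if i \<in> S then axis i 1 + u $ i *s v else axis i 1 :: real^'n"
    \<comment> \<open>Multiples of row \<open>k\<close>, which is \<open>v\<close>, can be removed
      from all other rows without changing the determinant; Cramer's rule evaluates what
      remains.\<close>
    have eq: "det (\<chi> i. if i = k then v else if i \<in> T then axis i 1 + u $ i *s v else axis i 1) = v $ k"
      if "finite T" "k \<notin> T" for T :: "'n set"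
      using that
    proof (induction T)
      case empty
      have "det (\<chi> i. if i = k then v else axis i 1) = det (transpose (\<chi> i j. if j = k then v $ i else mat 1 $ i $ j))"
        by (intro arg_cong[where f=det]) (auto simp: vec_eq_iff transpose_def mat_def axis_def)
      also have "\<dots> = det (\<chi> i j. if j = k then ((mat 1 :: real^'n^'n) *v v) $ i else mat 1 $ i $ j)"
        unfolding det_transpose matrix_vector_mul_lid ..
      also have "\<dots> = v $ k * det (mat 1 :: real^'n^'n)"
        by (rule cramer_lemma)
      finally show ?case by (simp cong: if_cong)
    next
      case (insert m T)
      let ?A = "(\<chi> i. if i = k then v else if i \<in> T then axis i 1 + u $ i *s v else axis i 1) :: real^'n^'n"
      have eqm: "(\<chi> i. if i = k then v else if i \<in> insert m T then axis i 1 + u $ i *s v else axis i 1)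
          = (\<chi> i. if i = m then row m ?A + u $ m *s row k ?A else row i ?A)"
        using insert by (auto simp: vec_eq_iff row_def)
      have "det (\<chi> i. if i = k then v else if i \<in> insert m T then axis i 1 + u $ i *s v else axis i 1)
          = det ?A"
        unfolding eqm by (rule det_row_operation) (use insert in auto)
      then show ?case using insert by simp
    qed
    have "(\<chi> i. if i \<in> insert k S then axis i 1 + u $ i *s v else axis i 1)
        = (\<chi> i. if i = k then axis i 1 + u $ i *s v else ?R i)"
      by (auto simp: vec_eq_iff)
    then have "det (\<chi> i. if i \<in> insert k S then axis i 1 + u $ i *s v else axis i 1)
        = det (\<chi> i. if i = k then axis i 1 else ?R i) + det (\<chi> i. if i = k then u $ i *s v else ?R i)"
      by (simp only: det_row_add)
    also have "(\<chi> i. if i = k then axis i 1 else ?R i) = (\<chi> i. ?R i)"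
      using insert by (auto simp: vec_eq_iff)
    also have "det (\<chi> i. if i = k then u $ i *s v else ?R i) = u $ k * det (\<chi> i. if i = k then v else ?R i)"
      using det_row_mul[of k "u $ k" "\<lambda>i. v" ?R] by (simp cong: if_cong)
    finally show ?case
      using insert eq[of S] by simp
  qed
  from this[of UNIV] have "det (\<chi> i. axis i 1 + u $ i *s v) = 1 + u \<bullet> v"
    by (simp add: inner_vec_def)
  moreover have "(\<chi> i. axis i 1 + u $ i *s v) = (\<chi> i j. (if i = j then 1 else 0) + u $ i * v $ j)"
    by (auto simp: vec_eq_iff axis_def)
  ultimately show ?thesis by simp

qed

text \<open>
  No implicit function theorem is needed: \<open>F (X, t) = 0\<close> determines \<open>t = \<tau> X\<close> on the set of those
  \<open>X\<close> for which a solution exists, and the differentiability of \<open>\<tau>\<close> relative to this set suffices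
  for Sard's theorem.
\<close>

lemma parametric_Sard:
  fixes F :: "(real^'n::finite) \<times> (real^'n) \<Rightarrow> real^'n"
  assumes T: "open T" and V: "open V" and c: "c > 0"
    and der: "\<And>X t. X \<in> V \<Longrightarrow> t \<in> T \<Longrightarrow> (F has_derivative F' (X, t)) (at (X, t))"
    and mono: "\<And>X s t. X \<in> V \<Longrightarrow> s \<in> T \<Longrightarrow> t \<in> T \<Longrightarrow> c * norm (s - t) \<le> norm (F (X, s) - F (X, t))"
  shows "negligible {t\<in>T. \<exists>X\<in>V. F (X, t) = 0 \<and> \<not> inj (\<lambda>h. F' (X, t) (h, 0))}"
proof -
  define S where "S = {X\<in>V. \<exists>t\<in>T. F (X, t) = 0 \<and> \<not> inj (\<lambda>h. F' (X, t) (h, 0))}"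
  define \<tau> where "\<tau> X = (SOME t. t \<in> T \<and> F (X, t) = 0)" for X
  have \<tau>: "\<tau> X \<in> T" "F (X, \<tau> X) = 0" if "X \<in> S" for X
    using someI_ex[of "\<lambda>t. t \<in> T \<and> F (X, t) = 0"] that unfolding \<tau>_def S_def by auto
  have uniq: "t = \<tau> X" if "X \<in> S" "t \<in> T" "F (X, t) = 0" for X t
    using mono[of X t "\<tau> X"] \<tau>[OF that(1)] that c by (auto simp: S_def mult_le_0_iff)
  have Bbnd: "c * norm s \<le> norm (F' (X, t) (0, s))" if X: "X \<in> V" "t \<in> T" for X t s
  proof (rule field_le_epsilon)
    fix e :: real assume e: "e > 0"
    define e' where "e' = e / (norm s + 1)"
    have s1: "norm s + 1 > 0" by (simp add: add_nonneg_pos)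
    have e': "e' > 0" "e' * norm s \<le> e"
      using e s1 by (auto simp: e'_def field_simps)
    from der[OF X] e'(1) obtain d where d: "d > 0"
      "\<And>p. norm (p - (X, t)) < d \<Longrightarrow> norm (F p - F (X, t) - F' (X, t) (p - (X, t))) \<le> e' * norm (p - (X, t))"
      unfolding has_derivative_at_alt by blast
    obtain d' where d': "d' > 0" "ball t d' \<subseteq> T"
      using T X(2) open_contains_ball by blast
    \<comment> \<open>So small that \<open>t + k *\<^sub>R s\<close> lies in \<open>T\<close> and
      within the range \<open>d\<close> of the linear approximation; the 1 added to
      \<open>norm s\<close> covers s = 0.\<close>
    define k where "k = min d d' / (2 * (norm s + 1))"
    have k: "k > 0" using d d' s1 by (simp add: k_def)
    have "k * norm s < k * (2 * (norm s + 1))" using k s1 by (intro mult_strict_left_mono) auto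
    also have "\<dots> = min d d'" using s1 by (simp add: k_def)
    finally have kd: "k * norm s < d" "k * norm s < d'" by auto
    have nrm: "norm ((X, t + k *\<^sub>R s) - (X, t)) = k * norm s"
      using k by (simp add: norm_Pair)
    have F's: "F' (X, t) ((X, t + k *\<^sub>R s) - (X, t)) = k *\<^sub>R F' (X, t) (0, s)"
      using linear_scale[OF has_derivative_linear[OF der[OF X]], of k "(0, s)"] by simp
    have "t + k *\<^sub>R s \<in> T"
      using d'(2) kd(2) k by (auto simp: dist_norm)
    then have "c * (k * norm s) \<le> norm (F (X, t + k *\<^sub>R s) - F (X, t))"
      using mono[OF X(1) _ X(2), of "t + k *\<^sub>R s"] k by simp
    also have "\<dots> \<le> norm (k *\<^sub>R F' (X, t) (0, s)) + norm (F (X, t + k *\<^sub>R s) - F (X, t) - k *\<^sub>R F' (X, t) (0, s))"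
      using norm_triangle_ineq[of "k *\<^sub>R F' (X, t) (0, s)" "F (X, t + k *\<^sub>R s) - F (X, t) - k *\<^sub>R F' (X, t) (0, s)"] by simp
    also have "\<dots> \<le> k * norm (F' (X, t) (0, s)) + e' * (k * norm s)"
      using d(2)[of "(X, t + k *\<^sub>R s)"] kd(1) k unfolding nrm F's by simp
    also have "\<dots> \<le> k * norm (F' (X, t) (0, s)) + k * e"
      using e'(2) k mult_left_mono[OF e'(2), of k] by (simp add: algebra_simps)
    finally have "k * (c * norm s) \<le> k * (norm (F' (X, t) (0, s)) + e)"
      by (simp add: algebra_simps)
    then show "c * norm s \<le> norm (F' (X, t) (0, s)) + e"
      using k by simp
  qed
  have dist: "\<exists>\<tau>'. (\<tau> has_derivative \<tau>') (at X within S) \<and> \<not> inj \<tau>'" if X: "X \<in> S" for X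
  proof -
    define t where "t = \<tau> X"
    have XV: "X \<in> V" and tT: "t \<in> T" and F0: "F (X, t) = 0"
      using X \<tau>[OF X] by (auto simp: S_def t_def)
    have noninj: "\<not> inj (\<lambda>h. F' (X, t) (h, 0))"
      using X uniq[OF X] unfolding S_def t_def by auto
    let ?A = "\<lambda>h. F' (X, t) (h, 0)" and ?B = "\<lambda>s. F' (X, t) (0, s)"
    have bl: "bounded_linear (F' (X, t))"
      using der[OF XV tT] by (rule has_derivative_bounded_linear)
    have blA: "bounded_linear ?A" and blB: "bounded_linear ?B"
      by (auto intro!: bounded_linear_compose[OF bl] bounded_linear_Pair bounded_linear_ident bounded_linear_zero)
    have F'_split: "F' (X, t) (h, s) = ?A h + ?B s" for h s
      using bounded_linear.linear[OF bl] linear_add[of "F' (X, t)" "(h, 0)" "(0, s)"] by simp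
    have "inj ?B"
      using Bbnd[OF XV tT] c unfolding linear_injective_0[OF bounded_linear.linear[OF blB]]
      by (metis mult_le_0_iff norm_eq_zero norm_le_zero_iff not_le)
    then obtain B' where B': "linear B'" "B' \<circ> ?B = id"
      using linear_injective_left_inverse[OF bounded_linear.linear[OF blB]] by auto
    have blB': "bounded_linear B'" using B'(1) by (simp add: linear_conv_bounded_linear)
    have B'B: "B' (?B s) = s" for s using B'(2) by (auto simp: fun_eq_iff)
    \<comment> \<open>Implicit differentiation of F (X, \<tau> X) = 0, where \<open>B'\<close>
      inverts the partial derivative in \<open>t\<close>. Two vectors identified by
      \<open>?A\<close> are also identified by this map, so non-injectivity is inherited.\<close>
    let ?\<tau>' = "\<lambda>h. - B' (?A h)"
    have "\<not> inj ?\<tau>'"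
    proof -
      obtain x y where "?A x = ?A y" "x \<noteq> y"
        using noninj unfolding inj_def by blast
      then have "?\<tau>' x = ?\<tau>' y" by simp
      then show ?thesis
        using \<open>x \<noteq> y\<close> unfolding inj_def by blast
    qed
    moreover have "(\<tau> has_derivative ?\<tau>') (at X within S)"
    proof -
      have bl\<tau>: "bounded_linear ?\<tau>'"
        by (intro bounded_linear_minus bounded_linear_compose[OF blB' blA])
      obtain KA where KA: "KA > 0" "\<And>h. norm (?A h) \<le> norm h * KA"
        using bounded_linear.pos_bounded[OF blA] by blast
      obtain KB where KB: "KB > 0" "\<And>h. norm (B' h) \<le> norm h * KB"
        using bounded_linear.pos_bounded[OF blB'] by blast
      have err: "\<exists>d>0. \<forall>X' t'. norm (X' - X) + norm (t' - t) < d \<longrightarrow>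
          norm (F (X', t') - ?A (X' - X) - ?B (t' - t)) \<le> e * (norm (X' - X) + norm (t' - t))"
        if "e > 0" for e
      proof -
        from der[OF XV tT] that obtain d where d: "d > 0"
          "\<And>p. norm (p - (X, t)) < d \<Longrightarrow> norm (F p - F (X, t) - F' (X, t) (p - (X, t))) \<le> e * norm (p - (X, t))"
          unfolding has_derivative_at_alt by blast
        show ?thesis
        proof (intro exI[of _ d] conjI allI impI d(1))
          fix X' t' assume "norm (X' - X) + norm (t' - t) < d"
          moreover have le: "norm ((X', t') - (X, t)) \<le> norm (X' - X) + norm (t' - t)"
            using norm_Pair_le[of "X' - X" "t' - t"] by simp
          ultimately have "norm (F (X', t') - F (X, t) - F' (X, t) ((X', t') - (X, t))) \<le> e * norm ((X', t') - (X, t))"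
            by (intro d(2)) auto
          also have "\<dots> \<le> e * (norm (X' - X) + norm (t' - t))"
            using le that by (intro mult_left_mono) auto
          finally show "norm (F (X', t') - ?A (X' - X) - ?B (t' - t)) \<le> e * (norm (X' - X) + norm (t' - t))"
            by (simp add: F0 F'_split[of "X' - X" "t' - t"] diff_diff_eq)
        qed
      qed
      \<comment> \<open>As F (X', \<tau> X') = 0, monotonicity gives c |\<tau> X' - t| <= |F (X',
        t)|, and the linear approximation with relative error 1 bounds the right side by (KA + 1)
        |X' - X|.\<close>
      define L where "L = (KA + 1) / c"
      have L: "L > 0" using KA c by (simp add: L_def)
      obtain d1 where d1: "d1 > 0" "\<And>X' t'. norm (X' - X) + norm (t' - t) < d1 \<Longrightarrow>
          norm (F (X', t') - ?A (X' - X) - ?B (t' - t)) \<le> 1 * (norm (X' - X) + norm (t' - t))"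
        using err[of 1] by auto
      have lip: "norm (\<tau> X' - t) \<le> L * norm (X' - X)" if "X' \<in> S" "norm (X' - X) < d1" for X'
      proof -
        have "c * norm (\<tau> X' - t) \<le> norm (F (X', \<tau> X') - F (X', t))"
          using that tT \<tau> by (intro mono) (auto simp: S_def)
        also have "\<dots> = norm (F (X', t))"
          using \<tau>[OF that(1)] by simp
        also have "\<dots> \<le> norm (F (X', t) - ?A (X' - X)) + norm (?A (X' - X))"
          using norm_triangle_ineq[of "F (X', t) - ?A (X' - X)" "?A (X' - X)"] by simp
        also have "\<dots> \<le> norm (X' - X) + norm (X' - X) * KA"
          using d1(2)[of X' t] that KA(2)[of "X' - X"] linear_0[OF bounded_linear.linear[OF blB]]
          by (intro add_mono) auto
        finally show ?thesis
          using c by (simp add: L_def field_simps)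
      qed
      show ?thesis
        unfolding has_derivative_within_alt
      proof (intro conjI allI impI bl\<tau>)
        fix e :: real assume e: "e > 0"
        \<comment> \<open>The Lipschitz bound turns the error into a multiple 1 + L of |X' - X|, and
          applying \<open>B'\<close> costs the factor \<open>KB\<close>.\<close>
        define e' where "e' = e / (KB * (1 + L))"
        have e': "e' > 0" using e KB L by (simp add: e'_def)
        obtain d2 where d2: "d2 > 0" "\<And>X' t'. norm (X' - X) + norm (t' - t) < d2 \<Longrightarrow>
          norm (F (X', t') - ?A (X' - X) - ?B (t' - t)) \<le> e' * (norm (X' - X) + norm (t' - t))"
          using err[OF e'] by auto
        have "norm (\<tau> X' - \<tau> X - ?\<tau>' (X' - X)) \<le> e * norm (X' - X)"
          if X': "X' \<in> S" "norm (X' - X) < min d1 (d2 / (1 + L))" for X'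
        proof -
          have l: "norm (\<tau> X' - t) \<le> L * norm (X' - X)"
            using lip X' by simp
          have "(1 + L) * norm (X' - X) < d2"
            using X'(2) L by (simp add: field_simps)
          then have "norm (X' - X) + norm (\<tau> X' - t) < d2"
            using l by (simp add: algebra_simps)
          from d2(2)[OF this] have E: "norm (- ?A (X' - X) - ?B (\<tau> X' - t)) \<le> e' * (norm (X' - X) + norm (\<tau> X' - t))"
            using \<tau>[OF X'(1)] by simp
          have "norm (\<tau> X' - \<tau> X - ?\<tau>' (X' - X)) = norm (B' (- ?A (X' - X) - ?B (\<tau> X' - t)))"
          proof -
            have eq: "B' (- ?A (X' - X) - ?B (\<tau> X' - t)) = - (\<tau> X' - t - ?\<tau>' (X' - X))"
              by (simp add: linear_diff[OF B'(1)] linear_neg[OF B'(1)] B'B)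
            show ?thesis unfolding eq norm_minus_cancel by (simp add: t_def)
          qed
          also have "\<dots> \<le> norm (- ?A (X' - X) - ?B (\<tau> X' - t)) * KB" by (rule KB)
          also have "\<dots> \<le> (e' * (norm (X' - X) + norm (\<tau> X' - t))) * KB"
            using E KB(1) by (intro mult_right_mono) auto
          also have "\<dots> \<le> (e' * (norm (X' - X) + L * norm (X' - X))) * KB"
            using l e' KB(1) by (intro mult_right_mono mult_left_mono) auto
          also have "\<dots> = e * norm (X' - X)"
          proof -
            have "KB * (1 + L) \<noteq> 0" using KB L by auto
            moreover have "(e' * (norm (X' - X) + L * norm (X' - X))) * KB = e' * (KB * (1 + L)) * norm (X' - X)"
              by (simp add: algebra_simps)
            ultimately show ?thesis by (simp add: e'_def)
          qed
          finally show ?thesis .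
        qed
        moreover have "min d1 (d2 / (1 + L)) > 0" using d1 d2 L by simp
        ultimately show "\<exists>d>0. \<forall>y\<in>S. norm (y - X) < d \<longrightarrow> norm (\<tau> y - \<tau> X - ?\<tau>' (y - X)) \<le> e * norm (y - X)"
          by blast
      qed
    qed
    ultimately show ?thesis by blast
  qed
  then obtain \<tau>' where \<tau>': "\<And>X. X \<in> S \<Longrightarrow> (\<tau> has_derivative \<tau>' X) (at X within S) \<and> \<not> inj (\<tau>' X)"
    by metis
  have "negligible (\<tau> ` S)"
    by (rule negligible_singular_image[of S \<tau> \<tau>']) (use \<tau>' in auto)
  moreover have "{t\<in>T. \<exists>X\<in>V. F (X, t) = 0 \<and> \<not> inj (\<lambda>h. F' (X, t) (h, 0))} \<subseteq> \<tau> ` S"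
  proof
    fix t assume "t \<in> {t\<in>T. \<exists>X\<in>V. F (X, t) = 0 \<and> \<not> inj (\<lambda>h. F' (X, t) (h, 0))}"
    then obtain X where "X \<in> S" "t \<in> T" "F (X, t) = 0" by (auto simp: S_def)
    then show "t \<in> \<tau> ` S" using uniq by blast
  qed
  ultimately show ?thesis by (rule negligible_subset)
qed

section \<open>Spaces of bounded functions with two derivatives\<close>

text \<open>A relation that names the derivative on the whole space, so that sum and product rules
  can be chained and \<open>partial\<close> is read off afterwards.\<close>

definition has_pderiv :: "'n::finite \<Rightarrow> (real^'n \<Rightarrow> real) \<Rightarrow> (real^'n \<Rightarrow> real) \<Rightarrow> bool" where
  "has_pderiv i f f' \<longleftrightarrow> (\<forall>x. ((\<lambda>t. f (x + t *\<^sub>R axis i 1)) has_real_derivative f' x) (at 0))"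

lemma has_partial_iff_has_pderiv: "(\<forall>x. has_partial i f x) \<longleftrightarrow> has_pderiv i f (partial i f)"
  unfolding has_partial_def has_pderiv_def partial_def
  by (metis DERIV_imp_deriv real_differentiable_def)

lemma has_pderiv_imp_partial: "has_pderiv i f f' \<Longrightarrow> partial i f = f'"
  unfolding has_pderiv_def partial_def by (auto intro!: ext DERIV_imp_deriv)

lemma has_pderiv_imp_has_partial: "has_pderiv i f f' \<Longrightarrow> has_partial i f x"
  using has_partial_iff_has_pderiv has_pderiv_imp_partial by blast

lemma has_derivative_imp_partial:
  assumes "(f has_derivative f') (at x)"
  shows "has_partial i f x" "partial i f x = f' (axis i 1)"
proof -
  have "((\<lambda>t. x + t *\<^sub>R axis i 1) has_derivative (\<lambda>t. t *\<^sub>R axis i 1)) (at (0::real))"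
    by (auto intro!: derivative_eq_intros)
  from has_derivative_compose[OF this, of f f'] assms
  have "((\<lambda>t. f (x + t *\<^sub>R axis i 1)) has_derivative (\<lambda>t. f' (t *\<^sub>R axis i 1))) (at 0)"
    by simp
  then have "((\<lambda>t. f (x + t *\<^sub>R axis i 1)) has_real_derivative f' (axis i 1)) (at 0)"
    using linear_scale[OF has_derivative_linear[OF assms]]
    by (simp add: has_field_derivative_def mult.commute[of _ "f' (axis i 1)"] mult_commute_abs)
  then show "has_partial i f x" "partial i f x = f' (axis i 1)"
    unfolding has_partial_def partial_def
    by (auto intro: DERIV_imp_deriv simp: real_differentiable_def)
qed

text \<open>Partial derivatives depend only on nearby values; this allows formulas that hold only on
  the deformed domain to be differentiated again.\<close>

lemma partial_cong_open:
  assumes "open U" "x \<in> U" "\<And>y. y \<in> U \<Longrightarrow> f y = g y"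
  shows "has_partial i f x \<longleftrightarrow> has_partial i g x" "partial i f x = partial i g x"
proof -
  have "\<forall>\<^sub>F t in nhds 0. x + t *\<^sub>R axis i 1 \<in> U"
  proof -
    have "((\<lambda>t. x + t *\<^sub>R axis i 1) \<longlongrightarrow> x + 0 *\<^sub>R axis i 1) (nhds (0::real))"
      by (intro tendsto_intros) (simp add: filterlim_ident)
    then show ?thesis
      using assms(1,2) by (auto dest: topological_tendstoD)
  qed
  then have ev: "\<forall>\<^sub>F t in nhds 0. f (x + t *\<^sub>R axis i 1) = g (x + t *\<^sub>R axis i 1)"
    by eventually_elim (use assms(3) in auto)
  have "((\<lambda>t. f (x + t *\<^sub>R axis i 1)) has_real_derivative d) (at 0) \<longleftrightarrow>
      ((\<lambda>t. g (x + t *\<^sub>R axis i 1)) has_real_derivative d) (at 0)" for d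
    by (rule DERIV_cong_ev[OF refl ev refl])
  then show "has_partial i f x \<longleftrightarrow> has_partial i g x" "partial i f x = partial i g x"
    unfolding has_partial_def partial_def deriv_def real_differentiable_def by auto
qed

lemma has_pderiv_line:
  assumes "has_pderiv i f f'"
  shows "((\<lambda>t. f (z + t *\<^sub>R axis i 1)) has_real_derivative f' (z + s *\<^sub>R axis i 1)) (at s)"
proof -
  have "((\<lambda>t. f ((z + s *\<^sub>R axis i 1) + t *\<^sub>R axis i 1)) has_real_derivative f' (z + s *\<^sub>R axis i 1)) (at 0)"
    using assms by (auto simp: has_pderiv_def)
  then have "((\<lambda>t. f (z + (t + s) *\<^sub>R axis i 1)) has_real_derivative f' (z + s *\<^sub>R axis i 1)) (at 0)"
    by (simp add: algebra_simps)
  then show ?thesis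
    using DERIV_shift[of "\<lambda>t. f (z + t *\<^sub>R axis i 1)" _ 0 s] by simp
qed

text \<open>The increment is split into moves along one coordinate at a time, and on each of them
  the mean value inequality is applied to \<open>f\<close> minus its linear part.\<close>

lemma has_derivative_continuous_partials:
  fixes f :: "real^'n::finite \<Rightarrow> real"
  assumes has_pderiv: "\<And>i. has_pderiv i f (f' i)" and cont: "\<And>i. continuous_on UNIV (f' i)"
  shows "(f has_derivative (\<lambda>h. \<Sum>i\<in>UNIV. h $ i * f' i x)) (at x)"
  unfolding has_derivative_at_alt
proof (intro conjI allI impI)
  show "bounded_linear (\<lambda>h. \<Sum>i\<in>UNIV. h $ i * f' i x)"
    by (intro bounded_linear_sum bounded_linear_mult_const bounded_linear_vec_nth)
  fix e :: real assume e: "e > 0"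
  define e' where "e' = e / CARD('n)"
  have e': "e' > 0" using e by (simp add: e'_def)
  have "\<exists>d>0. \<forall>y. norm (y - x) < d \<longrightarrow> \<bar>f' i y - f' i x\<bar> < e'" for i
    using cont[of i] e' by (auto simp: continuous_on_iff dist_norm)
  then obtain D where D: "\<And>i. D i > 0" "\<And>i y. norm (y - x) < D i \<Longrightarrow> \<bar>f' i y - f' i x\<bar> < e'"
    by metis
  define d where "d = Min (range D)"
  have d: "d > 0" using D(1) by (simp add: d_def)
  have d_le: "d \<le> D i" for i by (simp add: d_def)
  \<comment> \<open>\<open>S\<close> is the set of coordinates already moved; intermediate points
    stay within \<open>norm h\<close> of \<open>x\<close>, where each partial derivative varies by
    less than \<open>e'\<close>.\<close>
  have main: "\<bar>f (x + (\<Sum>i\<in>S. h $ i *\<^sub>R axis i 1)) - f x - (\<Sum>i\<in>S. h $ i * f' i x)\<bar> \<le> (\<Sum>i\<in>S. e' * \<bar>h $ i\<bar>)"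
    if h: "norm h < d" and "finite S" for h :: "real^'n" and S
    using that(2)
  proof (induction S)
    case (insert k S)
    let ?z = "x + (\<Sum>i\<in>S. h $ i *\<^sub>R axis i 1)"
    have bd: "\<bar>f' k (?z + s *\<^sub>R axis k 1) - f' k x\<bar> \<le> e'" if "s \<in> closed_segment 0 (h $ k)" for s
    proof -
      have "\<bar>s\<bar> \<le> \<bar>h $ k\<bar>"
        using segment_bound1[OF that] by simp
      then have "norm ((\<Sum>i\<in>S. h $ i *\<^sub>R axis i 1) + s *\<^sub>R axis k 1 :: real^'n) \<le> norm h"
        using insert.hyps
        by (intro norm_le_componentwise_cart) (auto simp: axis_def if_distrib cong: if_cong)
      then have "norm (?z + s *\<^sub>R axis k 1 - x) < D k"
        using h d_le[of k] by simp
      then show ?thesis using D(2) by fastforce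
    qed
    have "norm ((f (?z + (h $ k) *\<^sub>R axis k 1) - h $ k * f' k x) - (f (?z + 0 *\<^sub>R axis k 1) - 0 * f' k x))
        \<le> e' * norm (h $ k - 0)"
    proof (rule field_differentiable_bound[of "closed_segment 0 (h $ k)" _ "\<lambda>s. f' k (?z + s *\<^sub>R axis k 1) - f' k x"])
      show "((\<lambda>s. f (?z + s *\<^sub>R axis k 1) - s * f' k x) has_field_derivative
          f' k (?z + s *\<^sub>R axis k 1) - f' k x) (at s within closed_segment 0 (h $ k))" for s
        using DERIV_diff[OF has_field_derivative_at_within[OF has_pderiv_line[OF has_pderiv]] DERIV_cmult_right[OF DERIV_ident]] by simp
    qed (use bd in auto)
    then have "\<bar>f (?z + (h $ k) *\<^sub>R axis k 1) - f ?z - h $ k * f' k x\<bar> \<le> e' * \<bar>h $ k\<bar>"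
      by (simp add: algebra_simps)
    moreover have "x + (\<Sum>i\<in>insert k S. h $ i *\<^sub>R axis i 1) = ?z + (h $ k) *\<^sub>R axis k 1"
      using insert.hyps by simp
    moreover have "(\<Sum>i\<in>insert k S. h $ i * f' i x) = h $ k * f' k x + (\<Sum>i\<in>S. h $ i * f' i x)"
      "(\<Sum>i\<in>insert k S. e' * \<bar>h $ i\<bar>) = e' * \<bar>h $ k\<bar> + (\<Sum>i\<in>S. e' * \<bar>h $ i\<bar>)"
      using insert.hyps by simp_all
    ultimately show ?case
      using insert.IH by (simp only:)
  qed simp
  show "\<exists>d>0. \<forall>y. norm (y - x) < d \<longrightarrow>
      norm (f y - f x - (\<Sum>i\<in>UNIV. (y - x) $ i * f' i x)) \<le> e * norm (y - x)"
  proof (intro exI[of _ d] conjI d allI impI)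
    fix y assume y: "norm (y - x) < d"
    have "(\<Sum>i\<in>UNIV. (y - x) $ i *\<^sub>R axis i 1) = y - x"
      using basis_expansion[of "y - x"] by (simp add: scalar_mult_eq_scaleR)
    then have "norm (f y - f x - (\<Sum>i\<in>UNIV. (y - x) $ i * f' i x)) \<le> (\<Sum>i\<in>UNIV. e' * \<bar>(y - x) $ i\<bar>)"
      using main[OF y, of UNIV] by simp
    also have "\<dots> \<le> (\<Sum>i\<in>(UNIV::'n set). e' * norm (y - x))"
      using e' by (intro sum_mono mult_left_mono) (auto intro: component_le_norm_cart simp del: vector_minus_component)
    also have "\<dots> = e * norm (y - x)" by (simp add: e'_def)
    finally show "norm (f y - f x - (\<Sum>i\<in>UNIV. (y - x) $ i * f' i x)) \<le> e * norm (y - x)" .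
  qed
qed

section \<open>Bounded functions with k bounded continuous derivatives\<close>

fun Cb :: "nat \<Rightarrow> (real^'n::finite \<Rightarrow> real) \<Rightarrow> bool" where
  "Cb 0 f \<longleftrightarrow> continuous_on UNIV f \<and> bounded (range f)"
| "Cb (Suc k) f \<longleftrightarrow> continuous_on UNIV f \<and> bounded (range f) \<and> (\<forall>i. has_pderiv i f (partial i f) \<and> Cb k (partial i f))"

lemma Cb_SucI:
  assumes "continuous_on UNIV f" "bounded (range f)" "\<And>i. has_pderiv i f (f' i)" "\<And>i. Cb k (f' i)"
  shows "Cb (Suc k) f"
  unfolding Cb.simps has_pderiv_imp_partial[OF assms(3)] using assms by blast

lemma Cb_cont_bounded: "Cb k f \<Longrightarrow> continuous_on UNIV f \<and> bounded (range f)"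
  by (cases k) auto

lemma Cb_mono_Suc: "Cb (Suc k) f \<Longrightarrow> Cb k f"
  by (induction k arbitrary: f) auto

lemma Cb_const: "Cb k (\<lambda>x. c)"
proof (induction k arbitrary: c)
  case (Suc k)
  show ?case
    by (rule Cb_SucI[where f'="\<lambda>i x. 0"]) (auto simp: has_pderiv_def Suc)
qed auto

lemma has_pderiv_add: "has_pderiv i f f' \<Longrightarrow> has_pderiv i g g' \<Longrightarrow> has_pderiv i (\<lambda>x. f x + g x) (\<lambda>x. f' x + g' x)"
  by (auto simp: has_pderiv_def intro!: derivative_eq_intros)

lemma has_pderiv_mult: "has_pderiv i f f' \<Longrightarrow> has_pderiv i g g' \<Longrightarrow> has_pderiv i (\<lambda>x. f x * g x) (\<lambda>x. f' x * g x + f x * g' x)"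
  unfolding has_pderiv_def by (force intro!: derivative_eq_intros)

lemma Cb_add: "Cb k f \<Longrightarrow> Cb k g \<Longrightarrow> Cb k (\<lambda>x. f x + g x)"
proof (induction k arbitrary: f g)
  case (Suc k)
  then show ?case
    by (intro Cb_SucI[where f'="\<lambda>i x. partial i f x + partial i g x"])
       (auto intro!: continuous_intros has_pderiv_add Suc.IH bounded_plus_comp)
qed (auto intro!: continuous_intros bounded_plus_comp)

lemma bounded_range_mult:
  fixes f g :: "'a \<Rightarrow> real"
  assumes "bounded (range f)" "bounded (range g)"
  shows "bounded (range (\<lambda>x. f x * g x))"
proof -
  obtain B C where B: "\<And>x. \<bar>f x\<bar> \<le> B" and C: "\<And>x. \<bar>g x\<bar> \<le> C"
    using assms by (auto simp: bounded_iff)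
  have "\<bar>f x * g x\<bar> \<le> B * C" for x
    unfolding abs_mult using B[of x] C[of x] by (intro mult_mono) auto
  then show ?thesis
    by (auto simp: bounded_iff)
qed

lemma Cb_mult: "Cb k f \<Longrightarrow> Cb k g \<Longrightarrow> Cb k (\<lambda>x. f x * g x)"
proof (induction k arbitrary: f g)
  case (Suc k)
  have "Cb k f" "Cb k g"
    using Suc.prems Cb_mono_Suc by blast+
  with Suc show ?case
    by (intro Cb_SucI[where f'="\<lambda>i x. partial i f x * g x + f x * partial i g x"])
       (auto intro!: continuous_intros has_pderiv_mult Cb_add Suc.IH bounded_range_mult)
qed (auto intro!: continuous_intros bounded_range_mult)

lemma Cb_sum: "(\<And>i. i \<in> I \<Longrightarrow> Cb k (f i)) \<Longrightarrow> Cb k (\<lambda>x. \<Sum>i\<in>I. f i x)"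
  by (induction I rule: infinite_finite_induct) (auto intro: Cb_add Cb_const)

lemma iter_partial_snoc: "iter_partial (is @ [i]) f = iter_partial is (partial i f)"
  by (induction "is") auto

lemma Cb_iter_partial:
  assumes "Cb k f" "length is \<le> k"
  shows "Cb (k - length is) (iter_partial is f)"
  using assms
proof (induction "is" arbitrary: k f rule: rev_induct)
  case (snoc i js)
  then obtain m where m: "k = Suc m" by (cases k) auto
  have "Cb (m - length js) (iter_partial js (partial i f))"
    using snoc.prems unfolding m by (intro snoc.IH) auto
  then show ?case by (simp add: iter_partial_snoc m)
qed simp

text \<open>\<open>Cb\<close> differentiates once and recurs on the result, which suits inductions
  for sums and products, whereas \<open>iter_partial\<close> peels off the outermost derivative.
  Working from the end of the index list reconciles the two.\<close>

lemma Cb_iff: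
  fixes f :: "real^'n::finite \<Rightarrow> real"
  shows "Cb k f \<longleftrightarrow> Ck_on k UNIV f \<and> (\<forall>is. length is \<le> k \<longrightarrow> bounded (range (iter_partial is f)))"
proof
  assume *: "Cb k f"
  have "has_partial i (iter_partial is f) x" if "length is < k" for "is" i x
  proof -
    obtain m where "k - length is = Suc m" using \<open>length is < k\<close> by (metis Suc_diff_Suc)
    then show ?thesis
      using Cb_iter_partial[OF *, of "is"] that by (auto intro: has_pderiv_imp_has_partial)
  qed
  moreover have "continuous_on UNIV (iter_partial is f) \<and> bounded (range (iter_partial is f))" if "length is \<le> k" for "is"
    using Cb_iter_partial[OF * that] by (rule Cb_cont_bounded)
  ultimately show "Ck_on k UNIV f \<and> (\<forall>is. length is \<le> k \<longrightarrow> bounded (range (iter_partial is f)))"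
    by (auto simp: Ck_on_def)
next
  show "Ck_on k UNIV f \<and> (\<forall>is. length is \<le> k \<longrightarrow> bounded (range (iter_partial is f))) \<Longrightarrow> Cb k f"
  proof (induction k arbitrary: f)
    case 0
    then have "continuous_on UNIV (iter_partial [] f)" "bounded (range (iter_partial [] f))"
      unfolding Ck_on_def by blast+
    then show ?case by simp
  next
    case (Suc k)
    then have hp: "\<And>is i x. length is < Suc k \<Longrightarrow> has_partial i (iter_partial is f) x"
      and ct: "\<And>is. length is \<le> Suc k \<Longrightarrow> continuous_on UNIV (iter_partial is f) \<and> bounded (range (iter_partial is f))"
      by (auto simp: Ck_on_def)
    have "Cb k (partial i f)" for i
    proof (rule Suc.IH, unfold Ck_on_def, intro conjI allI impI ballI)
      fix "is" :: "'n list" and j x assume "length is < k"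
      then show "has_partial j (iter_partial is (partial i f)) x"
        using hp[of "is @ [i]" j x] by (simp add: iter_partial_snoc)
    next
      fix "is" :: "'n list" assume "length is \<le> k"
      then show "continuous_on UNIV (iter_partial is (partial i f))"
        "bounded (range (iter_partial is (partial i f)))"
        unfolding iter_partial_snoc[symmetric] using ct[of "is @ [i]"] by auto
    qed
    moreover have "has_pderiv i f (partial i f)" for i
      using hp[of "[]" i] has_partial_iff_has_pderiv[of i f] by auto
    ultimately show ?case
      using ct[of "[]"] by simp
  qed
qed

lemma iter_partial_add:
  assumes "Cb k f" "Cb k g" "length is \<le> k"
  shows "iter_partial is (\<lambda>x. f x + g x) = (\<lambda>x. iter_partial is f x + iter_partial is g x)"
  using assms
proof (induction "is" arbitrary: k f g rule: rev_induct)
  case (snoc i js)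
  then obtain m where m: "k = Suc m" by (cases k) auto
  have "partial i (\<lambda>x. f x + g x) = (\<lambda>x. partial i f x + partial i g x)"
    using snoc.prems unfolding m by (intro has_pderiv_imp_partial has_pderiv_add) auto
  then show ?case
    using snoc.prems snoc.IH[of m "partial i f" "partial i g"] unfolding m by (simp add: iter_partial_snoc)
qed simp

lemma iter_partial_cmult:
  assumes "Cb k f" "length is \<le> k"
  shows "iter_partial is (\<lambda>x. c * f x) = (\<lambda>x. c * iter_partial is f x)"
  using assms
proof (induction "is" arbitrary: k f rule: rev_induct)
  case (snoc i js)
  then obtain m where m: "k = Suc m" by (cases k) auto
  have "partial i (\<lambda>x. c * f x) = (\<lambda>x. 0 * f x + c * partial i f x)"
    using snoc.prems unfolding m by (intro has_pderiv_imp_partial has_pderiv_mult) (auto simp: has_pderiv_def)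
  then show ?case
    using snoc.prems snoc.IH[of m "partial i f"] unfolding m by (simp add: iter_partial_snoc)
qed simp

text \<open>There are only finitely many index lists of length at most 2, so a common bound exists
  as soon as each iterated partial derivative is bounded.\<close>

lemma C2_space_iff:
  fixes \<theta> :: "real^'n::finite \<Rightarrow> real^'n"
  shows "\<theta> \<in> C2_space \<longleftrightarrow> (\<forall>k. Cb 2 (\<lambda>y. \<theta> y $ k))"
proof -
  have "bdd_above (C2_vals \<theta>) \<longleftrightarrow> (\<forall>k is. length is \<le> 2 \<longrightarrow> bounded (range (iter_partial is (\<lambda>y. \<theta> y $ k))))"
  proof
    assume "bdd_above (C2_vals \<theta>)"
    then show "\<forall>k is. length is \<le> 2 \<longrightarrow> bounded (range (iter_partial is (\<lambda>y. \<theta> y $ k)))"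
      unfolding bdd_above_def C2_vals_def bounded_iff by fastforce
  next
    assume R: "\<forall>k is. length is \<le> 2 \<longrightarrow> bounded (range (iter_partial is (\<lambda>y. \<theta> y $ k)))"
    have eq: "C2_vals \<theta> = (\<Union>k. \<Union>is\<in>{is. set is \<subseteq> UNIV \<and> length is \<le> 2}. range (\<lambda>x. \<bar>iter_partial is (\<lambda>y. \<theta> y $ k) x\<bar>))"
      by (auto simp: C2_vals_def)
    have "bounded (range (\<lambda>x. \<bar>iter_partial is (\<lambda>y. \<theta> y $ k) x\<bar>))" if "length is \<le> 2" for "is" k
      using R that by (auto simp: bounded_iff)
    then have "bounded (C2_vals \<theta>)"
      unfolding eq using finite_lists_length_le[of "UNIV::'n set" 2]
      by (intro bounded_UN ballI) auto
    then show "bdd_above (C2_vals \<theta>)"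
      by (rule bounded_imp_bdd_above)
  qed
  then show ?thesis
    by (auto simp: C2_space_def Cb_iff)
qed

lemma C2_norm_ge:
  assumes "\<theta> \<in> C2_space" "length is \<le> 2"
  shows "\<bar>iter_partial is (\<lambda>y. \<theta> y $ k) x\<bar> \<le> C2_norm \<theta>"
  unfolding C2_norm_def
  by (rule cSup_upper) (use assms in \<open>auto simp: C2_vals_def C2_space_def\<close>)

lemma C2_norm_le:
  assumes "\<And>is k x. length is \<le> 2 \<Longrightarrow> \<bar>iter_partial is (\<lambda>y. \<theta> y $ k) x\<bar> \<le> M"
  shows "C2_norm \<theta> \<le> M"
  unfolding C2_norm_def
proof (rule cSup_least)
  have "\<bar>iter_partial [] (\<lambda>y. \<theta> y $ undefined) 0\<bar> \<in> C2_vals \<theta>"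
    unfolding C2_vals_def by (intro CollectI exI[of _ "[]"] exI) auto
  then show "C2_vals \<theta> \<noteq> {}" by blast
qed (use assms in \<open>auto simp: C2_vals_def\<close>)

lemma C2_norm_nonneg: "\<theta> \<in> C2_space \<Longrightarrow> 0 \<le> C2_norm \<theta>"
  using C2_norm_ge[of \<theta> "[]" undefined 0] by simp

lemma C2_space_add:
  fixes \<theta> \<eta> :: "real^'n::finite \<Rightarrow> real^'n"
  assumes "\<theta> \<in> C2_space" "\<eta> \<in> C2_space"
  shows "(\<lambda>x. \<theta> x + \<eta> x) \<in> C2_space" "C2_norm (\<lambda>x. \<theta> x + \<eta> x) \<le> C2_norm \<theta> + C2_norm \<eta>"
proof -
  show "(\<lambda>x. \<theta> x + \<eta> x) \<in> C2_space"
    using assms by (auto simp: C2_space_iff Cb_add)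
  show "C2_norm (\<lambda>x. \<theta> x + \<eta> x) \<le> C2_norm \<theta> + C2_norm \<eta>"
  proof (rule C2_norm_le)
    fix "is" :: "'n list" and k x assume l: "length is \<le> 2"
    have "iter_partial is (\<lambda>y. (\<theta> y + \<eta> y) $ k) x = iter_partial is (\<lambda>y. \<theta> y $ k) x + iter_partial is (\<lambda>y. \<eta> y $ k) x"
      using iter_partial_add[of 2 "\<lambda>y. \<theta> y $ k" "\<lambda>y. \<eta> y $ k" "is"] assms l by (simp add: C2_space_iff)
    then show "\<bar>iter_partial is (\<lambda>y. (\<theta> y + \<eta> y) $ k) x\<bar> \<le> C2_norm \<theta> + C2_norm \<eta>"
      using C2_norm_ge[OF assms(1) l, of k x] C2_norm_ge[OF assms(2) l, of k x] by linarith
  qed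
qed

lemma C2_space_scale:
  fixes \<theta> :: "real^'n::finite \<Rightarrow> real^'n"
  assumes "\<theta> \<in> C2_space"
  shows "(\<lambda>x. c *\<^sub>R \<theta> x) \<in> C2_space" "C2_norm (\<lambda>x. c *\<^sub>R \<theta> x) \<le> \<bar>c\<bar> * C2_norm \<theta>"
proof -
  show "(\<lambda>x. c *\<^sub>R \<theta> x) \<in> C2_space"
    using assms by (auto simp: C2_space_iff Cb_mult Cb_const)
  show "C2_norm (\<lambda>x. c *\<^sub>R \<theta> x) \<le> \<bar>c\<bar> * C2_norm \<theta>"
  proof (rule C2_norm_le)
    fix "is" :: "'n list" and k x assume l: "length is \<le> 2"
    have "iter_partial is (\<lambda>y. (c *\<^sub>R \<theta> y) $ k) x = c * iter_partial is (\<lambda>y. \<theta> y $ k) x"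
      using iter_partial_cmult[of 2 "\<lambda>y. \<theta> y $ k" "is" c] assms l by (simp add: C2_space_iff)
    then show "\<bar>iter_partial is (\<lambda>y. (c *\<^sub>R \<theta> y) $ k) x\<bar> \<le> \<bar>c\<bar> * C2_norm \<theta>"
      using C2_norm_ge[OF assms(1) l, of k x] by (simp add: abs_mult mult_left_mono)
  qed
qed

lemma C2_space_diff:
  fixes \<theta> \<eta> :: "real^'n::finite \<Rightarrow> real^'n"
  assumes "\<theta> \<in> C2_space" "\<eta> \<in> C2_space"
  shows "(\<lambda>x. \<theta> x - \<eta> x) \<in> C2_space"
  using C2_space_add(1)[OF assms(1) C2_space_scale(1)[OF assms(2), of "-1"]] by simp

lemma C2_space_sum:
  fixes \<theta> :: "'i \<Rightarrow> real^'n::finite \<Rightarrow> real^'n"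
  assumes "finite I" "\<And>i. i \<in> I \<Longrightarrow> \<theta> i \<in> C2_space"
  shows "(\<lambda>x. \<Sum>i\<in>I. \<theta> i x) \<in> C2_space \<and> C2_norm (\<lambda>x. \<Sum>i\<in>I. \<theta> i x) \<le> (\<Sum>i\<in>I. C2_norm (\<theta> i))"
  using assms
proof (induction I)
  case empty
  have "(\<lambda>x. 0 :: real^'n) \<in> C2_space"
    by (simp add: C2_space_iff Cb_const)
  from C2_space_scale(2)[OF this, of 0] this show ?case by simp
next
  case (insert i I)
  then show ?case
    using C2_space_add[of "\<theta> i" "\<lambda>x. \<Sum>i\<in>I. \<theta> i x"] by auto
qed

section \<open>Small deformations and the kernel\<close>

definition deform_deriv :: "(real^'n::finite \<Rightarrow> real^'n) \<Rightarrow> real^'n \<Rightarrow> real^'n \<Rightarrow> real^'n" where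
  "deform_deriv \<theta> x h = h + (\<chi> k. \<Sum>i\<in>UNIV. h $ i * partial i (\<lambda>y. \<theta> y $ k) x)"

lemma C2_space_has_derivative:
  fixes \<theta> :: "real^'n::finite \<Rightarrow> real^'n"
  assumes "\<theta> \<in> C2_space"
  shows "(\<theta> has_derivative (\<lambda>h. \<chi> k. \<Sum>i\<in>UNIV. h $ i * partial i (\<lambda>y. \<theta> y $ k) x)) (at x)"
proof (subst has_derivative_componentwise_within, rule ballI)
  fix b :: "real^'n" assume "b \<in> Basis"
  then obtain k where b: "b = axis k 1" by (auto simp: Basis_vec_def)
  have "Cb (Suc 1) (\<lambda>y. \<theta> y $ k)"
    using assms by (simp add: C2_space_iff numeral_2_eq_2)
  then have "((\<lambda>y. \<theta> y $ k) has_derivative (\<lambda>h. \<Sum>i\<in>UNIV. h $ i * partial i (\<lambda>y. \<theta> y $ k) x)) (at x)"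
    using Cb_cont_bounded by (intro has_derivative_continuous_partials) auto
  then show "((\<lambda>x. \<theta> x \<bullet> b) has_derivative (\<lambda>h. (\<chi> k. \<Sum>i\<in>UNIV. h $ i * partial i (\<lambda>y. \<theta> y $ k) x) \<bullet> b)) (at x)"
    by (simp add: b inner_axis)
qed

lemma deform_map_has_derivative:
  assumes "\<theta> \<in> C2_space"
  shows "((\<lambda>x. x + \<theta> x) has_derivative deform_deriv \<theta> x) (at x)"
  unfolding deform_deriv_def[abs_def] by (rule has_derivative_add[OF has_derivative_ident C2_space_has_derivative[OF assms]])

lemma C2_space_continuous:
  assumes "\<theta> \<in> C2_space"
  shows "continuous_on UNIV \<theta>"
  by (intro continuous_at_imp_continuous_on ballI has_derivative_continuous[OF C2_space_has_derivative[OF assms]])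

lemma C2_partial_le: "\<theta> \<in> C2_space \<Longrightarrow> \<bar>partial i (\<lambda>y. \<theta> y $ k) x\<bar> \<le> C2_norm \<theta>"
  using C2_norm_ge[of \<theta> "[i]" k x] by simp

lemma C2_norm_value_le:
  fixes \<theta> :: "real^'n::finite \<Rightarrow> real^'n"
  assumes "\<theta> \<in> C2_space"
  shows "norm (\<theta> x) \<le> real CARD('n) * C2_norm \<theta>"
proof -
  have "norm (\<theta> x) \<le> (\<Sum>i\<in>UNIV. \<bar>\<theta> x $ i\<bar>)" by (rule norm_le_l1_cart)
  also have "\<dots> \<le> (\<Sum>i\<in>(UNIV::'n set). C2_norm \<theta>)"
    using C2_norm_ge[OF assms, of "[]"] by (intro sum_mono) simp
  finally show ?thesis by simp
qed

text \<open>The constant is crude: the norm is estimated by the sum of n components, each a sum of n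
  products. \<open>rho_max\<close> below is chosen to make it 1/2.\<close>

lemma C2_space_lipschitz:
  fixes \<theta> :: "real^'n::finite \<Rightarrow> real^'n"
  assumes "\<theta> \<in> C2_space"
  shows "norm (\<theta> x - \<theta> y) \<le> (real CARD('n))\<^sup>2 * C2_norm \<theta> * norm (x - y)"
proof (rule differentiable_bound[of UNIV \<theta> "\<lambda>x h. \<chi> k. \<Sum>i\<in>UNIV. h $ i * partial i (\<lambda>y. \<theta> y $ k) x"])
  fix x
  show "onorm (\<lambda>h. \<chi> k. \<Sum>i\<in>UNIV. h $ i * partial i (\<lambda>y. \<theta> y $ k) x) \<le> (real CARD('n))\<^sup>2 * C2_norm \<theta>"
  proof (rule onorm_le)
    fix h :: "real^'n"
    have "\<bar>\<Sum>i\<in>UNIV. h $ i * partial i (\<lambda>y. \<theta> y $ k) x\<bar> \<le> (\<Sum>i\<in>(UNIV::'n set). norm h * C2_norm \<theta>)" for k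
      by (rule order_trans[OF sum_abs sum_mono])
         (auto simp: abs_mult intro!: mult_mono component_le_norm_cart C2_partial_le assms)
    then have "(\<Sum>k\<in>UNIV. \<bar>\<Sum>i\<in>UNIV. h $ i * partial i (\<lambda>y. \<theta> y $ k) x\<bar>) \<le> (\<Sum>k\<in>(UNIV::'n set). \<Sum>i\<in>(UNIV::'n set). norm h * C2_norm \<theta>)"
      by (intro sum_mono)
    then show "norm (\<chi> k. \<Sum>i\<in>UNIV. h $ i * partial i (\<lambda>y. \<theta> y $ k) x) \<le> (real CARD('n))\<^sup>2 * C2_norm \<theta> * norm h"
      using norm_le_l1_cart[of "\<chi> k. \<Sum>i\<in>UNIV. h $ i * partial i (\<lambda>y. \<theta> y $ k) x"]
      by (simp add: power2_eq_square algebra_simps)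
  qed
qed (use C2_space_has_derivative[OF assms] in auto)

text \<open>On the ball of this radius every \<open>\<theta>\<close> is a contraction with constant \<open>1/2\<close>.\<close>

definition rho_max :: "'n::finite itself \<Rightarrow> real" where
  "rho_max _ = 1 / (2 * (real CARD('n))\<^sup>2)"

abbreviation small_ball :: "(real^'n::finite \<Rightarrow> real^'n) set" where
  "small_ball \<equiv> C2_ball (rho_max TYPE('n))"

lemma small_ball_C2: "\<theta> \<in> small_ball \<Longrightarrow> \<theta> \<in> C2_space"
  by (simp add: C2_ball_def)

lemma small_ball_lipschitz:
  fixes \<theta> :: "real^'n::finite \<Rightarrow> real^'n"
  assumes "\<theta> \<in> small_ball"
  shows "norm (\<theta> x - \<theta> y) \<le> norm (x - y) / 2"
proof -
  have "norm (\<theta> x - \<theta> y) \<le> (real CARD('n))\<^sup>2 * C2_norm \<theta> * norm (x - y)"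
    using assms by (intro C2_space_lipschitz small_ball_C2)
  also have "\<dots> \<le> (real CARD('n))\<^sup>2 * rho_max TYPE('n) * norm (x - y)"
    using assms by (intro mult_right_mono mult_left_mono) (auto simp: C2_ball_def)
  also have "\<dots> = norm (x - y) / 2" by (simp add: rho_max_def)
  finally show ?thesis .
qed

lemma deform_map_expanding:
  assumes "\<theta> \<in> small_ball"
  shows "norm (x - y) / 2 \<le> norm ((x + \<theta> x) - (y + \<theta> y))"
proof -
  have "norm (x - y) \<le> norm ((x + \<theta> x) - (y + \<theta> y)) + norm (\<theta> x - \<theta> y)"
    using norm_triangle_ineq4[of "(x + \<theta> x) - (y + \<theta> y)" "\<theta> x - \<theta> y"] by (simp add: algebra_simps)
  then show ?thesis using small_ball_lipschitz[OF assms, of x y] by linarith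
qed

lemma deform_map_lipschitz:
  assumes "\<theta> \<in> small_ball"
  shows "norm ((x + \<theta> x) - (y + \<theta> y)) \<le> 2 * norm (x - y)"
proof -
  have "norm ((x + \<theta> x) - (y + \<theta> y)) \<le> norm (x - y) + norm (\<theta> x - \<theta> y)"
    using norm_triangle_ineq[of "x - y" "\<theta> x - \<theta> y"] by (simp add: algebra_simps)
  then show ?thesis using small_ball_lipschitz[OF assms, of x y] norm_ge_zero[of "x - y"] by linarith
qed

lemma bij_deform_map:
  fixes \<theta> :: "real^'n::finite \<Rightarrow> real^'n"
  assumes "\<theta> \<in> small_ball"
  shows "bij (\<lambda>x. x + \<theta> x)"
proof (rule bijI)
  show "inj (\<lambda>x. x + \<theta> x)"
  proof (rule injI)
    fix x y assume "x + \<theta> x = y + \<theta> y"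
    then show "x = y" using deform_map_expanding[OF assms, of x y] by simp
  qed
  show "surj (\<lambda>x. x + \<theta> x)"
    unfolding surj_def
  proof
    fix Y :: "real^'n"
    \<comment> \<open>A preimage of \<open>Y\<close> is a fixed point of the contraction that sends
      x to Y - \<theta> x.\<close>
    have "\<exists>!x. Y - \<theta> x = x"
      by (rule banach_fix_type[of "1/2"])
         (use small_ball_lipschitz[OF assms] in \<open>simp_all add: dist_norm norm_minus_commute\<close>)
    then show "\<exists>x. Y = x + \<theta> x" by (metis diff_add_cancel)
  qed
qed

text \<open>Distances shrink at most by the factor 1/2 and the map is onto, so every point of the
  smaller ball is the image of a point of \<open>ball x s\<close>. The radius is the same for all
  \<theta>.\<close>

lemma deform_contains_ball:
  fixes \<theta> :: "real^'n::finite \<Rightarrow> real^'n"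
  assumes \<theta>: "\<theta> \<in> small_ball" and "ball x s \<subseteq> \<Omega>"
  shows "ball (x + \<theta> x) (s / 2) \<subseteq> deform \<Omega> \<theta>"
proof
  fix Y assume Y: "Y \<in> ball (x + \<theta> x) (s / 2)"
  obtain y where y: "Y = y + \<theta> y"
    using bij_is_surj[OF bij_deform_map[OF \<theta>]] by (metis surj_def)
  have "norm (x - y) / 2 < s / 2"
    using deform_map_expanding[OF \<theta>, of x y] Y by (simp add: y dist_norm)
  then have "y \<in> \<Omega>" using assms(2) by (auto simp: dist_norm)
  then show "Y \<in> deform \<Omega> \<theta>" by (auto simp: deform_def y)
qed

lemma open_deform:
  assumes \<theta>: "\<theta> \<in> small_ball" and "open \<Omega>"
  shows "open (deform \<Omega> \<theta>)"
  unfolding open_contains_ball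
proof
  fix Y assume "Y \<in> deform \<Omega> \<theta>"
  then obtain y where y: "y \<in> \<Omega>" "Y = y + \<theta> y" by (auto simp: deform_def)
  then obtain s where "s > 0" "ball y s \<subseteq> \<Omega>"
    using assms(2) open_contains_ball by blast
  then show "\<exists>e>0. ball Y e \<subseteq> deform \<Omega> \<theta>"
    using deform_contains_ball[OF \<theta>, of y s \<Omega>] y(2) by (intro exI[of _ "s/2"]) auto
qed

lemma compl_deform:
  assumes "\<theta> \<in> small_ball"
  shows "- deform \<Omega> \<theta> = (\<lambda>x. x + \<theta> x) ` (- \<Omega>)"
  unfolding deform_def by (rule bij_image_Compl_eq[OF bij_deform_map[OF assms], symmetric])

text \<open>The deformation is a bijection of the whole space, so the complement of the deformed set
  is the image of the fixed set \<open>- \<Omega>\<close>; all dependence on \<theta> moves into the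
  integrand.\<close>

lemma integral_compl_deform:
  fixes f :: "real^'n::finite \<Rightarrow> real^'m::finite"
  assumes \<theta>: "\<theta> \<in> small_ball" and \<Omega>: "open \<Omega>"
    and f: "f absolutely_integrable_on (- deform \<Omega> \<theta>)"
  shows "(\<lambda>y. \<bar>jac_det (deform_deriv \<theta> y)\<bar> *\<^sub>R f (y + \<theta> y)) absolutely_integrable_on (- \<Omega>)"
    and "integral (- deform \<Omega> \<theta>) f = integral (- \<Omega>) (\<lambda>y. \<bar>jac_det (deform_deriv \<theta> y)\<bar> *\<^sub>R f (y + \<theta> y))"
proof -
  have "((\<lambda>y. y + \<theta> y) has_derivative deform_deriv \<theta> y) (at y within - \<Omega>)" for y
    using deform_map_has_derivative[OF small_ball_C2[OF \<theta>]] by (rule has_derivative_at_withinI)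
  moreover have "inj_on (\<lambda>y. y + \<theta> y) (- \<Omega>)"
    using bij_is_inj[OF bij_deform_map[OF \<theta>]] by (rule inj_on_subset) auto
  moreover have "closed (- \<Omega>)" using \<Omega> by auto
  ultimately have "(\<lambda>y. \<bar>jac_det (deform_deriv \<theta> y)\<bar> *\<^sub>R f (y + \<theta> y)) absolutely_integrable_on (- \<Omega>) \<and>
      integral (- \<Omega>) (\<lambda>y. \<bar>jac_det (deform_deriv \<theta> y)\<bar> *\<^sub>R f (y + \<theta> y)) = integral (- deform \<Omega> \<theta>) f"
    using f has_absolute_integral_change_of_variables_closed[of "- \<Omega>" "\<lambda>y. y + \<theta> y" "deform_deriv \<theta>" f "integral (- deform \<Omega> \<theta>) f"]
    by (auto simp: compl_deform[OF \<theta>])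
  then show "(\<lambda>y. \<bar>jac_det (deform_deriv \<theta> y)\<bar> *\<^sub>R f (y + \<theta> y)) absolutely_integrable_on (- \<Omega>)"
    "integral (- deform \<Omega> \<theta>) f = integral (- \<Omega>) (\<lambda>y. \<bar>jac_det (deform_deriv \<theta> y)\<bar> *\<^sub>R f (y + \<theta> y))"
    by auto
qed

section \<open>The kernel and its first two derivatives\<close>

definition kernel :: "real^'n::finite \<Rightarrow> real" where
  "kernel z = 1 / (z \<bullet> z) ^ CARD('n)"

definition dkernel :: "real^'n::finite \<Rightarrow> real^'n" where
  "dkernel z = (- 2 * real CARD('n) / (z \<bullet> z) ^ (CARD('n) + 1)) *\<^sub>R z"

definition ddkernel :: "real^'n::finite \<Rightarrow> real^'n \<Rightarrow> real^'n" where
  "ddkernel z h = (- 2 * real CARD('n) / (z \<bullet> z) ^ (CARD('n) + 1)) *\<^sub>R h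
     + (4 * real CARD('n) * (real CARD('n) + 1) * (z \<bullet> h) / (z \<bullet> z) ^ (CARD('n) + 2)) *\<^sub>R z"

text \<open>The kernels use powers of \<open>z \<bullet> z\<close>, which are polynomial in z and
  easy to differentiate; estimates return to powers of the norm by this identity.\<close>

lemma inner_power_norm: "(z \<bullet> z) ^ k = norm z ^ (2 * k)"
  by (simp add: dot_square_norm power_mult)

lemma kernel_has_derivative:
  assumes "z \<noteq> (0::real^'n::finite)"
  shows "(kernel has_derivative (\<lambda>h. dkernel z \<bullet> h)) (at z)"
proof -
  have nz: "z \<bullet> z \<noteq> 0" using assms by simp
  have "(kernel has_derivative (\<lambda>h. - (real CARD('n) * (z \<bullet> z) ^ (CARD('n) - 1) * (z \<bullet> h + h \<bullet> z)) / ((z \<bullet> z) ^ CARD('n))\<^sup>2)) (at z)"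
    unfolding kernel_def[abs_def] using nz
    by (auto intro!: derivative_eq_intros simp: power2_eq_square field_simps)
  moreover have "- (real CARD('n) * (z \<bullet> z) ^ (CARD('n) - 1) * (z \<bullet> h + h \<bullet> z)) / ((z \<bullet> z) ^ CARD('n))\<^sup>2 = dkernel z \<bullet> h" for h
  proof -
    obtain m where m: "CARD('n) = Suc m"
      using zero_less_card_finite[where 'a='n] gr0_implies_Suc by blast
    show ?thesis
      unfolding dkernel_def m using nz
      by (simp add: inner_commute[of h z] power2_eq_square divide_simps) (simp add: algebra_simps)
  qed
  ultimately show ?thesis by simp
qed

lemma dkernel_has_derivative:
  assumes "z \<noteq> (0::real^'n::finite)"
  shows "(dkernel has_derivative ddkernel z) (at z)"
proof -
  have nz: "z \<bullet> z \<noteq> 0" using assms by simp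
  let ?n = "CARD('n)"
  let ?P = "\<lambda>z::real^'n. (z \<bullet> z) ^ (?n + 1)"
  have "(?P has_derivative (\<lambda>h. real (?n + 1) * (z \<bullet> h + h \<bullet> z) * (z \<bullet> z) ^ (?n + 1 - 1))) (at z)"
    by (intro has_derivative_power has_derivative_inner has_derivative_ident)
  moreover have "real (?n + 1) * (z \<bullet> h + h \<bullet> z) * (z \<bullet> z) ^ (?n + 1 - 1) = 2 * (real ?n + 1) * (z \<bullet> h) * (z \<bullet> z) ^ ?n" for h
    using inner_commute[of h z] by simp
  ultimately have "(?P has_derivative (\<lambda>h. 2 * (real ?n + 1) * (z \<bullet> h) * (z \<bullet> z) ^ ?n)) (at z)"
    by (simp only:)
  then have "((\<lambda>z. inverse (?P z)) has_derivative
      (\<lambda>h. - (inverse (?P z) * (2 * (real ?n + 1) * (z \<bullet> h) * (z \<bullet> z) ^ ?n) * inverse (?P z)))) (at z)"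
    by (intro Deriv.has_derivative_inverse) (use nz in simp)
  then have "((\<lambda>z. - 2 * real ?n * inverse (?P z)) has_derivative
      (\<lambda>h. - 2 * real ?n * - (inverse (?P z) * (2 * (real ?n + 1) * (z \<bullet> h) * (z \<bullet> z) ^ ?n) * inverse (?P z)))) (at z)"
    by (rule has_derivative_mult_right)
  moreover have "- 2 * real ?n * - (inverse (?P z) * (2 * (real ?n + 1) * (z \<bullet> h) * (z \<bullet> z) ^ ?n) * inverse (?P z))
      = 4 * real ?n * (real ?n + 1) * (z \<bullet> h) / (z \<bullet> z) ^ (?n + 2)" for h
  proof -
    have "(z \<bullet> z) ^ ?n \<noteq> 0" using nz by simp
    then show ?thesis using nz by (simp add: field_simps)
  qed
  ultimately have "((\<lambda>z. - 2 * real ?n / ?P z) has_derivative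
      (\<lambda>h. 4 * real ?n * (real ?n + 1) * (z \<bullet> h) / (z \<bullet> z) ^ (?n + 2))) (at z)"
    by (simp only: divide_inverse)
  from has_derivative_scaleR[OF this has_derivative_ident]
  show ?thesis
    unfolding dkernel_def[abs_def] ddkernel_def[abs_def] .
qed

text \<open>The decay is really of order 2n + 1; one power of the norm is given up for
  \<open>1 / m\<close>, so that all kernels share the same integrable majorant.\<close>

lemma dkernel_bound:
  assumes "0 < m" "m \<le> norm (z::real^'n::finite)"
  shows "norm (dkernel z) \<le> (2 * real CARD('n) / m) / norm z ^ (2 * CARD('n))"
proof -
  have nz: "norm z > 0" using assms by linarith
  have "(z \<bullet> z) ^ (CARD('n) + 1) = norm z ^ (2 * CARD('n)) * (norm z)\<^sup>2"
    unfolding inner_power_norm by (simp add: power_add power2_eq_square)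
  then have "norm (dkernel z) = (2 * real CARD('n) / norm z) / norm z ^ (2 * CARD('n))"
    unfolding dkernel_def using nz by (simp add: power2_eq_square)
  also have "\<dots> \<le> (2 * real CARD('n) / m) / norm z ^ (2 * CARD('n))"
    using assms nz by (intro divide_right_mono divide_left_mono) auto
  finally show ?thesis .
qed

text \<open>By Cauchy-Schwarz the two terms contribute 2n and 4n (n + 1), whose sum is 2n (2n + 3);
  the two surplus powers of decay are given up for 1 / m^2.\<close>

lemma ddkernel_bound:
  assumes "0 < m" "m \<le> norm (z::real^'n::finite)"
  shows "norm (ddkernel z h) \<le> (2 * real CARD('n) * (2 * real CARD('n) + 3) / m\<^sup>2) / norm z ^ (2 * CARD('n)) * norm h"
proof -
  let ?n = "real CARD('n)"
  let ?P = "norm z ^ (2 * CARD('n))"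
  have nz: "norm z > 0" using assms by linarith
  have p1: "(z \<bullet> z) ^ (CARD('n) + 1) = ?P * (norm z)\<^sup>2" and p2: "(z \<bullet> z) ^ (CARD('n) + 2) = ?P * (norm z)\<^sup>2 * (norm z)\<^sup>2"
    unfolding inner_power_norm by (simp_all add: power_add power2_eq_square)
  have "norm (ddkernel z h) \<le> norm ((- 2 * ?n / (?P * (norm z)\<^sup>2)) *\<^sub>R h) + norm ((4 * ?n * (?n + 1) * (z \<bullet> h) / (?P * (norm z)\<^sup>2 * (norm z)\<^sup>2)) *\<^sub>R z)"
    unfolding ddkernel_def p1 p2 by (rule norm_triangle_ineq)
  also have "norm ((- 2 * ?n / (?P * (norm z)\<^sup>2)) *\<^sub>R h) = 2 * ?n / (?P * (norm z)\<^sup>2) * norm h"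
    by simp
  also have "norm ((4 * ?n * (?n + 1) * (z \<bullet> h) / (?P * (norm z)\<^sup>2 * (norm z)\<^sup>2)) *\<^sub>R z)
      = 4 * ?n * (?n + 1) * \<bar>z \<bullet> h\<bar> / (?P * (norm z)\<^sup>2 * (norm z)\<^sup>2) * norm z"
    by (simp add: abs_mult)
  also have "\<dots> \<le> 4 * ?n * (?n + 1) * (norm z * norm h) / (?P * (norm z)\<^sup>2 * (norm z)\<^sup>2) * norm z"
    by (intro mult_right_mono divide_right_mono mult_left_mono Cauchy_Schwarz_ineq2) auto
  also have "\<dots> = 4 * ?n * (?n + 1) / (?P * (norm z)\<^sup>2) * norm h"
    using nz by (simp add: power2_eq_square divide_simps)
  also have "2 * ?n / (?P * (norm z)\<^sup>2) * norm h + 4 * ?n * (?n + 1) / (?P * (norm z)\<^sup>2) * norm h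
      = 2 * ?n * (2 * ?n + 3) / (norm z)\<^sup>2 / ?P * norm h"
    using nz by (simp add: divide_simps algebra_simps)
  also have "\<dots> \<le> 2 * ?n * (2 * ?n + 3) / m\<^sup>2 / ?P * norm h"
    using assms nz by (intro mult_right_mono divide_right_mono divide_left_mono) (auto intro!: power_mono)
  finally show ?thesis by simp
qed

lemma continuous_on_kernels:
  assumes "continuous_on S f" "\<And>y. y \<in> S \<Longrightarrow> f y \<noteq> (0::real^'n::finite)"
  shows "continuous_on S (\<lambda>y. kernel (f y))" "continuous_on S (\<lambda>y. dkernel (f y))" "continuous_on S (\<lambda>y. ddkernel (f y) h)"
  unfolding kernel_def dkernel_def ddkernel_def using assms by (auto intro!: continuous_intros)

text \<open>Continuity on a closed set gives measurability, and the inverse power is integrable away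
  from its pole. With \<open>f\<close> zero the second conclusion provides dominating
  functions.\<close>

lemma absolutely_integrable_kernel_bound:
  fixes f :: "real^'n::finite \<Rightarrow> 'b::euclidean_space"
  assumes S: "closed S" "\<And>y. y \<in> S \<Longrightarrow> r \<le> norm (y - a)" and r: "r > 0"
    and f: "continuous_on S f" "\<And>y. y \<in> S \<Longrightarrow> norm (f y) \<le> C / norm (y - a) ^ (2 * CARD('n))"
  shows "f absolutely_integrable_on S" "(\<lambda>y. C / norm (y - a) ^ (2 * CARD('n))) integrable_on S"
proof -
  have leb: "S \<in> sets lebesgue" using S(1) by (simp add: borel_closed)
  have "(\<lambda>y. 1 / norm (y - a) ^ (2 * CARD('n))) absolutely_integrable_on S"
    by (rule set_integrable_subset[OF absolutely_integrable_inverse_power[OF r] leb]) (use S(2) in auto)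
  then have "(\<lambda>y. 1 / norm (y - a) ^ (2 * CARD('n))) integrable_on S"
    using absolutely_integrable_on_def by blast
  from integrable_cmul[OF this, of C] show g: "(\<lambda>y. C / norm (y - a) ^ (2 * CARD('n))) integrable_on S"
    by simp
  have "f integrable_on S"
    by (rule measurable_bounded_by_integrable_imp_integrable[OF _ g f(2) leb])
       (rule continuous_imp_measurable_on_sets_lebesgue[OF f(1) leb])
  then show "f absolutely_integrable_on S"
    using f(2) g by (intro absolutely_integrable_integrable_bound[of S f]) auto
qed

section \<open>Derivatives of the potential and closedness\<close>

text \<open>The common properties of \<open>dkernel\<close> and of \<open>ddkernel\<close> in a
  fixed direction, so that integrability and continuous dependence on the deformation are proved
  once for both.\<close>

definition admissible :: "(real^'n::finite \<Rightarrow> real^'n) \<Rightarrow> bool" where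
  "admissible K \<longleftrightarrow> continuous_on (- {0}) K \<and>
     (\<forall>m>0. \<exists>C\<ge>0. \<forall>z. m \<le> norm z \<longrightarrow> norm (K z) \<le> C / norm z ^ (2 * CARD('n)))"

lemma admissible_dkernel: "admissible (dkernel :: real^'n::finite \<Rightarrow> _)"
  unfolding admissible_def
proof (intro conjI allI impI)
  show "continuous_on (- {0}) (dkernel :: real^'n \<Rightarrow> _)"
    using continuous_on_kernels(2)[of "- {0}" "\<lambda>z. z"] by auto
  show "\<exists>C\<ge>0. \<forall>z::real^'n. m \<le> norm z \<longrightarrow> norm (dkernel z) \<le> C / norm z ^ (2 * CARD('n))" if "m > 0" for m
    using dkernel_bound[OF that] that by (intro exI[of _ "2 * real CARD('n) / m"]) auto
qed

lemma admissible_ddkernel: "admissible (\<lambda>z::real^'n::finite. ddkernel z h)"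
  unfolding admissible_def
proof (intro conjI allI impI)
  show "continuous_on (- {0}) (\<lambda>z::real^'n. ddkernel z h)"
    using continuous_on_kernels(3)[of "- {0}" "\<lambda>z. z"] by auto
  show "\<exists>C\<ge>0. \<forall>z::real^'n. m \<le> norm z \<longrightarrow> norm (ddkernel z h) \<le> C / norm z ^ (2 * CARD('n))" if "m > 0" for m
    using ddkernel_bound[OF that, of _ h] that
    by (intro exI[of _ "2 * real CARD('n) * (2 * real CARD('n) + 3) / m\<^sup>2 * norm h"]) (auto simp: field_simps)
qed

lemma admissible_integrable:
  fixes X :: "real^'n::finite"
  assumes K: "admissible K" and D: "open D" "X \<in> D"
  shows "(\<lambda>Y. K (X - Y)) absolutely_integrable_on - D"
proof -
  obtain r where r: "r > 0" "ball X r \<subseteq> D"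
    using D open_contains_ball by blast
  have far: "r \<le> norm (Y - X)" if "Y \<in> - D" for Y
    using that r(2) by (auto simp: dist_norm norm_minus_commute not_less[symmetric])
  obtain C where C: "\<And>z. r \<le> norm z \<Longrightarrow> norm (K z) \<le> C / norm z ^ (2 * CARD('n))"
    using K r(1) unfolding admissible_def by blast
  have cont: "continuous_on (- D) (\<lambda>Y. K (X - Y))"
    by (rule continuous_on_compose2[of "- {0}" K])
       (use K D in \<open>auto simp: admissible_def intro!: continuous_intros\<close>)
  have bd: "norm (K (X - Y)) \<le> C / norm (Y - X) ^ (2 * CARD('n))" if "Y \<in> - D" for Y
    using C[of "X - Y"] far[OF that] by (simp add: norm_minus_commute)
  have cl: "closed (- D)" using D by auto
  show ?thesis
    by (rule absolutely_integrable_kernel_bound(1)[OF cl far r(1) cont bd])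
qed

text \<open>Replaces a moving pole by the fixed pole \<open>a\<close>, as a single dominating
  function requires. The ratio 1/4 is small enough for all applications.\<close>

lemma kernel_bound_shift:
  fixes y a :: "real^'n::finite" and z :: "'b::real_normed_vector"
  assumes "C \<ge> 0" "norm (y - a) / 4 \<le> norm z" "y \<noteq> a"
  shows "C / norm z ^ (2 * CARD('n)) \<le> (C * 4 ^ (2 * CARD('n))) / norm (y - a) ^ (2 * CARD('n))"
proof -
  have p: "0 < norm (y - a)" using assms by simp
  have "C / norm z ^ (2 * CARD('n)) \<le> C / (norm (y - a) / 4) ^ (2 * CARD('n))"
    using assms p by (intro divide_left_mono power_mono mult_pos_pos zero_less_power) (auto intro: less_le_trans[of _ "norm (y - a) / 4"])
  also have "\<dots> = (C * 4 ^ (2 * CARD('n))) / norm (y - a) ^ (2 * CARD('n))"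
    by (simp add: power_divide)
  finally show ?thesis .
qed

lemma rho_max_pos: "rho_max TYPE('n::finite) > 0"
  by (simp add: rho_max_def)

lemma rho_max_le_1: "rho_max TYPE('n::finite) \<le> 1"
proof -
  have "1 \<le> real CARD('n)" by (simp add: Suc_le_eq)
  then have "1 \<le> (real CARD('n))\<^sup>2" by (simp add: one_le_power)
  then have "1 \<le> 2 * (real CARD('n))\<^sup>2" by linarith
  then show ?thesis by (simp add: rho_max_def divide_le_eq)
qed

lemma deform_deriv_axis: "deform_deriv \<theta> y (axis j 1) $ i = (if i = j then 1 else 0) + partial j (\<lambda>y. \<theta> y $ i) y"
proof -
  have "(\<Sum>l\<in>UNIV. axis j 1 $ l * partial l (\<lambda>y. \<theta> y $ i) y) = partial j (\<lambda>y. \<theta> y $ i) y"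
    by (subst sum.remove[of _ j]) (auto simp: axis_def)
  then show ?thesis by (simp add: deform_deriv_def axis_def)
qed

text \<open>Leibniz's formula has one term per permutation, each a product of n entries of size at
  most 1 + \<open>rho_max\<close> <= 2.\<close>

lemma jac_det_deform_deriv_bounded:
  obtains C where "C \<ge> 0" "\<And>\<theta> y. \<theta> \<in> (small_ball :: (real^'n::finite \<Rightarrow> real^'n) set) \<Longrightarrow> \<bar>jac_det (deform_deriv \<theta> y)\<bar> \<le> C"
proof
  let ?P = "{p. p permutes (UNIV :: 'n idx set)}"
  show "0 \<le> real (card ?P) * 2 ^ CARD('n idx)" by simp
  fix \<theta> :: "real^'n \<Rightarrow> real^'n" and y assume \<theta>: "\<theta> \<in> small_ball"
  have entry: "\<bar>deform_deriv \<theta> y (axis j 1) $ i\<bar> \<le> 2" for i j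
  proof -
    have "\<bar>partial j (\<lambda>y. \<theta> y $ i) y\<bar> \<le> 1"
      using C2_partial_le[OF small_ball_C2[OF \<theta>], of j i y] \<theta> rho_max_le_1[where 'n='n] by (simp add: C2_ball_def)
    then show ?thesis unfolding deform_deriv_axis by (auto simp: abs_le_iff)
  qed
  have "\<bar>jac_det (deform_deriv \<theta> y)\<bar> \<le> (\<Sum>p\<in>?P. 2 ^ CARD('n idx))"
    unfolding jac_det_def det_def
    by (rule order_trans[OF sum_abs sum_mono])
       (auto simp: abs_mult abs_prod sign_def entry intro!: prod_mono[where g="\<lambda>_. 2::real", simplified])
  then show "\<bar>jac_det (deform_deriv \<theta> y)\<bar> \<le> real (card ?P) * 2 ^ CARD('n idx)"
    by simp
qed

lemma C2_dist_bounds: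
  fixes \<theta> \<eta> :: "real^'n::finite \<Rightarrow> real^'n"
  assumes "\<theta> \<in> C2_space" "\<eta> \<in> C2_space"
  shows "norm (\<theta> x - \<eta> x) \<le> real CARD('n) * C2_dist \<theta> \<eta>"
    "\<bar>partial i (\<lambda>y. \<theta> y $ k) x - partial i (\<lambda>y. \<eta> y $ k) x\<bar> \<le> C2_dist \<theta> \<eta>"
proof -
  note d = C2_space_diff[OF assms]
  show "norm (\<theta> x - \<eta> x) \<le> real CARD('n) * C2_dist \<theta> \<eta>"
    using C2_norm_value_le[OF d] by (simp add: C2_dist_def)
  have c: "Cb 2 (\<lambda>y. \<theta> y $ k)" "Cb 2 (\<lambda>y. - 1 * \<eta> y $ k)" "Cb 2 (\<lambda>y. \<eta> y $ k)"
    using assms Cb_mult[OF Cb_const[of 2 "- 1"], of "\<lambda>y. \<eta> y $ k"] unfolding C2_space_iff by blast+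
  have "iter_partial [i] (\<lambda>y. \<theta> y $ k + - 1 * \<eta> y $ k) = (\<lambda>x. iter_partial [i] (\<lambda>y. \<theta> y $ k) x + iter_partial [i] (\<lambda>y. - 1 * \<eta> y $ k) x)"
    by (rule iter_partial_add[OF c(1,2)]) simp
  moreover have "iter_partial [i] (\<lambda>y. - 1 * \<eta> y $ k) = (\<lambda>x. - 1 * iter_partial [i] (\<lambda>y. \<eta> y $ k) x)"
    by (rule iter_partial_cmult[OF c(3)]) simp
  ultimately have "partial i (\<lambda>y. (\<theta> y - \<eta> y) $ k) x = partial i (\<lambda>y. \<theta> y $ k) x - partial i (\<lambda>y. \<eta> y $ k) x"
    by (simp add: fun_eq_iff)
  then show "\<bar>partial i (\<lambda>y. \<theta> y $ k) x - partial i (\<lambda>y. \<eta> y $ k) x\<bar> \<le> C2_dist \<theta> \<eta>"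
    using C2_partial_le[OF d, of i k x] by (simp add: C2_dist_def)
qed

text \<open>Dominated convergence on the fixed set \<open>- \<Omega>\<close>: convergence of the
  first partial derivatives handles the Jacobian, uniform convergence of the deformations handles
  the kernel, and the expanding bound keeps the pole away from the integration points uniformly
  along the sequence.\<close>

lemma admissible_tendsto:
  fixes \<theta> :: "real^'n::finite \<Rightarrow> real^'n" and \<theta>k :: "nat \<Rightarrow> real^'n \<Rightarrow> real^'n"
  assumes K: "admissible K" and \<Omega>: "open \<Omega>" "x \<in> \<Omega>"
    and \<theta>: "\<theta> \<in> small_ball" "\<And>k. \<theta>k k \<in> small_ball" "(\<lambda>k. C2_dist \<theta> (\<theta>k k)) \<longlonglongrightarrow> 0"
    and x: "xk \<longlonglongrightarrow> x"
  shows "(\<lambda>k. integral (- deform \<Omega> (\<theta>k k)) (\<lambda>Y. K (xk k + \<theta>k k (xk k) - Y)))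
     \<longlonglongrightarrow> integral (- deform \<Omega> \<theta>) (\<lambda>Y. K (x + \<theta> x - Y))"
proof -
  obtain s where s: "s > 0" "ball x s \<subseteq> \<Omega>"
    using \<Omega> open_contains_ball by blast
  define r where "r = s / 2"
  have r: "r > 0" using s by (simp add: r_def)
  have far: "2 * r \<le> norm (y - x)" if "y \<in> - \<Omega>" for y
    using that s(2) by (auto simp: r_def dist_norm norm_minus_commute not_less[symmetric])
  obtain N where N: "\<And>k. k \<ge> N \<Longrightarrow> norm (xk k - x) < r"
    using x r by (metis LIMSEQ_iff)
  \<comment> \<open>A tail of the sequence, for which all base points lie within \<open>r\<close> of
    \<open>x\<close>, while \<open>- \<Omega>\<close> stays at distance
    \<open>2 * r\<close>.\<close>
  define \<eta> where "\<eta> k = \<theta>k (k + N)" for k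
  define u where "u k = xk (k + N)" for k
  have u: "norm (u k - x) < r" for k using N by (simp add: u_def)
  have u_lim: "u \<longlonglongrightarrow> x" unfolding u_def using x by (rule LIMSEQ_ignore_initial_segment)
  have \<eta>: "\<eta> k \<in> small_ball" for k using \<theta>(2) by (simp add: \<eta>_def)
  have dist_lim: "(\<lambda>k. C2_dist \<theta> (\<eta> k)) \<longlonglongrightarrow> 0"
    unfolding \<eta>_def using \<theta>(3) by (rule LIMSEQ_ignore_initial_segment)
  have u\<Omega>: "u k \<in> \<Omega>" for k
    using u[of k] s by (intro subsetD[OF s(2)]) (auto simp: r_def dist_norm norm_minus_commute)
  have \<eta>x: "(\<lambda>k. \<eta> k (v k)) \<longlonglongrightarrow> \<theta> w" if v: "v \<longlonglongrightarrow> w" for v w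
  proof -
    have nv: "(\<lambda>k. norm (v k - w)) \<longlonglongrightarrow> 0"
      using v by (simp add: LIM_zero tendsto_norm_zero)
    have "(\<lambda>k. real CARD('n) * C2_dist \<theta> (\<eta> k) + norm (v k - w) / 2) \<longlonglongrightarrow> real CARD('n) * 0 + 0 / 2"
      by (intro tendsto_intros dist_lim nv) simp
    moreover have "norm (\<eta> k (v k) - \<theta> w) \<le> real CARD('n) * C2_dist \<theta> (\<eta> k) + norm (v k - w) / 2" for k
    proof -
      have "norm (\<eta> k (v k) - \<theta> w) \<le> norm (\<theta> (v k) - \<eta> k (v k)) + norm (\<theta> (v k) - \<theta> w)"
        using norm_triangle_ineq4[of "\<theta> (v k) - \<theta> w" "\<theta> (v k) - \<eta> k (v k)"] by simp
      then show ?thesis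
        using C2_dist_bounds(1)[OF small_ball_C2[OF \<theta>(1)] small_ball_C2[OF \<eta>[of k]], of "v k"]
          small_ball_lipschitz[OF \<theta>(1), of "v k" w] by linarith
    qed
    ultimately have "(\<lambda>k. \<eta> k (v k) - \<theta> w) \<longlonglongrightarrow> 0"
      by (intro Lim_null_comparison[of "\<lambda>k. \<eta> k (v k) - \<theta> w"]) auto
    then show ?thesis by (simp add: LIM_zero_iff)
  qed
  have jac: "(\<lambda>k. jac_det (deform_deriv (\<eta> k) y)) \<longlonglongrightarrow> jac_det (deform_deriv \<theta> y)" for y
  proof -
    have "(\<lambda>k. partial i (\<lambda>y. \<eta> k y $ l) y) \<longlonglongrightarrow> partial i (\<lambda>y. \<theta> y $ l) y" for i l
    proof -
      have "(\<lambda>k. partial i (\<lambda>y. \<theta> y $ l) y - partial i (\<lambda>y. \<eta> k y $ l) y) \<longlonglongrightarrow> 0"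
        by (rule Lim_null_comparison[OF _ dist_lim])
           (use C2_dist_bounds(2)[OF small_ball_C2[OF \<theta>(1)] small_ball_C2[OF \<eta>]] in auto)
      from tendsto_diff[OF tendsto_const[of "partial i (\<lambda>y. \<theta> y $ l) y"] this] show ?thesis by simp
    qed
    then show ?thesis
      unfolding jac_det_def det_def deform_deriv_axis vec_lambda_beta
      by (intro tendsto_intros) auto
  qed
  obtain CJ where CJ: "CJ \<ge> 0" "\<And>\<theta> y. \<theta> \<in> (small_ball :: (real^'n \<Rightarrow> real^'n) set) \<Longrightarrow> \<bar>jac_det (deform_deriv \<theta> y)\<bar> \<le> CJ"
    using jac_det_deform_deriv_bounded[where 'n='n] by blast
  obtain CK where CK: "CK \<ge> 0" "\<And>z. r / 2 \<le> norm z \<Longrightarrow> norm (K z) \<le> CK / norm z ^ (2 * CARD('n))"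
    using K r unfolding admissible_def by (metis half_gt_zero)
  define q where "q k y = \<bar>jac_det (deform_deriv (\<eta> k) y)\<bar> *\<^sub>R K (u k + \<eta> k (u k) - (y + \<eta> k y))" for k y
  have near: "norm (y - x) / 2 \<le> norm (u k - y)" if "y \<in> - \<Omega>" for k y
  proof -
    have "norm (y - x) \<le> norm (u k - y) + norm (u k - x)"
      using norm_triangle_ineq4[of "u k - x" "u k - y"] by (simp add: algebra_simps)
    then show ?thesis using u[of k] far[OF that] by linarith
  qed
  \<comment> \<open>One factor 1/2 comes from the displacement of the base point, the other from the
    expanding bound.\<close>
  have near': "norm (y - x) / 4 \<le> norm (u k + \<eta> k (u k) - (y + \<eta> k y))" if "y \<in> - \<Omega>" for k y
    using deform_map_expanding[OF \<eta>, of "u k" y k] near[OF that, of k] by linarith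
  have qint: "q k absolutely_integrable_on - \<Omega>"
    and qeq: "integral (- deform \<Omega> (\<eta> k)) (\<lambda>Y. K (u k + \<eta> k (u k) - Y)) = integral (- \<Omega>) (q k)" for k
  proof -
    have "u k + \<eta> k (u k) \<in> deform \<Omega> (\<eta> k)"
      using u\<Omega> by (auto simp: deform_def)
    from admissible_integrable[OF K open_deform[OF \<eta> \<Omega>(1)] this]
    have *: "(\<lambda>Y. K (u k + \<eta> k (u k) - Y)) absolutely_integrable_on - deform \<Omega> (\<eta> k)" .
    show "q k absolutely_integrable_on - \<Omega>"
      unfolding q_def by (rule integral_compl_deform(1)[OF \<eta> \<Omega>(1) *])
    show "integral (- deform \<Omega> (\<eta> k)) (\<lambda>Y. K (u k + \<eta> k (u k) - Y)) = integral (- \<Omega>) (q k)"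
      unfolding q_def by (rule integral_compl_deform(2)[OF \<eta> \<Omega>(1) *])
  qed
  have limeq: "integral (- deform \<Omega> \<theta>) (\<lambda>Y. K (x + \<theta> x - Y)) = integral (- \<Omega>) (\<lambda>y. \<bar>jac_det (deform_deriv \<theta> y)\<bar> *\<^sub>R K (x + \<theta> x - (y + \<theta> y)))"
  proof -
    have "x + \<theta> x \<in> deform \<Omega> \<theta>"
      using \<Omega> by (auto simp: deform_def)
    from admissible_integrable[OF K open_deform[OF \<theta>(1) \<Omega>(1)] this]
    show ?thesis by (rule integral_compl_deform(2)[OF \<theta>(1) \<Omega>(1)])
  qed
  have "(\<lambda>k. integral (- \<Omega>) (q k)) \<longlonglongrightarrow> integral (- \<Omega>) (\<lambda>y. \<bar>jac_det (deform_deriv \<theta> y)\<bar> *\<^sub>R K (x + \<theta> x - (y + \<theta> y)))"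
  proof (rule dominated_convergence(2))
    show "q k integrable_on - \<Omega>" for k
      using qint[of k] absolutely_integrable_on_def by blast
    show "(\<lambda>y. (CJ * CK * 4 ^ (2 * CARD('n))) / norm (y - x) ^ (2 * CARD('n))) integrable_on - \<Omega>"
      by (rule absolutely_integrable_kernel_bound(2)[of "- \<Omega>" r x "\<lambda>y. 0::real"])
         (use \<Omega> far r CJ CK in \<open>auto intro: order_trans[of r "2 * r"]\<close>)
    show "norm (q k y) \<le> (CJ * CK * 4 ^ (2 * CARD('n))) / norm (y - x) ^ (2 * CARD('n))" if y: "y \<in> - \<Omega>" for k y
    proof -
      let ?z = "u k + \<eta> k (u k) - (y + \<eta> k y)"
      have "norm (K ?z) \<le> CK / norm ?z ^ (2 * CARD('n))"
        using near'[OF y, of k] far[OF y] by (intro CK) linarith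
      also have "\<dots> \<le> CK * 4 ^ (2 * CARD('n)) / norm (y - x) ^ (2 * CARD('n))"
        using near'[OF y] CK(1) y \<Omega>(2) by (intro kernel_bound_shift) auto
      finally have "norm (q k y) \<le> CJ * (CK * 4 ^ (2 * CARD('n)) / norm (y - x) ^ (2 * CARD('n)))"
        unfolding q_def norm_scaleR abs_idempotent using CJ(2)[OF \<eta>[of k], of y] CJ(1)
        by (intro mult_mono) auto
      then show ?thesis by simp
    qed
    show "(\<lambda>k. q k y) \<longlonglongrightarrow> \<bar>jac_det (deform_deriv \<theta> y)\<bar> *\<^sub>R K (x + \<theta> x - (y + \<theta> y))" if y: "y \<in> - \<Omega>" for y
    proof -
      have "norm (x - y) / 2 \<le> norm (x + \<theta> x - (y + \<theta> y))"
        by (rule deform_map_expanding[OF \<theta>(1)])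
      moreover have "x \<noteq> y" using y \<Omega>(2) by auto
      ultimately have nz: "x + \<theta> x - (y + \<theta> y) \<noteq> 0"
        by (metis half_gt_zero not_le norm_zero zero_less_norm_iff right_minus_eq)
      have "isCont K (x + \<theta> x - (y + \<theta> y))"
        using K nz continuous_on_eq_continuous_at[of "- {0}" K] open_Compl[OF closed_singleton[of "0::real^'n"]]
        by (auto simp: admissible_def)
      moreover have "(\<lambda>k. u k + \<eta> k (u k) - (y + \<eta> k y)) \<longlonglongrightarrow> x + \<theta> x - (y + \<theta> y)"
        by (intro tendsto_intros u_lim \<eta>x)
      ultimately have "(\<lambda>k. K (u k + \<eta> k (u k) - (y + \<eta> k y))) \<longlonglongrightarrow> K (x + \<theta> x - (y + \<theta> y))"
        by (rule isCont_tendsto_compose)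
      then show ?thesis
        unfolding q_def by (intro tendsto_intros jac)
    qed
  qed
  then have "(\<lambda>k. integral (- deform \<Omega> (\<eta> k)) (\<lambda>Y. K (u k + \<eta> k (u k) - Y))) \<longlonglongrightarrow> integral (- deform \<Omega> \<theta>) (\<lambda>Y. K (x + \<theta> x - Y))"
    by (simp add: qeq limeq)
  then show ?thesis
    unfolding \<eta>_def u_def by (rule LIMSEQ_offset)
qed

section \<open>Gradient and Hessian of the potential\<close>

definition grad_psi :: "(real^'n::finite) set \<Rightarrow> real^'n \<Rightarrow> real^'n" where
  "grad_psi S X = integral S (\<lambda>Y. dkernel (X - Y))"

definition hess_psi :: "(real^'n::finite) set \<Rightarrow> real^'n \<Rightarrow> real^'n \<Rightarrow> real^'n" where
  "hess_psi S X h = integral S (\<lambda>Y. ddkernel (X - Y) h)"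

lemma psi_eq: "psi D X = integral (- D) (\<lambda>Y. kernel (X - Y))"
  by (simp add: psi_def kernel_def inner_power_norm)

text \<open>For base points in \<open>ball X r\<close> the distance to a point of the complement is
  at least \<open>r\<close> and comparable to its distance from \<open>X\<close>. Both derivatives
  of the kernel are thus dominated, and differentiation under the integral applies twice.\<close>

lemma psi_derivatives:
  fixes X :: "real^'n::finite"
  assumes D: "open D" "X \<in> D"
  shows "(psi D has_derivative (\<lambda>h. grad_psi (- D) X \<bullet> h)) (at X)"
    and "(grad_psi (- D) has_derivative hess_psi (- D) X) (at X)"
proof -
  obtain s where s: "s > 0" "ball X s \<subseteq> D"
    using D open_contains_ball by blast
  define r where "r = s / 2"
  have r: "r > 0" using s by (simp add: r_def)
  have far: "2 * r \<le> norm (y - X)" if "y \<in> - D" for y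
    using that s(2) by (auto simp: r_def dist_norm norm_minus_commute not_less[symmetric])
  have inD: "z \<in> D" if "z \<in> ball X r" for z
    using that s by (intro subsetD[OF s(2)]) (auto simp: r_def)
  have near: "norm (y - X) / 2 \<le> norm (z - y)" if "y \<in> - D" "z \<in> ball X r" for z y
  proof -
    have "norm (y - X) \<le> norm (z - y) + norm (z - X)"
      using norm_triangle_ineq4[of "z - X" "z - y"] by (simp add: algebra_simps)
    then show ?thesis using far[OF that(1)] that(2) by (simp add: dist_norm norm_minus_commute)
  qed
  have near4: "norm (y - X) / 4 \<le> norm (z - y)" and nearr: "r \<le> norm (z - y)"
    if "y \<in> - D" "z \<in> ball X r" for z y
    using near[OF that] far[OF that(1)] r by linarith+
  have neq: "z - y \<noteq> 0" if "y \<in> - D" "z \<in> ball X r" for z y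
    using nearr[OF that] r by auto
  have cl: "closed (- D)" using D by auto
  have farr: "r \<le> norm (y - X)" if "y \<in> - D" for y using far[OF that] r by linarith
  have gint: "(\<lambda>y. C / norm (y - X) ^ (2 * CARD('n))) integrable_on - D" if "C \<ge> 0" for C
    by (rule absolutely_integrable_kernel_bound(2)[of "- D" r X "\<lambda>y. 0::real"])
       (use cl farr r that in auto)
  have K1int: "(\<lambda>Y. dkernel (z - Y)) integrable_on - D" and K2int: "(\<lambda>Y. ddkernel (z - Y) h) integrable_on - D"
    if "z \<in> ball X r" for z h
    using admissible_integrable[OF admissible_dkernel D(1) inD[OF that]] admissible_integrable[OF admissible_ddkernel D(1) inD[OF that]]
    by (auto simp: absolutely_integrable_on_def)
  have K0int: "(\<lambda>Y. kernel (z - Y)) integrable_on - D" if z: "z \<in> ball X r" for z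
  proof -
    have "(\<lambda>Y. kernel (z - Y)) absolutely_integrable_on - D"
    proof (rule absolutely_integrable_kernel_bound(1)[OF cl farr r, where C="1 * 4 ^ (2 * CARD('n))"])
      show "continuous_on (- D) (\<lambda>Y. kernel (z - Y))"
        by (intro continuous_on_kernels continuous_intros) (use neq z in auto)
      show "norm (kernel (z - Y)) \<le> 1 * 4 ^ (2 * CARD('n)) / norm (Y - X) ^ (2 * CARD('n))" if "Y \<in> - D" for Y
        using kernel_bound_shift[OF _ near4[OF that z], of 1] that D(2) by (auto simp: kernel_def inner_power_norm)
    qed
    then show ?thesis by (simp add: absolutely_integrable_on_def)
  qed
  let ?C1 = "2 * real CARD('n) / r" and ?C2 = "2 * real CARD('n) * (2 * real CARD('n) + 3) / r\<^sup>2"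
  have b1: "norm (dkernel (z - Y)) \<le> ?C1 * 4 ^ (2 * CARD('n)) / norm (Y - X) ^ (2 * CARD('n))"
    if "Y \<in> - D" "z \<in> ball X r" for Y z
    using dkernel_bound[OF r nearr[OF that]] kernel_bound_shift[OF _ near4[OF that], of ?C1] that D(2) r by fastforce
  have b2: "norm (ddkernel (z - Y) h) \<le> ?C2 * 4 ^ (2 * CARD('n)) / norm (Y - X) ^ (2 * CARD('n)) * norm h"
    if "Y \<in> - D" "z \<in> ball X r" for Y z h
  proof -
    have "norm (ddkernel (z - Y) h) \<le> ?C2 / norm (z - Y) ^ (2 * CARD('n)) * norm h"
      by (rule ddkernel_bound[OF r nearr[OF that]])
    also have "\<dots> \<le> ?C2 * 4 ^ (2 * CARD('n)) / norm (Y - X) ^ (2 * CARD('n)) * norm h"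
      using that D(2) r by (intro mult_right_mono kernel_bound_shift[OF _ near4[OF that]]) auto
    finally show ?thesis .
  qed
  have X: "X \<in> ball X r" using r by simp
  have "((\<lambda>x. integral (- D) (\<lambda>Y. kernel (x - Y))) has_derivative (\<lambda>h. integral (- D) (\<lambda>Y. dkernel (X - Y) \<bullet> h))) (at X)"
  proof (rule has_derivative_integral_dominated[of "ball X r", where g="\<lambda>Y. ?C1 * 4 ^ (2 * CARD('n)) / norm (Y - X) ^ (2 * CARD('n))"
        and f'="\<lambda>x Y h. dkernel (x - Y) \<bullet> h"])
    show "((\<lambda>x. kernel (x - Y)) has_derivative (\<bullet>) (dkernel (x - Y))) (at x)" if "x \<in> ball X r" "Y \<in> - D" for x Y
    proof -
      have "((\<lambda>x. x - Y) has_derivative (\<lambda>h. h)) (at x)" by (auto intro!: derivative_eq_intros)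
      from has_derivative_compose[OF this kernel_has_derivative[OF neq[OF that(2,1)]]] show ?thesis by simp
    qed
    show "norm (dkernel (x - Y) \<bullet> h) \<le> ?C1 * 4 ^ (2 * CARD('n)) / norm (Y - X) ^ (2 * CARD('n)) * norm h"
      if "x \<in> ball X r" "Y \<in> - D" for x Y h
      using b1[OF that(2,1)] Cauchy_Schwarz_ineq2[of "dkernel (x - Y)" h] mult_right_mono[OF b1[OF that(2,1)], of "norm h"] by simp
    show "(\<lambda>Y. dkernel (X - Y) \<bullet> h) integrable_on - D" for h
      using integrable_linear[OF K1int[OF X] bounded_linear_inner_left[of h]] by (simp add: comp_def)
  qed (use gint[of "?C1 * 4 ^ (2 * CARD('n))"] r K0int X in auto)
  moreover have "integral (- D) (\<lambda>Y. dkernel (X - Y) \<bullet> h) = grad_psi (- D) X \<bullet> h" for h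
    unfolding grad_psi_def using integral_linear[OF K1int[OF X] bounded_linear_inner_left[of h]] by (simp add: comp_def)
  ultimately show "(psi D has_derivative (\<lambda>h. grad_psi (- D) X \<bullet> h)) (at X)"
    unfolding psi_eq[abs_def] by simp
  have "((\<lambda>x. integral (- D) (\<lambda>Y. dkernel (x - Y))) has_derivative (\<lambda>h. integral (- D) (\<lambda>Y. ddkernel (X - Y) h))) (at X)"
  proof (rule has_derivative_integral_dominated[of "ball X r", where g="\<lambda>Y. ?C2 * 4 ^ (2 * CARD('n)) / norm (Y - X) ^ (2 * CARD('n))"
        and f'="\<lambda>x Y h. ddkernel (x - Y) h"])
    show "((\<lambda>x. dkernel (x - Y)) has_derivative ddkernel (x - Y)) (at x)" if "x \<in> ball X r" "Y \<in> - D" for x Y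
    proof -
      have "((\<lambda>x. x - Y) has_derivative (\<lambda>h. h)) (at x)" by (auto intro!: derivative_eq_intros)
      from has_derivative_compose[OF this dkernel_has_derivative[OF neq[OF that(2,1)]]] show ?thesis by simp
    qed
  qed (use gint[of "?C2 * 4 ^ (2 * CARD('n))"] b2 r K1int K2int X in auto)
  then show "(grad_psi (- D) has_derivative hess_psi (- D) X) (at X)"
    unfolding grad_psi_def[abs_def] hess_psi_def[abs_def] .
qed

lemma zero_in_small_ball: "(\<lambda>x. 0) \<in> (small_ball :: (real^'n::finite \<Rightarrow> real^'n) set)"
proof -
  have 0: "(\<lambda>x. 0) \<in> (C2_space :: (real^'n \<Rightarrow> real^'n) set)"
    by (simp add: C2_space_iff Cb_const)
  have "C2_norm (\<lambda>x::real^'n. 0::real^'n) \<le> 0"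
    using C2_space_scale(2)[OF 0, of 0] by simp
  then show ?thesis using 0 rho_max_pos[where 'n='n] by (simp add: C2_ball_def)
qed

text \<open>The case of \<open>admissible_tendsto\<close> in which the deformation is constantly
  zero and only the base point moves.\<close>

lemma continuous_hess_psi:
  fixes D :: "(real^'n::finite) set"
  assumes D: "open D"
  shows "continuous_on D (\<lambda>X. hess_psi (- D) X h)"
proof -
  have "(\<lambda>k. hess_psi (- D) (xk k) h) \<longlonglongrightarrow> hess_psi (- D) x h" if "xk \<longlonglongrightarrow> x" "x \<in> D" for xk x
  proof -
    have 0: "C2_dist (\<lambda>x. 0) (\<lambda>x::real^'n. 0::real^'n) = 0"
    proof -
      note z = small_ball_C2[OF zero_in_small_ball[where 'n='n]]
      show ?thesis
        using C2_space_scale(2)[OF z, of 0] C2_norm_nonneg[OF z] by (simp add: C2_dist_def)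
    qed
    have "deform D (\<lambda>x. 0) = D" by (simp add: deform_def)
    then show ?thesis
      using admissible_tendsto[OF admissible_ddkernel D that(2) zero_in_small_ball zero_in_small_ball _ that(1)]
      by (simp add: 0 hess_psi_def)
  qed
  then show ?thesis
    by (auto simp: continuous_on_sequentially comp_def)
qed

text \<open>\<open>partial j (psi D)\<close> is a total function with no formula outside
  \<open>D\<close>; openness of \<open>D\<close> lets it be replaced by a component of the gradient
  before the second derivative is taken.\<close>

lemma partial_psi:
  fixes D :: "(real^'n::finite) set"
  assumes D: "open D" and X: "X \<in> D"
  shows "has_partial i (psi D) X" "partial i (psi D) X = grad_psi (- D) X $ i"
    "has_partial i (partial j (psi D)) X" "partial i (partial j (psi D)) X = hess_psi (- D) X (axis i 1) $ j"
proof -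
  have p: "has_partial i (psi D) X" "partial i (psi D) X = grad_psi (- D) X $ i" if "X \<in> D" for X i
    using has_derivative_imp_partial[OF psi_derivatives(1)[OF D that], of i] by (auto simp: inner_axis)
  then show "has_partial i (psi D) X" "partial i (psi D) X = grad_psi (- D) X $ i"
    using X by auto
  have "((\<lambda>X. grad_psi (- D) X $ j) has_derivative (\<lambda>h. hess_psi (- D) X h $ j)) (at X)"
    by (rule bounded_linear.has_derivative[OF bounded_linear_vec_nth psi_derivatives(2)[OF D X]])
  from has_derivative_imp_partial[OF this, of i]
  show "has_partial i (partial j (psi D)) X" "partial i (partial j (psi D)) X = hess_psi (- D) X (axis i 1) $ j"
    using partial_cong_open[OF D X, of "partial j (psi D)" "\<lambda>X. grad_psi (- D) X $ j" i] p(2) by auto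
qed

lemma Ck_on_psi:
  fixes D :: "(real^'n::finite) set"
  assumes D: "open D"
  shows "Ck_on 2 D (psi D)"
  unfolding Ck_on_def
proof (intro conjI allI impI ballI)
  fix "is" :: "'n list" and i x assume l: "length is < 2" and x: "x \<in> D"
  then consider "is = []" | j where "is = [j]"
    by (cases "is") (auto simp: less_Suc_eq numeral_2_eq_2)
  then show "has_partial i (iter_partial is (psi D)) x"
    using partial_psi[OF D x] by cases auto
next
  fix "is" :: "'n list" assume "length is \<le> 2"
  then consider "is = []" | j where "is = [j]" | i j where "is = [i, j]"
    by (cases "is" rule: remdups_adj.cases) auto
  then show "continuous_on D (iter_partial is (psi D))"
  proof cases
    case 1
    then show ?thesis
      using psi_derivatives(1)[OF D] by (auto intro!: continuous_at_imp_continuous_on has_derivative_continuous)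
  next
    case (2 j)
    have "continuous_on D (grad_psi (- D))"
      using psi_derivatives(2)[OF D] by (auto intro!: continuous_at_imp_continuous_on has_derivative_continuous)
    then have "continuous_on D (\<lambda>X. grad_psi (- D) X $ j)" by (intro continuous_intros)
    then show ?thesis using partial_psi(2)[OF D] 2 by (simp cong: continuous_on_cong)
  next
    case (3 i j)
    have "continuous_on D (\<lambda>X. hess_psi (- D) X (axis i 1) $ j)"
      by (intro continuous_intros continuous_hess_psi D)
    then show ?thesis using partial_psi(4)[OF D] 3 by (simp cong: continuous_on_cong)
  qed
qed

section \<open>Degenerate critical points of deformed domains\<close>

definition degenerate :: "(real^'n::finite) set \<Rightarrow> real^'n \<Rightarrow> bool" where
  "degenerate D X \<longleftrightarrow> grad_psi (- D) X = 0 \<and> det (\<chi> i j. hess_psi (- D) X (axis i 1) $ j) = 0"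

lemma morse_on_psi_iff:
  assumes "open D"
  shows "morse_on D (psi D) \<longleftrightarrow> (\<forall>X\<in>D. \<not> degenerate D X)"
proof -
  have "critical_point (psi D) X \<longleftrightarrow> grad_psi (- D) X = 0" if "X \<in> D" for X
    using partial_psi(2)[OF assms that] by (simp add: critical_point_def vec_eq_iff)
  moreover have "hessian (psi D) X = (\<chi> i j. hess_psi (- D) X (axis i 1) $ j)" if "X \<in> D" for X
    using partial_psi(4)[OF assms that] by (simp add: hessian_def)
  ultimately show ?thesis
    using Ck_on_psi[OF assms] by (auto simp: morse_on_def degenerate_def)
qed

text \<open>The matrix in \<open>degenerate\<close> has the index order of \<open>hessian\<close>,
  which is the transpose of the matrix of the linear map \<open>hess_psi\<close>; the determinant is
  the same.\<close>

lemma degenerate_imp_not_inj: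
  fixes D :: "(real^'n::finite) set"
  assumes "open D" "X \<in> D" "degenerate D X"
  shows "\<not> inj (hess_psi (- D) X)"
proof -
  have lin: "linear (hess_psi (- D) X)"
    using psi_derivatives(2)[OF assms(1,2)] by (rule has_derivative_linear)
  have "(\<chi> i j. hess_psi (- D) X (axis i 1) $ j) = transpose (matrix (hess_psi (- D) X))"
    by (simp add: vec_eq_iff transpose_def matrix_def)
  then have "det (matrix (hess_psi (- D) X)) = 0"
    using assms(3) by (simp add: degenerate_def det_transpose)
  then show ?thesis
    by (simp add: det_nz_iff_inj[OF lin, symmetric])
qed

text \<open>Points are parametrized by the undeformed domain, so that the set \<open>C\<close> of
  base points stays fixed while \<theta> varies and compactness can be applied to it.\<close>

definition degenerate_thetas :: "(real^'n::finite) set \<Rightarrow> (real^'n) set \<Rightarrow> (real^'n \<Rightarrow> real^'n) set" where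
  "degenerate_thetas \<Omega> C = {\<theta>\<in>small_ball. \<exists>x\<in>C. degenerate (deform \<Omega> \<theta>) (x + \<theta> x)}"

lemma closed_degenerate_thetas:
  fixes \<Omega> :: "(real^'n::finite) set"
  assumes \<Omega>: "open \<Omega>" and C: "compact C" "C \<subseteq> \<Omega>"
  shows "closed_in_C2 small_ball (degenerate_thetas \<Omega> C)"
  unfolding closed_in_C2_def
proof (intro conjI ballI impI)
  show "degenerate_thetas \<Omega> C \<subseteq> small_ball" by (auto simp: degenerate_thetas_def)
  fix \<theta> :: "real^'n \<Rightarrow> real^'n"
  assume \<theta>: "\<theta> \<in> small_ball" and lim: "\<forall>\<epsilon>>0. \<exists>\<eta>\<in>degenerate_thetas \<Omega> C. C2_dist \<theta> \<eta> < \<epsilon>"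
  have "\<forall>k. \<exists>\<eta>. \<eta> \<in> degenerate_thetas \<Omega> C \<and> C2_dist \<theta> \<eta> < 1 / Suc k"
    using lim by (metis of_nat_0_less_iff zero_less_Suc zero_less_divide_1_iff)
  then obtain \<eta> where \<eta>: "\<And>k. \<eta> k \<in> degenerate_thetas \<Omega> C" "\<And>k. C2_dist \<theta> (\<eta> k) < 1 / Suc k"
    by metis
  have \<eta>B: "\<eta> k \<in> small_ball" for k using \<eta>(1) by (auto simp: degenerate_thetas_def)
  obtain v where v: "\<And>k. v k \<in> C" "\<And>k. degenerate (deform \<Omega> (\<eta> k)) (v k + \<eta> k (v k))"
    using \<eta>(1) unfolding degenerate_thetas_def by (auto simp: Bex_def) metis
  \<comment> \<open>The limit base point lies in \<open>C\<close>, hence inside \<Omega>, so the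
    gradient and the Hessian converge there along the subsequence.\<close>
  obtain x \<sigma> where x: "x \<in> C" and \<sigma>: "strict_mono \<sigma>" "(v \<circ> \<sigma>) \<longlonglongrightarrow> x"
    using C(1) v(1) unfolding compact_def by metis
  have "(\<lambda>k. C2_dist \<theta> (\<eta> k)) \<longlonglongrightarrow> 0"
  proof (rule Lim_null_comparison[OF _ LIMSEQ_inverse_real_of_nat])
    have "0 \<le> C2_dist \<theta> (\<eta> k)" for k
      unfolding C2_dist_def by (intro C2_norm_nonneg C2_space_diff small_ball_C2 \<theta> \<eta>B)
    then show "\<forall>\<^sub>F k in sequentially. norm (C2_dist \<theta> (\<eta> k)) \<le> inverse (real (Suc k))"
      using \<eta>(2) by (auto simp: inverse_eq_divide intro!: always_eventually less_imp_le)
  qed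
  from LIMSEQ_subseq_LIMSEQ[OF this \<sigma>(1)] have dl: "(\<lambda>k. C2_dist \<theta> (\<eta> (\<sigma> k))) \<longlonglongrightarrow> 0"
    by (simp add: comp_def)
  have x\<Omega>: "x \<in> \<Omega>" using x C by auto
  have conv: "(\<lambda>k. integral (- deform \<Omega> (\<eta> (\<sigma> k))) (\<lambda>Y. K (v (\<sigma> k) + \<eta> (\<sigma> k) (v (\<sigma> k)) - Y)))
      \<longlonglongrightarrow> integral (- deform \<Omega> \<theta>) (\<lambda>Y. K (x + \<theta> x - Y))" if "admissible K" for K
    using admissible_tendsto[OF that \<Omega> x\<Omega> \<theta>, of "\<lambda>k. \<eta> (\<sigma> k)" "v \<circ> \<sigma>"] \<eta>B dl \<sigma>(2) by (simp add: comp_def)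
  have "grad_psi (- deform \<Omega> \<theta>) (x + \<theta> x) = 0"
  proof (rule LIMSEQ_unique[OF _ tendsto_const])
    show "(\<lambda>k. 0) \<longlonglongrightarrow> grad_psi (- deform \<Omega> \<theta>) (x + \<theta> x)"
      using conv[OF admissible_dkernel] v(2) by (simp add: degenerate_def grad_psi_def)
  qed
  moreover have "det (\<chi> i j. hess_psi (- deform \<Omega> \<theta>) (x + \<theta> x) (axis i 1) $ j) = 0"
  proof -
    have "(\<lambda>k. hess_psi (- deform \<Omega> (\<eta> (\<sigma> k))) (v (\<sigma> k) + \<eta> (\<sigma> k) (v (\<sigma> k))) h) \<longlonglongrightarrow> hess_psi (- deform \<Omega> \<theta>) (x + \<theta> x) h" for h
      using conv[OF admissible_ddkernel[of h]] by (simp add: hess_psi_def)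
    then have "(\<lambda>k. det (\<chi> i j. hess_psi (- deform \<Omega> (\<eta> (\<sigma> k))) (v (\<sigma> k) + \<eta> (\<sigma> k) (v (\<sigma> k))) (axis i 1) $ j))
        \<longlonglongrightarrow> det (\<chi> i j. hess_psi (- deform \<Omega> \<theta>) (x + \<theta> x) (axis i 1) $ j)"
      unfolding det_def vec_lambda_beta by (intro tendsto_intros)
    then have "(\<lambda>k. 0) \<longlonglongrightarrow> det (\<chi> i j. hess_psi (- deform \<Omega> \<theta>) (x + \<theta> x) (axis i 1) $ j)"
      using v(2) by (simp add: degenerate_def)
    then show ?thesis
      by (rule LIMSEQ_unique[OF _ tendsto_const])
  qed
  ultimately show "\<theta> \<in> degenerate_thetas \<Omega> C"
    using \<theta> x by (auto simp: degenerate_thetas_def degenerate_def)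
qed

section \<open>Radial perturbations\<close>

text \<open>
  With \<open>z = Y - a\<close> the perturbation is the radial map \<open>Y \<mapsto> a + (1 + t \<bullet> rvec z) z\<close>, whose Jacobian is
  \<open>radial_jac n (rbeta z) (t \<bullet> rvec z)\<close>.  After this substitution \<open>pert (\<xi>, t)\<close> is the integrand of the gradient
  of \<open>psi\<close> of the perturbed set at \<open>a + \<xi>\<close>, and \<open>dpert\<close> is its derivative in \<open>(\<xi>, t)\<close>.
\<close>

definition rvec :: "'a::real_inner \<Rightarrow> 'a" where
  "rvec z = (1 / (1 + z \<bullet> z)\<^sup>2) *\<^sub>R z"

text \<open>Euler's relation: z \<bullet> grad u = \<open>rbeta z\<close> u for u =
  \<open>t \<bullet> rvec z\<close>. The 1 is the degree of \<open>t \<bullet> z\<close>, the other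
  term comes from the weight.\<close>

definition rbeta :: "'a::real_inner \<Rightarrow> real" where
  "rbeta z = 1 - 4 * (z \<bullet> z) / (1 + z \<bullet> z)"

text \<open>The product of the eigenvalues of the derivative: 1 + u with multiplicity n - 1, and 1 +
  u + b u in the radial direction.\<close>

definition radial_jac :: "nat \<Rightarrow> real \<Rightarrow> real \<Rightarrow> real" where
  "radial_jac n b u = (1 + u) ^ (n - 1) * (1 + u + b * u)"

definition dradial_jac :: "nat \<Rightarrow> real \<Rightarrow> real \<Rightarrow> real" where
  "dradial_jac n b u = real (n - 1) * (1 + u) ^ (n - 1 - 1) * (1 + u + b * u) + (1 + u) ^ (n - 1) * (1 + b)"

text \<open>For p = (\<xi>, t) this is the evaluation point minus the image of z, both taken
  relative to \<open>a\<close>.\<close>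

definition offset :: "'a::real_inner \<times> 'a \<Rightarrow> 'a \<Rightarrow> 'a" where
  "offset p z = fst p - (1 + snd p \<bullet> rvec z) *\<^sub>R z"

definition pert :: "(real^'n::finite) \<times> (real^'n) \<Rightarrow> real^'n \<Rightarrow> real^'n" where
  "pert p z = radial_jac CARD('n) (rbeta z) (snd p \<bullet> rvec z) *\<^sub>R dkernel (offset p z)"

definition dpert :: "(real^'n::finite) \<times> (real^'n) \<Rightarrow> real^'n \<Rightarrow> (real^'n) \<times> (real^'n) \<Rightarrow> real^'n" where
  "dpert p z h = radial_jac CARD('n) (rbeta z) (snd p \<bullet> rvec z) *\<^sub>R ddkernel (offset p z) (fst h - (snd h \<bullet> rvec z) *\<^sub>R z)
     + (dradial_jac CARD('n) (rbeta z) (snd p \<bullet> rvec z) * (snd h \<bullet> rvec z)) *\<^sub>R dkernel (offset p z)"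

section \<open>Uniform bounds for the perturbed integrand\<close>

lemma one_plus_inner_pos: "1 + z \<bullet> (z::'a::real_inner) > 0"
  using inner_ge_zero[of z] by linarith

text \<open>The weight makes both the relative stretching u and the displacement u z at most |t|, at
  every distance from \<open>a\<close>.\<close>

lemma norm_rvec_le: "norm (rvec z) \<le> 1"
  and norm_rvec_mult_le: "norm (rvec z) * norm z \<le> 1"
proof -
  let ?s = "norm z"
  have s: "z \<bullet> z = ?s\<^sup>2" by (simp add: dot_square_norm)
  have p: "(1 + ?s\<^sup>2)\<^sup>2 > 0" by (metis one_plus_inner_pos s zero_less_power)
  have n: "norm (rvec z) = ?s / (1 + ?s\<^sup>2)\<^sup>2" by (simp add: rvec_def s)
  have "0 \<le> (?s - 1)\<^sup>2" by simp
  then have a: "2 * ?s \<le> 1 + ?s\<^sup>2" by (simp add: power2_eq_square algebra_simps)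
  have b: "1 + ?s\<^sup>2 \<le> (1 + ?s\<^sup>2)\<^sup>2" by (simp add: power2_eq_square algebra_simps)
  have "?s \<le> (1 + ?s\<^sup>2)\<^sup>2" using a b norm_ge_zero[of z] by linarith
  then show "norm (rvec z) \<le> 1" using p by (simp add: n)
  have "?s * ?s \<le> (1 + ?s\<^sup>2)\<^sup>2" using b by (simp add: power2_eq_square)
  then show "norm (rvec z) * norm z \<le> 1" using p by (simp add: n)
qed

lemma inner_rvec_le: "\<bar>t \<bullet> rvec z\<bar> \<le> norm t"
  using Cauchy_Schwarz_ineq2[of t "rvec z"] mult_left_mono[OF norm_rvec_le[of z], of "norm t"] by simp

lemma norm_fst_snd_le: "norm (fst p) \<le> norm p" "norm (snd p) \<le> norm p"
  by (metis norm_fst_le prod.collapse) (metis norm_snd_le prod.collapse)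

lemma inner_rvec_mult_le: "\<bar>t \<bullet> rvec z\<bar> * norm z \<le> norm t"
proof -
  have "\<bar>t \<bullet> rvec z\<bar> * norm z \<le> (norm t * norm (rvec z)) * norm z"
    by (intro mult_right_mono Cauchy_Schwarz_ineq2) auto
  also have "\<dots> = norm t * (norm (rvec z) * norm z)" by simp
  also have "\<dots> \<le> norm t * 1" by (intro mult_left_mono norm_rvec_mult_le) auto
  finally show ?thesis by simp
qed

lemma rbeta_bounds: "-3 \<le> rbeta z" "rbeta z \<le> 1"
proof -
  have "0 \<le> (z \<bullet> z) / (1 + z \<bullet> z)" "(z \<bullet> z) / (1 + z \<bullet> z) \<le> 1"
    using one_plus_inner_pos[of z] by (auto simp: divide_le_eq)
  then show "-3 \<le> rbeta z" "rbeta z \<le> 1" unfolding rbeta_def by auto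
qed

lemma continuous_rvec: "continuous_on S f \<Longrightarrow> continuous_on S (\<lambda>z. rvec (f z))"
  unfolding rvec_def using one_plus_inner_pos
  by (auto intro!: continuous_intros simp: add_nonneg_eq_0_iff)

lemma continuous_rbeta: "continuous_on S f \<Longrightarrow> continuous_on S (\<lambda>z. rbeta (f z))"
  unfolding rbeta_def
  by (auto intro!: continuous_intros simp: add_nonneg_eq_0_iff)

lemma radial_jac_has_derivative: "(radial_jac n b has_real_derivative dradial_jac n b u) (at u)"
  unfolding radial_jac_def[abs_def] dradial_jac_def
  by (auto intro!: derivative_eq_intros simp: algebra_simps)

text \<open>With |u| <= 1/8 and |b| <= 3 the last factor is at least 7/8 - 3/8 = 1/2. This is the
  origin of the bound 1/8 on the parameters; positivity lets the absolute value of the Jacobian be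
  dropped.\<close>

lemma radial_jac_bounds:
  assumes u: "\<bar>u\<bar> \<le> 1/8" and b: "-3 \<le> b" "b \<le> 1"
  shows "0 < radial_jac n b u" "\<bar>radial_jac n b u\<bar> \<le> 2 ^ n * 2" "\<bar>dradial_jac n b u\<bar> \<le> real n * 2 ^ n * 2 + 2 ^ n * 4"
proof -
  have "\<bar>b * u\<bar> \<le> 3 * (1/8)"
    unfolding abs_mult using u b by (intro mult_mono) auto
  then have l: "1 + u + b * u \<ge> 1/2" "1 + u + b * u \<le> 2"
    using u by (auto simp: abs_le_iff)
  have g: "1 + u \<ge> 7/8" "1 + u \<le> 2" using u by auto
  show "0 < radial_jac n b u" unfolding radial_jac_def using l g by (intro mult_pos_pos zero_less_power) auto
  have pw: "\<bar>1 + u\<bar> ^ k \<le> 2 ^ n" if "k \<le> n" for k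
  proof -
    have "\<bar>1 + u\<bar> ^ k \<le> 2 ^ k" using g by (intro power_mono) auto
    also have "\<dots> \<le> 2 ^ n" using that by (intro power_increasing) auto
    finally show ?thesis .
  qed
  show "\<bar>radial_jac n b u\<bar> \<le> 2 ^ n * 2"
    unfolding radial_jac_def abs_mult power_abs using l pw[of "n - 1"] by (intro mult_mono) auto
  have "\<bar>dradial_jac n b u\<bar> \<le> real (n - 1) * \<bar>1 + u\<bar> ^ (n - 1 - 1) * \<bar>1 + u + b * u\<bar> + \<bar>1 + u\<bar> ^ (n - 1) * \<bar>1 + b\<bar>"
    unfolding dradial_jac_def using abs_triangle_ineq[of "real (n - 1) * (1 + u) ^ (n - 1 - 1) * (1 + u + b * u)" "(1 + u) ^ (n - 1) * (1 + b)"]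
    by (simp add: abs_mult power_abs)
  also have "\<dots> \<le> real n * 2 ^ n * 2 + 2 ^ n * 4"
    using l b pw[of "n - 1"] pw[of "n - 1 - 1"] by (intro add_mono mult_mono) auto
  finally show "\<bar>dradial_jac n b u\<bar> \<le> real n * 2 ^ n * 2 + 2 ^ n * 4" .
qed

text \<open>Since |z| >= r, the offset has norm at least 7/8 |z| - r/4 >= 5/8 |z|, which exceeds
  both lower bounds.\<close>

lemma offset_far:
  assumes r: "r > 0" "r \<le> norm z" and p: "norm p < min (r/4) (1/8)"
  shows "norm z / 4 \<le> norm (offset p z)" "r / 2 \<le> norm (offset p z)" "\<bar>snd p \<bullet> rvec z\<bar> \<le> 1/8"
proof -
  have f: "norm (fst p) < r/4" and s: "norm (snd p) < 1/8"
    using p norm_fst_snd_le[of p] by auto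
  show u: "\<bar>snd p \<bullet> rvec z\<bar> \<le> 1/8"
    using inner_rvec_le[of "snd p" z] s by linarith
  then have "7/8 \<le> \<bar>1 + snd p \<bullet> rvec z\<bar>" by linarith
  then have "7/8 * norm z \<le> norm ((1 + snd p \<bullet> rvec z) *\<^sub>R z)"
    unfolding norm_scaleR by (intro mult_right_mono) auto
  moreover have "norm ((1 + snd p \<bullet> rvec z) *\<^sub>R z) \<le> norm (fst p) + norm (offset p z)"
    unfolding offset_def using norm_triangle_ineq4[of "fst p" "fst p - (1 + snd p \<bullet> rvec z) *\<^sub>R z"] by simp
  ultimately show "norm z / 4 \<le> norm (offset p z)" "r / 2 \<le> norm (offset p z)"
    using f r by linarith+
qed

lemma pert_has_derivative:
  fixes z :: "real^'n::finite"
  assumes "offset p z \<noteq> 0"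
  shows "((\<lambda>p. pert p z) has_derivative dpert p z) (at p)"
proof -
  have u: "((\<lambda>p. snd p \<bullet> rvec z) has_derivative (\<lambda>h. snd h \<bullet> rvec z)) (at p)"
    by (auto intro!: derivative_eq_intros)
  have "((\<lambda>p. offset p z) has_derivative (\<lambda>h. fst h - (snd h \<bullet> rvec z) *\<^sub>R z)) (at p)"
    unfolding offset_def by (auto intro!: derivative_eq_intros)
  from has_derivative_compose[OF this dkernel_has_derivative[OF assms]]
  have k: "((\<lambda>p. dkernel (offset p z)) has_derivative (\<lambda>h. ddkernel (offset p z) (fst h - (snd h \<bullet> rvec z) *\<^sub>R z))) (at p)" .
  have "(radial_jac CARD('n) (rbeta z) has_derivative (\<lambda>x. dradial_jac CARD('n) (rbeta z) (snd p \<bullet> rvec z) * x)) (at (snd p \<bullet> rvec z))"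
    using radial_jac_has_derivative unfolding has_field_derivative_def .
  from has_derivative_scaleR[OF has_derivative_compose[OF u this] k]
  show ?thesis
    unfolding pert_def[abs_def] dpert_def[abs_def] .
qed

lemma continuous_pert:
  fixes S :: "(real^'n::finite) set"
  assumes "\<And>z. z \<in> S \<Longrightarrow> offset p z \<noteq> 0"
  shows "continuous_on S (pert p)" "continuous_on S (\<lambda>z. dpert p z h)"
proof -
  have z: "continuous_on S (offset p)"
    unfolding offset_def[abs_def] by (intro continuous_intros continuous_rvec)
  have zz: "offset p z \<bullet> offset p z \<noteq> 0" if "z \<in> S" for z using assms[OF that] by simp
  show "continuous_on S (pert p)"
    unfolding pert_def[abs_def] radial_jac_def
    by (intro continuous_intros continuous_rvec continuous_rbeta continuous_on_kernels z assms)
  show "continuous_on S (\<lambda>z. dpert p z h)"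
    unfolding dpert_def radial_jac_def dradial_jac_def ddkernel_def
    by (intro continuous_intros continuous_rvec continuous_rbeta continuous_on_kernels z assms) (use assms in auto)
qed

text \<open>One constant for \<open>pert\<close> and \<open>dpert\<close>. The radius r/2 is the
  lower bound for the offset, the isolated factor 2 estimates the direction inserted into
  \<open>ddkernel\<close>, and the power of 4 moves the pole back to the origin.\<close>

definition pert_const :: "'n::finite itself \<Rightarrow> real \<Rightarrow> real" where
  "pert_const _ r = (2 ^ CARD('n) * 2 * (2 * real CARD('n) * (2 * real CARD('n) + 3) / (r/2)\<^sup>2) * 2
     + (real CARD('n) * 2 ^ CARD('n) * 2 + 2 ^ CARD('n) * 4 + 2 ^ CARD('n) * 2) * (2 * real CARD('n) / (r/2))) * 4 ^ (2 * CARD('n))"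

lemma pert_bounds:
  fixes z :: "real^'n::finite"
  assumes r: "r > 0" "r \<le> norm z" and p: "norm p < min (r/4) (1/8)"
  shows "norm (pert p z) \<le> pert_const TYPE('n) r / norm (z - 0) ^ (2 * CARD('n))"
    "norm (dpert p z h) \<le> pert_const TYPE('n) r / norm (z - 0) ^ (2 * CARD('n)) * norm h"
proof -
  let ?N = "CARD('n)"
  define CJ :: real where "CJ = 2 ^ ?N * 2"
  define CD where "CD = real ?N * 2 ^ ?N * 2 + 2 ^ ?N * 4"
  define C1 where "C1 = 2 * real ?N / (r/2)"
  define C2 where "C2 = 2 * real ?N * (2 * real ?N + 3) / (r/2)\<^sup>2"
  let ?Z = "norm (offset p z) ^ (2 * ?N)"
  let ?u = "snd p \<bullet> rvec z"
  have r2: "0 < r / 2" using r by simp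
  have J: "\<bar>radial_jac ?N (rbeta z) ?u\<bar> \<le> CJ" "\<bar>dradial_jac ?N (rbeta z) ?u\<bar> \<le> CD"
    using radial_jac_bounds[OF offset_far(3)[OF r p] rbeta_bounds] by (auto simp: CJ_def CD_def)
  have k1: "norm (dkernel (offset p z)) \<le> C1 / ?Z"
    unfolding C1_def by (rule dkernel_bound[OF r2 offset_far(2)[OF r p]])
  have k2: "norm (ddkernel (offset p z) k) \<le> C2 / ?Z * norm k" for k
    unfolding C2_def by (rule ddkernel_bound[OF r2 offset_far(2)[OF r p]])
  have shift: "A / ?Z \<le> A * 4 ^ (2 * ?N) / norm (z - 0) ^ (2 * ?N)" if "A \<ge> 0" for A
    by (rule kernel_bound_shift[OF that]) (use offset_far(1)[OF r p] r in auto)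
  define A where "A = CJ * C2 * 2 + (CD + CJ) * C1"
  have A: "pert_const TYPE('n) r = A * 4 ^ (2 * ?N)" by (simp add: A_def pert_const_def CJ_def CD_def C1_def C2_def)
  have pos: "C1 \<ge> 0" "C2 \<ge> 0" "CJ \<ge> 0" "CD \<ge> 0" using r by (auto simp: C1_def C2_def CJ_def CD_def)
  have pos': "CJ * C2 \<ge> 0" "CD * C1 \<ge> 0" "CJ * C1 \<ge> 0"
    using pos by auto
  have A0: "A \<ge> 0" "CJ * C1 \<le> A" "CJ * C2 * 2 + CD * C1 \<le> A"
    unfolding A_def distrib_right using pos' by linarith+
  have "norm (pert p z) \<le> CJ * (C1 / ?Z)"
    unfolding pert_def norm_scaleR using J k1 by (intro mult_mono) auto
  also have "\<dots> \<le> A / ?Z"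
    using divide_right_mono[OF A0(2), of ?Z] by simp
  also have "\<dots> \<le> A * 4 ^ (2 * ?N) / norm (z - 0) ^ (2 * ?N)" by (rule shift[OF A0(1)])
  finally show "norm (pert p z) \<le> pert_const TYPE('n) r / norm (z - 0) ^ (2 * ?N)" unfolding A .
  have hh: "norm (fst h - (snd h \<bullet> rvec z) *\<^sub>R z) \<le> 2 * norm h"
  proof -
    have "norm (fst h - (snd h \<bullet> rvec z) *\<^sub>R z) \<le> norm (fst h) + \<bar>snd h \<bullet> rvec z\<bar> * norm z"
      using norm_triangle_ineq4[of "fst h" "(snd h \<bullet> rvec z) *\<^sub>R z"] by simp
    then show ?thesis
      using inner_rvec_mult_le[of "snd h" z] norm_fst_snd_le[of h] by linarith
  qed
  have sh: "\<bar>snd h \<bullet> rvec z\<bar> \<le> norm h"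
    using inner_rvec_le[of "snd h" z] norm_fst_snd_le[of h] by linarith
  have "norm (dpert p z h) \<le> \<bar>radial_jac ?N (rbeta z) ?u\<bar> * norm (ddkernel (offset p z) (fst h - (snd h \<bullet> rvec z) *\<^sub>R z))
      + (\<bar>dradial_jac ?N (rbeta z) ?u\<bar> * \<bar>snd h \<bullet> rvec z\<bar>) * norm (dkernel (offset p z))"
    unfolding dpert_def by (rule order_trans[OF norm_triangle_ineq]) (simp add: abs_mult)
  also have "\<dots> \<le> CJ * (C2 / ?Z * (2 * norm h)) + (CD * norm h) * (C1 / ?Z)"
  proof (intro add_mono mult_mono J sh k1)
    show "norm (ddkernel (offset p z) (fst h - (snd h \<bullet> rvec z) *\<^sub>R z)) \<le> C2 / ?Z * (2 * norm h)"
      by (rule order_trans[OF k2 mult_left_mono[OF hh]]) (use pos in auto)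
  qed (use pos in auto)
  also have "\<dots> = (CJ * C2 * 2 + CD * C1) / ?Z * norm h"
    by (simp add: add_divide_distrib distrib_left mult_ac)
  also have "\<dots> \<le> A / ?Z * norm h"
    by (intro mult_right_mono divide_right_mono A0) auto
  also have "\<dots> \<le> (A * 4 ^ (2 * ?N) / norm (z - 0) ^ (2 * ?N)) * norm h"
    by (intro mult_right_mono shift[OF A0(1)]) auto
  finally show "norm (dpert p z h) \<le> pert_const TYPE('n) r / norm (z - 0) ^ (2 * ?N) * norm h" unfolding A .
qed

lemma pert_integrable:
  fixes S :: "(real^'n::finite) set"
  assumes S: "closed S" "\<And>z. z \<in> S \<Longrightarrow> r \<le> norm z" and r: "r > 0" and p: "norm p < min (r/4) (1/8)"
  shows "pert p absolutely_integrable_on S" "(\<lambda>z. dpert p z h) absolutely_integrable_on S"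
    "(\<lambda>z. pert_const TYPE('n) r / norm (z - 0) ^ (2 * CARD('n))) integrable_on S"
proof -
  have S': "r \<le> norm (z - 0)" if "z \<in> S" for z using S(2)[OF that] by simp
  have nz: "offset p z \<noteq> 0" if "z \<in> S" for z using offset_far(2)[OF r S(2)[OF that] p] r by auto
  show "pert p absolutely_integrable_on S"
    by (rule absolutely_integrable_kernel_bound(1)[OF S(1) S' r continuous_pert(1)[OF nz] pert_bounds(1)[OF r S(2) p]])
  show "(\<lambda>z. pert_const TYPE('n) r / norm (z - 0) ^ (2 * CARD('n))) integrable_on S"
    by (rule absolutely_integrable_kernel_bound(2)[OF S(1) S' r continuous_pert(1)[OF nz] pert_bounds(1)[OF r S(2) p]])
  show "(\<lambda>z. dpert p z h) absolutely_integrable_on S"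
  proof (rule absolutely_integrable_kernel_bound(1)[OF S(1) S' r continuous_pert(2)[OF nz], where C="pert_const TYPE('n) r * norm h"])
    show "norm (dpert p z h) \<le> pert_const TYPE('n) r * norm h / norm (z - 0) ^ (2 * CARD('n))" if "z \<in> S" for z
      using pert_bounds(2)[OF r S(2)[OF that] p, of h] by simp
  qed
qed

lemma pert_integral_has_derivative:
  fixes S :: "(real^'n::finite) set"
  assumes S: "closed S" "\<And>z. z \<in> S \<Longrightarrow> r \<le> norm z" and r: "r > 0" and p: "norm p < min (r/4) (1/8)"
  shows "((\<lambda>p. integral S (pert p)) has_derivative (\<lambda>h. integral S (\<lambda>z. dpert p z h))) (at p)"
proof (rule has_derivative_integral_dominated[of "ball 0 (min (r/4) (1/8))", where g="\<lambda>z. pert_const TYPE('n) r / norm (z - 0) ^ (2 * CARD('n))"])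
  show "((\<lambda>p. pert p z) has_derivative dpert p z) (at p)" if "p \<in> ball 0 (min (r/4) (1/8))" "z \<in> S" for p z
    using offset_far(2)[OF r S(2)[OF that(2)], of p] that(1) r by (intro pert_has_derivative) auto
  show "norm (dpert p z h) \<le> pert_const TYPE('n) r / norm (z - 0) ^ (2 * CARD('n)) * norm h"
    if "p \<in> ball 0 (min (r/4) (1/8))" "z \<in> S" for p z h
    using that by (intro pert_bounds(2) r S(2)) auto
  show "pert p integrable_on S" if "p \<in> ball 0 (min (r/4) (1/8))" for p
    using pert_integrable(1)[OF S r, of p] that by (auto simp: absolutely_integrable_on_def)
  show "(\<lambda>z. dpert p z h) integrable_on S" for h
    using pert_integrable(2)[OF S r p] by (auto simp: absolutely_integrable_on_def)
qed (use pert_integrable(3)[OF S r p] p in auto)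

text \<open>\<open>dkernel\<close> is homogeneous of degree - 2n - 1, and at u = 0 the Jacobian has
  logarithmic derivative n + \<beta> with \<beta> = \<open>rbeta z\<close>; together they give - (n
  + 1 - \<beta>), which is negative because \<beta> <= 1.\<close>

lemma dpert_origin:
  fixes z \<tau> :: "real^'n::finite"
  assumes "z \<noteq> 0"
  shows "\<tau> \<bullet> dpert 0 z (0, \<tau>) = - (2 * real CARD('n) * (\<tau> \<bullet> z)\<^sup>2 * (real CARD('n) + 1 - rbeta z) / ((1 + z \<bullet> z)\<^sup>2 * (z \<bullet> z) ^ (CARD('n) + 1)))"
proof -
  let ?n = "CARD('n)"
  define s where "s = z \<bullet> z"
  define c where "c = \<tau> \<bullet> rvec z"
  have s: "s \<noteq> 0" using assms by (simp add: s_def)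
  have n1: "real (?n - 1) = real ?n - 1" using zero_less_card_finite[where 'a='n] by (simp add: of_nat_diff Suc_le_eq)
  have zt: "offset 0 z = - z" by (simp add: offset_def)
  have J: "radial_jac ?n (rbeta z) 0 = 1" "dradial_jac ?n (rbeta z) 0 = real ?n + rbeta z"
    by (simp_all add: radial_jac_def dradial_jac_def n1)
  have k1: "dkernel (- z) = (2 * real ?n / s ^ (?n + 1)) *\<^sub>R z"
    by (simp add: dkernel_def s_def)
  have k2: "ddkernel (- z) (- (c *\<^sub>R z)) = (c * (2 * real ?n - 4 * real ?n * (real ?n + 1)) / s ^ (?n + 1)) *\<^sub>R z"
  proof -
    have "ddkernel (- z) (- (c *\<^sub>R z)) = (c * (2 * real ?n) / s ^ (?n + 1)) *\<^sub>R z - (4 * real ?n * (real ?n + 1) * (c * s) / s ^ (?n + 2)) *\<^sub>R z"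
      by (simp add: ddkernel_def s_def)
    also have "4 * real ?n * (real ?n + 1) * (c * s) / s ^ (?n + 2) = c * (4 * real ?n * (real ?n + 1)) / s ^ (?n + 1)"
      using s by simp
    finally show ?thesis
      by (simp only: scaleR_diff_left[symmetric] diff_divide_distrib[symmetric] right_diff_distrib)
  qed
  have "dpert 0 z (0, \<tau>) = ddkernel (- z) (- (c *\<^sub>R z)) + ((real ?n + rbeta z) * c) *\<^sub>R dkernel (- z)"
    unfolding dpert_def by (simp add: zt J c_def)
  also have "\<dots> = (c * (2 * real ?n - 4 * real ?n * (real ?n + 1)) / s ^ (?n + 1) + (real ?n + rbeta z) * c * (2 * real ?n / s ^ (?n + 1))) *\<^sub>R z"
    unfolding k1 k2 by (simp add: scaleR_add_left)
  also have "c * (2 * real ?n - 4 * real ?n * (real ?n + 1)) / s ^ (?n + 1) + (real ?n + rbeta z) * c * (2 * real ?n / s ^ (?n + 1))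
      = - (2 * real ?n * c * (real ?n + 1 - rbeta z) / s ^ (?n + 1))"
  proof -
    have "c * (2 * real ?n - 4 * real ?n * (real ?n + 1)) + (real ?n + rbeta z) * c * (2 * real ?n)
        = - (2 * real ?n * c * (real ?n + 1 - rbeta z))"
      by (simp add: algebra_simps)
    then show ?thesis
      unfolding times_divide_eq_right add_divide_distrib[symmetric] by simp
  qed
  finally have "\<tau> \<bullet> dpert 0 z (0, \<tau>) = - (2 * real ?n * c * (real ?n + 1 - rbeta z) / s ^ (?n + 1)) * (\<tau> \<bullet> z)"
    by simp
  moreover have "c = (\<tau> \<bullet> z) / (1 + s)\<^sup>2" by (simp add: c_def rvec_def s_def)
  ultimately show ?thesis
    by (simp add: s_def power2_eq_square algebra_simps)
qed

text \<open>
  The constants below depend on the set \<open>S\<close> only through the radii \<open>r\<close> and \<open>R\<close>; hence the same ball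
  of base points works for all deformations at once.
\<close>

lemma dpert_origin_negative_definite:
  assumes R: "R > 0"
  obtains c where "c > 0" "\<And>S r (\<tau>::real^'n::finite). \<lbrakk>closed S; r > 0; \<And>z. z \<in> S \<Longrightarrow> r \<le> norm z; {z. R \<le> norm z} \<subseteq> S\<rbrakk> \<Longrightarrow>
     \<tau> \<bullet> integral S (\<lambda>z. dpert 0 z (0, \<tau>)) \<le> - c * (norm \<tau>)\<^sup>2"
proof -
  let ?n = "CARD('n)"
  \<comment> \<open>A lower bound for the integrand divided by |\<tau>|^2, on a ball where \<tau>
    \<bullet> z >= 2 R |\<tau>| and |z| <= 4 R; \<open>V\<close> is the volume of that ball.\<close>
  define \<mu> where "\<mu> = 2 * real ?n * (2 * R)\<^sup>2 / ((1 + (4 * R)\<^sup>2)\<^sup>2 * ((4 * R)\<^sup>2) ^ (?n + 1))"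
  define V where "V = unit_ball_vol ?n * R ^ ?n"
  have n: "1 \<le> real ?n" by (simp add: Suc_le_eq)
  have den: "(1 + (4 * R)\<^sup>2)\<^sup>2 * ((4 * R)\<^sup>2) ^ (?n + 1) > 0"
    using R by (intro mult_pos_pos zero_less_power) (auto intro: add_pos_pos)
  have \<mu>: "\<mu> > 0" unfolding \<mu>_def using R n den by (intro divide_pos_pos mult_pos_pos) auto
  have V: "V > 0" using R by (simp add: V_def)
  show ?thesis
  proof (rule that[of "\<mu> * V"])
    show "\<mu> * V > 0" using \<mu> V by simp
    fix S :: "(real^'n) set" and r and \<tau> :: "real^'n"
    assume S: "closed S" "r > 0" "\<And>z. z \<in> S \<Longrightarrow> r \<le> norm z" "{z. R \<le> norm z} \<subseteq> S"
    have p0: "norm (0 :: (real^'n) \<times> (real^'n)) < min (r/4) (1/8)" using S(2) by simp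
    have int: "(\<lambda>z. dpert 0 z (0, \<tau>)) absolutely_integrable_on S"
      by (rule pert_integrable(2)[OF S(1,3,2) p0])
    define m where "m z = - (\<tau> \<bullet> dpert 0 z (0, \<tau>))" for z
    have mint: "m absolutely_integrable_on S"
      using absolutely_integrable_linear[OF int bounded_linear_minus[OF bounded_linear_inner_right[of \<tau>]]]
      by (simp add: m_def[abs_def] comp_def)
    have m_eq: "m z = 2 * real ?n * (\<tau> \<bullet> z)\<^sup>2 * (real ?n + 1 - rbeta z) / ((1 + z \<bullet> z)\<^sup>2 * (z \<bullet> z) ^ (?n + 1))" if "z \<noteq> 0" for z
      unfolding m_def dpert_origin[OF that] by simp
    have m0: "0 \<le> m z" if "z \<in> S" for z
    proof -
      have "z \<noteq> 0" using S(2) S(3)[OF that] by auto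
      then show ?thesis
        unfolding m_eq[OF \<open>z \<noteq> 0\<close>] using rbeta_bounds(2)[of z] n by (intro divide_nonneg_nonneg mult_nonneg_nonneg) auto
    qed
    have I: "\<tau> \<bullet> integral S (\<lambda>z. dpert 0 z (0, \<tau>)) = - integral S m"
      using integral_linear[OF _ bounded_linear_inner_right[of \<tau>], of "\<lambda>z. dpert 0 z (0, \<tau>)" S] int
      by (simp add: m_def[abs_def] comp_def absolutely_integrable_on_def)
    have "\<mu> * V * (norm \<tau>)\<^sup>2 \<le> integral S m"
    proof (cases "\<tau> = 0")
      case True
      then show ?thesis using integral_nonneg[of m S] m0 mint by (simp add: absolutely_integrable_on_def)
    next
      case False
      define e where "e = \<tau> /\<^sub>R norm \<tau>"
      have e: "norm e = 1" "\<tau> = norm \<tau> *\<^sub>R e" using False by (auto simp: e_def)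
      \<comment> \<open>A test ball on the ray through \<tau>. Its points have norm at least 2 R, so
        it lies in \<open>S\<close> whatever \<open>S\<close> is, and the integrand is nonnegative
        on the rest of \<open>S\<close>.\<close>
      define B where "B = cball ((3 * R) *\<^sub>R e) R"
      have B: "2 * R \<le> e \<bullet> z" "norm z \<le> 4 * R" "2 * R \<le> norm z" if "z \<in> B" for z
      proof -
        have d: "norm (z - (3 * R) *\<^sub>R e) \<le> R"
          using that by (simp add: B_def dist_norm norm_minus_commute)
        have "\<bar>e \<bullet> (z - (3 * R) *\<^sub>R e)\<bar> \<le> R"
          using Cauchy_Schwarz_ineq2[of e "z - (3 * R) *\<^sub>R e"] d e(1) by simp
        moreover have "e \<bullet> e = 1" using e(1) by (simp add: dot_square_norm)
        ultimately show "2 * R \<le> e \<bullet> z" by (simp add: inner_diff_right abs_le_iff)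
        then show "2 * R \<le> norm z" using norm_cauchy_schwarz[of e z] e(1) by simp
        show "norm z \<le> 4 * R"
          using norm_triangle_ineq[of "z - (3 * R) *\<^sub>R e" "(3 * R) *\<^sub>R e"] d e(1) R by simp
      qed
      have BS: "B \<subseteq> S" using B(3) S(4) R by fastforce
      have Bm: "B \<in> lmeasurable" by (simp add: B_def)
      have mB: "m absolutely_integrable_on B"
        by (rule set_integrable_subset[OF mint _ BS]) (use Bm in auto)
      have lower: "\<mu> * (norm \<tau>)\<^sup>2 \<le> m z" if z: "z \<in> B" for z
      proof -
        have z0: "z \<noteq> 0" using B(3)[OF z] R by auto
        have s: "z \<bullet> z \<le> (4 * R)\<^sup>2" unfolding dot_square_norm using B(2)[OF z] by (intro power_mono) auto
        have "norm \<tau> * (2 * R) \<le> norm \<tau> * (e \<bullet> z)" using B(1)[OF z] by (intro mult_left_mono) auto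
        also have "\<dots> = \<tau> \<bullet> z" by (subst (2) e(2)) simp
        finally have "(norm \<tau> * (2 * R))\<^sup>2 \<le> (\<tau> \<bullet> z)\<^sup>2" using R by (intro power_mono) auto
        moreover have "1 \<le> real ?n + 1 - rbeta z" using rbeta_bounds(2)[of z] n by linarith
        ultimately have num: "2 * real ?n * (norm \<tau> * (2 * R))\<^sup>2 * 1 \<le> 2 * real ?n * (\<tau> \<bullet> z)\<^sup>2 * (real ?n + 1 - rbeta z)"
          by (intro mult_mono mult_left_mono) auto
        have "2 * real ?n * (norm \<tau> * (2 * R))\<^sup>2 * 1 / ((1 + (4 * R)\<^sup>2)\<^sup>2 * ((4 * R)\<^sup>2) ^ (?n + 1)) \<le> m z"
          unfolding m_eq[OF z0]
        proof (rule frac_le[OF order_trans[OF _ num] num])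
          show "0 < (1 + z \<bullet> z)\<^sup>2 * (z \<bullet> z) ^ (?n + 1)"
            using z0 one_plus_inner_pos[of z] by (intro mult_pos_pos zero_less_power) auto
          show "(1 + z \<bullet> z)\<^sup>2 * (z \<bullet> z) ^ (?n + 1) \<le> (1 + (4 * R)\<^sup>2)\<^sup>2 * ((4 * R)\<^sup>2) ^ (?n + 1)"
            using s by (intro mult_mono power_mono add_left_mono) auto
        qed auto
        then show ?thesis
          unfolding \<mu>_def power_mult_distrib[of "norm \<tau>" "2 * R"] mult_1_right times_divide_eq_left
          by (simp only: mult_ac)
      qed
      have "\<mu> * V * (norm \<tau>)\<^sup>2 = \<mu> * (norm \<tau>)\<^sup>2 * measure lebesgue B"
        using R by (simp add: V_def B_def content_cball)
      also have "\<dots> = integral B (\<lambda>z. \<mu> * (norm \<tau>)\<^sup>2)"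
        using lmeasure_integral[OF Bm] integral_mult_right[of B "\<mu> * (norm \<tau>)\<^sup>2" "\<lambda>_. 1"] by (simp only: mult_1_right)
      also have "\<dots> \<le> integral B m"
        using lower mB Bm by (intro integral_le integrable_on_const) (auto simp: absolutely_integrable_on_def)
      also have "\<dots> \<le> integral S m"
        using BS mB mint m0 by (intro integral_subset_le) (auto simp: absolutely_integrable_on_def)
      finally show ?thesis .
    qed
    then show "\<tau> \<bullet> integral S (\<lambda>z. dpert 0 z (0, \<tau>)) \<le> - (\<mu> * V) * (norm \<tau>)\<^sup>2"
      unfolding I by simp
  qed
qed

lemma continuous_dpert_param:
  fixes z :: "real^'n::finite"
  shows "continuous_on {p. offset p z \<noteq> 0} (\<lambda>p. dpert p z h)"
proof -
  have z: "continuous_on S (\<lambda>p. offset p z)" for S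
    unfolding offset_def by (intro continuous_intros)
  show ?thesis
    unfolding dpert_def radial_jac_def dradial_jac_def
    by (intro continuous_intros continuous_on_kernels z) auto
qed

lemma linear_vec_expansion:
  fixes f :: "real^'n::finite \<Rightarrow> 'b::real_vector"
  assumes "linear f"
  shows "f x = (\<Sum>j\<in>UNIV. x $ j *\<^sub>R f (axis j 1))"
proof -
  have "f x = f (\<Sum>j\<in>UNIV. x $ j *\<^sub>R axis j 1)"
    using basis_expansion[of x] by (simp add: scalar_mult_eq_scaleR)
  then show ?thesis
    by (simp add: linear_sum[OF assms] linear_scale[OF assms])
qed

text \<open>A perturbation of the case p = 0. The change of the form is estimated by integrals of
  norms over the largest possible set \<open>S0\<close>, so one neighbourhood of the origin serves
  every \<open>S\<close>; half of the constant absorbs the change.\<close>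

lemma dpert_uniformly_negative_definite:
  assumes r: "r > 0" and R: "R > 0"
  obtains \<epsilon> c where "\<epsilon> > 0" "c > 0" "\<epsilon> \<le> min (r/4) (1/8)"
    "\<And>S p (\<tau>::real^'n::finite). \<lbrakk>closed S; \<And>z. z \<in> S \<Longrightarrow> r \<le> norm z; {z. R \<le> norm z} \<subseteq> S; norm p < \<epsilon>\<rbrakk> \<Longrightarrow>
     \<tau> \<bullet> integral S (\<lambda>z. dpert p z (0, \<tau>)) \<le> - c * (norm \<tau>)\<^sup>2"
proof -
  obtain c where c: "c > 0" "\<And>S r (\<tau>::real^'n). \<lbrakk>closed S; r > 0; \<And>z. z \<in> S \<Longrightarrow> r \<le> norm z; {z. R \<le> norm z} \<subseteq> S\<rbrakk> \<Longrightarrow>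
     \<tau> \<bullet> integral S (\<lambda>z. dpert 0 z (0, \<tau>)) \<le> - c * (norm \<tau>)\<^sup>2"
    using dpert_origin_negative_definite[OF R, where 'n='n] by metis
  define \<delta> where "\<delta> = min (r/4) (1/8)"
  have \<delta>: "\<delta> > 0" using r by (simp add: \<delta>_def)
  define S0 where "S0 = {z :: real^'n. r \<le> norm z}"
  have S0: "closed S0" "\<And>z. z \<in> S0 \<Longrightarrow> r \<le> norm z"
    unfolding S0_def by (auto intro!: closed_Collect_le continuous_intros)
  \<comment> \<open>By linearity in \<tau> only the n coordinate directions have to be compared with
    p = 0; \<open>E\<close> collects their errors.\<close>
  define D where "D j p z = dpert p z (0, axis j 1) - dpert 0 z (0, axis j 1)" for j :: 'n and p and z :: "real^'n"
  define E where "E p = (\<Sum>j\<in>UNIV. integral S0 (\<lambda>z. norm (D j p z)))" for p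
  have Dint: "D j p absolutely_integrable_on S"
    if "closed S" "\<And>z. z \<in> S \<Longrightarrow> r \<le> norm z" "norm p < \<delta>" for j p S
    unfolding D_def[abs_def] using that \<delta>
    by (intro set_integral_diff(1) pert_integrable(2)[OF _ _ r]) (auto simp: \<delta>_def)
  have E_lim: "(E \<longlongrightarrow> 0) (at 0 within ball 0 \<delta>)"
    unfolding tendsto_at_iff_sequentially
  proof (intro allI impI)
    fix P :: "nat \<Rightarrow> (real^'n) \<times> (real^'n)"
    assume P: "\<forall>i. P i \<in> ball 0 \<delta> - {0}" and lim: "P \<longlonglongrightarrow> 0"
    have Pb: "norm (P k) < min (r/4) (1/8)" for k using P by (auto simp: \<delta>_def)
    have z0: "norm (0 :: (real^'n) \<times> (real^'n)) < min (r/4) (1/8)" using r by simp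
    have "(\<lambda>k. integral S0 (\<lambda>z. norm (D j (P k) z))) \<longlonglongrightarrow> integral S0 (\<lambda>z. 0)" for j
    proof (rule dominated_convergence(2))
      show "(\<lambda>z. norm (D j (P k) z)) integrable_on S0" for k
        using Dint[OF S0, of "P k" j] Pb[of k] by (simp add: absolutely_integrable_on_def \<delta>_def)
      show "(\<lambda>z. 2 * (pert_const TYPE('n) r / norm (z - 0) ^ (2 * CARD('n)))) integrable_on S0"
        using integrable_cmul[OF pert_integrable(3)[OF S0 r z0], of 2] by simp
      show "norm (norm (D j (P k) z)) \<le> 2 * (pert_const TYPE('n) r / norm (z - 0) ^ (2 * CARD('n)))" if "z \<in> S0" for k z
      proof -
        have a: "norm (axis j 1 :: real^'n) = 1" by simp
        have h: "norm ((0, axis j 1) :: (real^'n) \<times> (real^'n)) = 1" by (simp add: norm_Pair a)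
        show ?thesis
          unfolding D_def
          using norm_triangle_ineq4[of "dpert (P k) z (0, axis j 1)" "dpert 0 z (0, axis j 1)"]
            pert_bounds(2)[OF r S0(2)[OF that] Pb[of k], of "(0, axis j 1)"]
            pert_bounds(2)[OF r S0(2)[OF that] z0, of "(0, axis j 1)"] unfolding h by simp
      qed
      show "(\<lambda>k. norm (D j (P k) z)) \<longlonglongrightarrow> 0" if "z \<in> S0" for z
      proof -
        have nz: "offset p z \<noteq> 0" if "norm p < min (r/4) (1/8)" for p
          using offset_far(2)[OF r S0(2)[OF \<open>z \<in> S0\<close>] that] r by auto
        have "(\<lambda>k. dpert (P k) z (0, axis j 1)) \<longlonglongrightarrow> dpert 0 z (0, axis j 1)"
          by (rule continuous_on_tendsto_compose[OF continuous_dpert_param lim])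
             (use nz[OF z0] nz[OF Pb] in auto)
        then show ?thesis
          unfolding D_def by (intro tendsto_norm_zero) (rule LIM_zero)
      qed
    qed
    then have "(\<lambda>k. E (P k)) \<longlonglongrightarrow> (\<Sum>j\<in>(UNIV::'n set). 0)"
      unfolding E_def by (intro tendsto_sum) simp
    then show "(E \<circ> P) \<longlonglongrightarrow> 0" by (simp add: comp_def)
  qed
  have "\<forall>\<^sub>F p in at 0 within ball 0 \<delta>. dist (E p) 0 < c / 2"
    using tendstoD[OF E_lim, of "c / 2"] c(1) by simp
  then obtain d where d: "d > 0" "\<And>p. p \<in> ball 0 \<delta> \<Longrightarrow> p \<noteq> 0 \<Longrightarrow> dist p 0 < d \<Longrightarrow> dist (E p) 0 < c / 2"
    unfolding eventually_at by blast
  have E0: "E 0 = 0" by (simp add: E_def D_def)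
  show ?thesis
  proof (rule that[of "min \<delta> d" "c / 2"])
    fix S :: "(real^'n) set" and p :: "(real^'n) \<times> (real^'n)" and \<tau> :: "real^'n"
    assume S: "closed S" "\<And>z. z \<in> S \<Longrightarrow> r \<le> norm z" "{z. R \<le> norm z} \<subseteq> S" and p: "norm p < min \<delta> d"
    have p\<delta>: "norm p < \<delta>" "norm p < min (r/4) (1/8)" using p by (auto simp: \<delta>_def)
    have z0: "norm (0 :: (real^'n) \<times> (real^'n)) < min (r/4) (1/8)" using r by simp
    have "\<bar>E p\<bar> < c / 2"
      using d(2)[of p] p E0 c(1) by (cases "p = 0") auto
    then have E: "E p \<le> c / 2" by linarith
    define L where "L q h = integral S (\<lambda>z. dpert q z h)" for q h
    have lin: "linear (\<lambda>\<tau>. L q (0, \<tau>))" if "norm q < min (r/4) (1/8)" for q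
    proof -
      have "bounded_linear (L q)"
        unfolding L_def[abs_def] using pert_integral_has_derivative[OF S(1,2) r that] by (rule has_derivative_bounded_linear)
      then have "bounded_linear (\<lambda>\<tau>. L q (0, \<tau>))"
        by (rule bounded_linear_compose) (intro bounded_linear_Pair bounded_linear_zero bounded_linear_ident)
      then show ?thesis by (rule bounded_linear.linear)
    qed
    have Lj: "norm (L p (0, axis j 1) - L 0 (0, axis j 1)) \<le> integral S0 (\<lambda>z. norm (D j p z))" for j
    proof -
      have "L p (0, axis j 1) - L 0 (0, axis j 1) = integral S (D j p)"
        unfolding L_def D_def[abs_def]
        using pert_integrable(2)[OF S(1,2) r p\<delta>(2)] pert_integrable(2)[OF S(1,2) r z0]
        by (simp add: integral_diff absolutely_integrable_on_def)
      also have "norm \<dots> \<le> integral S (\<lambda>z. norm (D j p z))"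
        using Dint[OF S(1,2) p\<delta>(1), of j] by (intro integral_norm_bound_integral) (auto simp: absolutely_integrable_on_def)
      also have "\<dots> \<le> integral S0 (\<lambda>z. norm (D j p z))"
        using Dint[OF S(1,2) p\<delta>(1), of j] Dint[OF S0 p\<delta>(1), of j] S(2)
        by (intro integral_subset_le) (auto simp: absolutely_integrable_on_def S0_def)
      finally show ?thesis .
    qed
    have "norm (L p (0, \<tau>) - L 0 (0, \<tau>)) = norm (\<Sum>j\<in>UNIV. \<tau> $ j *\<^sub>R (L p (0, axis j 1) - L 0 (0, axis j 1)))"
      using linear_vec_expansion[OF lin[OF p\<delta>(2)], of \<tau>] linear_vec_expansion[OF lin[OF z0], of \<tau>]
      by (simp add: scaleR_diff_right sum_subtractf)
    also have "\<dots> \<le> (\<Sum>j\<in>UNIV. \<bar>\<tau> $ j\<bar> * norm (L p (0, axis j 1) - L 0 (0, axis j 1)))"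
      by (rule order_trans[OF norm_sum]) simp
    also have "\<dots> \<le> (\<Sum>j\<in>UNIV. norm \<tau> * integral S0 (\<lambda>z. norm (D j p z)))"
      by (intro sum_mono mult_mono component_le_norm_cart Lj) auto
    also have "\<dots> = norm \<tau> * E p" by (simp add: E_def sum_distrib_left)
    finally have diff: "norm (L p (0, \<tau>) - L 0 (0, \<tau>)) \<le> norm \<tau> * E p" .
    have "\<tau> \<bullet> L p (0, \<tau>) = \<tau> \<bullet> L 0 (0, \<tau>) + \<tau> \<bullet> (L p (0, \<tau>) - L 0 (0, \<tau>))"
      by (simp add: inner_diff_right)
    also have "\<dots> \<le> - c * (norm \<tau>)\<^sup>2 + norm \<tau> * (norm \<tau> * E p)"
      using c(2)[OF S(1) r S(2,3), of \<tau>] norm_cauchy_schwarz[of \<tau> "L p (0, \<tau>) - L 0 (0, \<tau>)"]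
        mult_left_mono[OF diff, of "norm \<tau>"] unfolding L_def by simp
    also have "norm \<tau> * (norm \<tau> * E p) \<le> norm \<tau> * (norm \<tau> * (c / 2))"
      using E by (intro mult_left_mono) auto
    also have "- c * (norm \<tau>)\<^sup>2 + norm \<tau> * (norm \<tau> * (c / 2)) = - (c / 2) * (norm \<tau>)\<^sup>2"
      by (simp add: power2_eq_square)
    finally show "\<tau> \<bullet> integral S (\<lambda>z. dpert p z (0, \<tau>)) \<le> - (c / 2) * (norm \<tau>)\<^sup>2"
      by (simp add: L_def)
  qed (use \<delta> d c in \<open>auto simp: \<delta>_def\<close>)
qed

text \<open>The mean value theorem along the segment from \<open>t\<close> to \<open>s\<close> turns
  negative definiteness into the monotonicity that \<open>parametric_Sard\<close> requires. The
  quantifier over \<open>S\<close> stands after \<epsilon>, so that \<epsilon> is common to all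
  sets.\<close>

lemma negligible_degenerate_parameters:
  assumes r: "r > 0" and R: "R > 0"
  obtains \<epsilon> where "\<epsilon> > 0" "2 * \<epsilon> \<le> 1/8" "2 * \<epsilon> \<le> r/4"
    "\<forall>S :: (real^'n::finite) set. closed S \<and> (\<forall>z\<in>S. r \<le> norm z) \<and> {z. R \<le> norm z} \<subseteq> S \<longrightarrow>
     negligible {t \<in> ball 0 \<epsilon>. \<exists>\<xi> \<in> ball 0 \<epsilon>. integral S (pert (\<xi>, t)) = 0 \<and> \<not> inj (\<lambda>h. integral S (\<lambda>z. dpert (\<xi>, t) z (h, 0)))}"
proof -
  obtain \<epsilon> c where \<epsilon>: "\<epsilon> > 0" and c: "c > 0" and \<epsilon>r: "\<epsilon> \<le> min (r/4) (1/8)"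
    and neg: "\<And>S p (\<tau>::real^'n). \<lbrakk>closed S; \<And>z. z \<in> S \<Longrightarrow> r \<le> norm z; {z. R \<le> norm z} \<subseteq> S; norm p < \<epsilon>\<rbrakk> \<Longrightarrow>
     \<tau> \<bullet> integral S (\<lambda>z. dpert p z (0, \<tau>)) \<le> - c * (norm \<tau>)\<^sup>2"
    using dpert_uniformly_negative_definite[OF r R, where 'n='n] by metis
  show ?thesis
  \<comment> \<open>Half the radius, so that a pair of vectors from the two balls has norm less than
    \<epsilon> in the product.\<close>
  proof (rule that[of "\<epsilon> / 2"], goal_cases)
    case 4
    show ?case
    proof (intro allI impI)
      fix S :: "(real^'n) set"
      assume "closed S \<and> (\<forall>z\<in>S. r \<le> norm z) \<and> {z. R \<le> norm z} \<subseteq> S"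
      then have S: "closed S" "\<And>z. z \<in> S \<Longrightarrow> r \<le> norm z" "{z. R \<le> norm z} \<subseteq> S" by auto
      define F where "F p = integral S (pert p)" for p
      define F' where "F' p h = integral S (\<lambda>z. dpert p z h)" for p h
      have small: "norm (\<xi>, t) < \<epsilon>" if "\<xi> \<in> ball 0 (\<epsilon> / 2)" "t \<in> ball 0 (\<epsilon> / 2)" for \<xi> t :: "real^'n"
        using norm_Pair_le[of \<xi> t] that by simp
      have der: "(F has_derivative F' p) (at p)" if "norm p < \<epsilon>" for p
        unfolding F_def[abs_def] F'_def[abs_def] using that \<epsilon>r by (intro pert_integral_has_derivative[OF S(1,2) r]) auto
      have "negligible {t \<in> ball 0 (\<epsilon> / 2). \<exists>\<xi> \<in> ball 0 (\<epsilon> / 2). F (\<xi>, t) = 0 \<and> \<not> inj (\<lambda>h. F' (\<xi>, t) (h, 0))}"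
      proof (rule parametric_Sard[OF open_ball open_ball c])
        show "(F has_derivative F' (\<xi>, t)) (at (\<xi>, t))" if "\<xi> \<in> ball 0 (\<epsilon> / 2)" "t \<in> ball 0 (\<epsilon> / 2)" for \<xi> t
          by (rule der[OF small[OF that]])
        fix \<xi> s t :: "real^'n" assume \<xi>: "\<xi> \<in> ball 0 (\<epsilon> / 2)" and s: "s \<in> ball 0 (\<epsilon> / 2)" and t: "t \<in> ball 0 (\<epsilon> / 2)"
        let ?\<tau> = "s - t"
        define \<phi> where "\<phi> l = ?\<tau> \<bullet> F (\<xi>, t + l *\<^sub>R ?\<tau>)" for l
        have seg: "t + l *\<^sub>R ?\<tau> \<in> ball 0 (\<epsilon> / 2)" if "0 \<le> l" "l \<le> 1" for l
        proof -
          have "(1 - l) *\<^sub>R t + l *\<^sub>R s \<in> ball 0 (\<epsilon> / 2)"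
            by (rule convexD[OF convex_ball t s]) (use that in auto)
          then show ?thesis by (simp add: algebra_simps)
        qed
        have d\<phi>: "(\<phi> has_real_derivative ?\<tau> \<bullet> F' (\<xi>, t + l *\<^sub>R ?\<tau>) (0, ?\<tau>)) (at l)" if "0 \<le> l" "l \<le> 1" for l
        proof -
          let ?p = "(\<xi>, t + l *\<^sub>R ?\<tau>)"
          have dp: "((\<lambda>l. (\<xi>, t + l *\<^sub>R ?\<tau>)) has_derivative (\<lambda>k. (0, k *\<^sub>R ?\<tau>))) (at l)"
            by (auto intro!: derivative_eq_intros)
          have dF: "(F has_derivative F' ?p) (at ?p)"
            by (rule der[OF small[OF \<xi> seg[OF that]]])
          have "(\<phi> has_derivative (\<lambda>k. ?\<tau> \<bullet> F' ?p (0, k *\<^sub>R ?\<tau>))) (at l)"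
            unfolding \<phi>_def[abs_def] by (intro has_derivative_inner_right has_derivative_compose[OF dp dF])
          moreover have "?\<tau> \<bullet> F' ?p (0, k *\<^sub>R ?\<tau>) = (?\<tau> \<bullet> F' ?p (0, ?\<tau>)) * k" for k
            using linear_scale[OF has_derivative_linear[OF dF], of k "(0, ?\<tau>)"] by simp
          ultimately show ?thesis by (simp add: has_field_derivative_def)
        qed
        obtain l where l: "0 < l" "l < 1" "\<phi> 1 - \<phi> 0 = (1 - 0) * (?\<tau> \<bullet> F' (\<xi>, t + l *\<^sub>R ?\<tau>) (0, ?\<tau>))"
          using MVT2[of 0 1 \<phi> "\<lambda>l. ?\<tau> \<bullet> F' (\<xi>, t + l *\<^sub>R ?\<tau>) (0, ?\<tau>)"] d\<phi> by auto
        have "?\<tau> \<bullet> F' (\<xi>, t + l *\<^sub>R ?\<tau>) (0, ?\<tau>) \<le> - c * (norm ?\<tau>)\<^sup>2"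
          unfolding F'_def using l by (intro neg S small \<xi> seg) auto
        then have "c * (norm ?\<tau>)\<^sup>2 \<le> ?\<tau> \<bullet> (F (\<xi>, t) - F (\<xi>, s))"
          using l(3) by (simp add: \<phi>_def inner_diff_right)
        also have "\<dots> \<le> norm ?\<tau> * norm (F (\<xi>, s) - F (\<xi>, t))"
          using norm_cauchy_schwarz[of ?\<tau> "F (\<xi>, t) - F (\<xi>, s)"] by (simp add: norm_minus_commute)
        finally have "norm ?\<tau> * (c * norm ?\<tau>) \<le> norm ?\<tau> * norm (F (\<xi>, s) - F (\<xi>, t))"
          by (simp add: power2_eq_square mult_ac)
        then show "c * norm ?\<tau> \<le> norm (F (\<xi>, s) - F (\<xi>, t))"
          by (cases "?\<tau> = 0") auto
      qed
      then show "negligible {t \<in> ball 0 (\<epsilon> / 2). \<exists>\<xi> \<in> ball 0 (\<epsilon> / 2). integral S (pert (\<xi>, t)) = 0 \<and> \<not> inj (\<lambda>h. integral S (\<lambda>z. dpert (\<xi>, t) z (h, 0)))}"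
        by (simp add: F_def F'_def)
    qed
  qed (use \<epsilon> \<epsilon>r in auto)
qed

section \<open>The radial map and its Jacobian\<close>

lemma radial_map_has_derivative:
  fixes t z :: "real^'n::finite"
  defines "G \<equiv> (1 / (1 + z \<bullet> z)\<^sup>2) *\<^sub>R t - (4 * (t \<bullet> z) / (1 + z \<bullet> z) ^ 3) *\<^sub>R z"
  shows "((\<lambda>z. a + (1 + t \<bullet> rvec z) *\<^sub>R z) has_derivative (\<lambda>h. (1 + t \<bullet> rvec z) *\<^sub>R h + (G \<bullet> h) *\<^sub>R z)) (at z)"
    and "G \<bullet> z = rbeta z * (t \<bullet> rvec z)"
proof -
  have pos: "1 + z \<bullet> z \<noteq> 0" using one_plus_inner_pos[of z] by auto
  have "((\<lambda>z. (1 + z \<bullet> z)\<^sup>2) has_derivative (\<lambda>h. real 2 * (0 + (z \<bullet> h + h \<bullet> z)) * (1 + z \<bullet> z) ^ (2 - 1))) (at z)"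
    by (intro has_derivative_power has_derivative_add has_derivative_const has_derivative_inner has_derivative_ident)
  from has_derivative_divide'[OF has_derivative_inner_right[OF has_derivative_ident, of t] this]
  have "((\<lambda>z. (t \<bullet> z) / (1 + z \<bullet> z)\<^sup>2) has_derivative
      (\<lambda>h. ((t \<bullet> h) * (1 + z \<bullet> z)\<^sup>2 - (t \<bullet> z) * (real 2 * (0 + (z \<bullet> h + h \<bullet> z)) * (1 + z \<bullet> z) ^ (2 - 1))) / ((1 + z \<bullet> z)\<^sup>2 * (1 + z \<bullet> z)\<^sup>2))) (at z)"
    using pos by simp
  moreover have "((t \<bullet> h) * (1 + z \<bullet> z)\<^sup>2 - (t \<bullet> z) * (real 2 * (0 + (z \<bullet> h + h \<bullet> z)) * (1 + z \<bullet> z) ^ (2 - 1))) / ((1 + z \<bullet> z)\<^sup>2 * (1 + z \<bullet> z)\<^sup>2) = G \<bullet> h" for h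
  proof -
    define s where "s = 1 + z \<bullet> z"
    have "s \<noteq> 0" using pos by (simp add: s_def)
    then show ?thesis
      unfolding G_def s_def[symmetric] inner_diff_left inner_scaleR_left inner_commute[of h z]
      by (simp add: field_simps power2_eq_square power3_eq_cube)
  qed
  ultimately have "((\<lambda>z. (t \<bullet> z) / (1 + z \<bullet> z)\<^sup>2) has_derivative (\<lambda>h. G \<bullet> h)) (at z)"
    by (simp only:)
  then have u: "((\<lambda>z. 1 + t \<bullet> rvec z) has_derivative (\<lambda>h. 0 + G \<bullet> h)) (at z)"
    by (intro has_derivative_add has_derivative_const) (simp add: rvec_def)
  from has_derivative_add[OF has_derivative_const[of a] has_derivative_scaleR[OF u has_derivative_ident]]
  show "((\<lambda>z. a + (1 + t \<bullet> rvec z) *\<^sub>R z) has_derivative (\<lambda>h. (1 + t \<bullet> rvec z) *\<^sub>R h + (G \<bullet> h) *\<^sub>R z)) (at z)"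
    by simp
  \<comment> \<open>\<open>G\<close> is the gradient of \<open>t \<bullet> rvec z\<close>; what
    remains is Euler's relation with the factor \<open>rbeta z\<close>.\<close>
  define s w where "s = z \<bullet> z" and "w = 1 + s"
  have "w \<noteq> 0" using pos by (simp add: s_def w_def)
  then have "(t \<bullet> z) / w\<^sup>2 - 4 * (t \<bullet> z) * s / w ^ 3 = (1 - 4 * s / w) * ((t \<bullet> z) / w\<^sup>2)"
    by (simp add: field_simps power2_eq_square power3_eq_cube)
  moreover have "G \<bullet> z = (t \<bullet> z) / w\<^sup>2 - 4 * (t \<bullet> z) * s / w ^ 3"
    by (simp add: G_def s_def w_def inner_diff_left)
  moreover have "rbeta z * (t \<bullet> rvec z) = (1 - 4 * s / w) * ((t \<bullet> z) / w\<^sup>2)"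
    by (simp add: rbeta_def rvec_def s_def w_def)
  ultimately show "G \<bullet> z = rbeta z * (t \<bullet> rvec z)"
    by simp
qed

text \<open>Taking \<open>g\<close> out of each row leaves the identity plus a rank-one matrix. The
  index bijection preserves inner products, so the result is expressed by
  \<open>G \<bullet> z\<close> itself.\<close>

lemma jac_det_scale_plus_rank_one:
  fixes G z :: "real^'n::finite"
  assumes g: "g \<noteq> 0"
  shows "jac_det (\<lambda>h. g *\<^sub>R h + (G \<bullet> h) *\<^sub>R z) = g ^ (CARD('n) - 1) * (g + G \<bullet> z)"
proof -
  let ?s = "idx_bij :: 'n idx \<Rightarrow> 'n"
  let ?u = "reindex ?s ((1 / g) *\<^sub>R z)" and ?v = "reindex ?s G"
  have inj: "?s i = ?s j \<longleftrightarrow> i = j" for i j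
    using bij_is_inj[OF bij_idx_bij] by (auto dest: injD)
  have "jac_det (\<lambda>h. g *\<^sub>R h + (G \<bullet> h) *\<^sub>R z) = det (\<chi> i. g *s (\<chi> j. (if i = j then 1 else 0) + ?u $ i * ?v $ j) :: real^('n idx)^('n idx))"
    unfolding jac_det_def using g
    by (intro arg_cong[where f=det]) (auto simp: vec_eq_iff axis_def inner_axis inj algebra_simps inner_vec_def if_distrib cong: if_cong)
  also have "\<dots> = g ^ CARD('n) * (1 + ?u \<bullet> ?v)"
    by (simp only: det_rows_mul det_identity_plus_rank_one prod_constant card_idx)
  also have "?u \<bullet> ?v = (G \<bullet> z) / g"
    unfolding inner_vec_def using sum.reindex_bij_betw[OF bij_idx_bij[where 'a='n], of "\<lambda>i. ((1 / g) *\<^sub>R z) $ i \<bullet> G $ i"]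
    by (simp add: sum_divide_distrib mult.commute)
  also have "g ^ CARD('n) * (1 + (G \<bullet> z) / g) = g ^ (CARD('n) - 1) * (g + G \<bullet> z)"
  proof -
    obtain m where m: "CARD('n) = Suc m"
      using zero_less_card_finite[where 'a='n] gr0_implies_Suc by blast
    show ?thesis unfolding m using g by (simp add: field_simps)
  qed
  finally show ?thesis .
qed

section \<open>Density\<close>

text \<open>
  The partial derivatives of \<open>q = 1 / (1 + \<bar>z\<bar>\<^sup>2)\<close> and \<open>P = q z\<close> are polynomials in \<open>q\<close>, \<open>P\<close> and
  the partial derivatives of \<open>z\<close>, so boundedness propagates from each order to the next.
\<close>

lemma Cb_normalized_field:
  fixes \<theta> :: "real^'n::finite \<Rightarrow> real^'n"
  assumes \<theta>: "\<theta> \<in> C2_space"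
  shows "Cb 2 (\<lambda>y. (y + \<theta> y - a) $ j / (1 + (y + \<theta> y - a) \<bullet> (y + \<theta> y - a)))"
proof -
  define z where "z l y = (y + \<theta> y - a) $ l" for l y
  define q where "q y = 1 / (1 + (y + \<theta> y - a) \<bullet> (y + \<theta> y - a))" for y
  define P where "P l y = z l y * q y" for l y
  define d where "d i l y = (if l = i then 1 else 0) + partial i (\<lambda>y. \<theta> y $ l) y" for i l y
  have sq: "(y + \<theta> y - a) \<bullet> (y + \<theta> y - a) = (\<Sum>l\<in>UNIV. (z l y)\<^sup>2)" for y
    by (simp add: inner_vec_def z_def power2_eq_square)
  have pos: "1 + (\<Sum>l\<in>UNIV. (z l y)\<^sup>2) > 0" for y
    by (intro add_pos_nonneg sum_nonneg) auto
  have q: "q y = 1 / (1 + (\<Sum>l\<in>UNIV. (z l y)\<^sup>2))" for y by (simp add: q_def sq)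
  have c2: "Cb (Suc 1) (\<lambda>y. \<theta> y $ l)" for l
    using \<theta> by (simp add: C2_space_iff numeral_2_eq_2)
  have dCb: "Cb 1 (d i l)" for i l
    unfolding d_def[abs_def] by (intro Cb_add Cb_const) (use c2[of l] in auto)
  have zpd: "has_pderiv i (z l) (d i l)" for i l
    unfolding has_pderiv_def
  proof
    fix y
    have "has_pderiv i (\<lambda>y. \<theta> y $ l) (partial i (\<lambda>y. \<theta> y $ l))" using c2[of l] by auto
    then have "((\<lambda>t. \<theta> (y + t *\<^sub>R axis i 1) $ l) has_real_derivative partial i (\<lambda>y. \<theta> y $ l) y) (at 0)"
      by (auto simp: has_pderiv_def)
    then show "((\<lambda>t. z l (y + t *\<^sub>R axis i 1)) has_real_derivative d i l y) (at 0)"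
      unfolding z_def d_def by (auto intro!: derivative_eq_intros simp: axis_def)
  qed
  \<comment> \<open>The derivative of q is - q^2 times the sum of 2 z_l d_il, and one factor q
    combines with the unbounded z_l to the bounded P_l.\<close>
  have qpd: "has_pderiv i q (\<lambda>y. (- 2) * q y * (\<Sum>l\<in>UNIV. P l y * d i l y))" for i
    unfolding has_pderiv_def
  proof
    fix y :: "real^'n"
    let ?y = "\<lambda>t. y + t *\<^sub>R axis i 1"
    have dz: "((\<lambda>t. z l (?y t)) has_real_derivative d i l y) (at 0)" for l
      using zpd by (auto simp: has_pderiv_def)
    have "((\<lambda>t. (z l (?y t))\<^sup>2) has_real_derivative 2 * z l y * d i l y) (at 0)" for l
      using DERIV_power[OF dz[of l], of 2] by (simp add: mult_ac)
    then have "((\<lambda>t. 1 + (\<Sum>l\<in>UNIV. (z l (?y t))\<^sup>2)) has_real_derivative 0 + (\<Sum>l\<in>UNIV. 2 * z l y * d i l y)) (at 0)"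
      by (intro DERIV_add DERIV_const DERIV_sum)
    from DERIV_inverse'[OF this] pos[of y]
    have "((\<lambda>t. q (?y t)) has_real_derivative - (q y * (\<Sum>l\<in>UNIV. 2 * z l y * d i l y) * q y)) (at 0)"
      by (simp add: q inverse_eq_divide)
    moreover have "- (q y * (\<Sum>l\<in>UNIV. 2 * z l y * d i l y) * q y) = (- 2) * q y * (\<Sum>l\<in>UNIV. P l y * d i l y)"
      by (simp add: P_def sum_distrib_left sum_distrib_right mult_ac sum_negf[symmetric])
    ultimately show "((\<lambda>t. q (?y t)) has_real_derivative (- 2) * q y * (\<Sum>l\<in>UNIV. P l y * d i l y)) (at 0)"
      by (simp only:)
  qed
  have Ppd: "has_pderiv i (P k) (\<lambda>y. d i k y * q y + (- 2) * P k y * (\<Sum>l\<in>UNIV. P l y * d i l y))" for i k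
  proof -
    have "has_pderiv i (P k) (\<lambda>y. d i k y * q y + z k y * ((- 2) * q y * (\<Sum>l\<in>UNIV. P l y * d i l y)))"
      unfolding P_def[abs_def] by (rule has_pderiv_mult[OF zpd qpd[unfolded P_def]])
    moreover have "z k y * ((- 2) * q y * (\<Sum>l\<in>UNIV. P l y * d i l y)) = (- 2) * P k y * (\<Sum>l\<in>UNIV. P l y * d i l y)" for y
      by (simp add: P_def)
    ultimately show ?thesis by (simp only:)
  qed
  have zc: "continuous_on UNIV (z l)" for l
    unfolding z_def[abs_def] by (intro continuous_intros C2_space_continuous \<theta>)
  have qc: "continuous_on UNIV q"
    unfolding q[abs_def] using pos by (intro continuous_intros zc) (metis less_irrefl)
  have qb: "\<bar>q y\<bar> \<le> 1" for y
    unfolding q using pos[of y] by (simp add: divide_le_eq sum_nonneg)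
  have Pb: "\<bar>P l y\<bar> \<le> 1" for l y
  proof -
    have "(z l y)\<^sup>2 \<le> (\<Sum>l\<in>UNIV. (z l y)\<^sup>2)" by (rule member_le_sum) auto
    moreover have "2 * \<bar>z l y\<bar> \<le> 1 + (z l y)\<^sup>2"
      using sum_squares_bound[of "\<bar>z l y\<bar>" 1] by simp
    ultimately have "\<bar>z l y\<bar> \<le> 1 + (\<Sum>l\<in>UNIV. (z l y)\<^sup>2)"
      using abs_ge_zero[of "z l y"] by linarith
    then show ?thesis
      unfolding P_def q using pos[of y] by (simp add: abs_mult divide_le_eq)
  qed
  have q0: "Cb 0 q" using qc qb by (auto simp: bounded_iff)
  have P0: "Cb 0 (P l)" for l
    using Pb zc qc by (auto simp: bounded_iff P_def[abs_def] intro!: continuous_intros)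
  \<comment> \<open>One order is gained as long as the derivatives \<open>d\<close> of the field are
    bounded to the preceding order; they belong to \<open>Cb 1\<close>, so two steps are
    possible.\<close>
  have step: "Cb (Suc k) q \<and> (\<forall>l. Cb (Suc k) (P l))" if "Cb k q" "\<And>l. Cb k (P l)" "\<And>i l. Cb k (d i l)" for k
  proof (intro conjI allI)
    show "Cb (Suc k) q"
    proof (rule Cb_SucI[OF _ _ qpd])
      show "Cb k (\<lambda>y. - 2 * q y * (\<Sum>l\<in>UNIV. P l y * d i l y))" for i
        by (intro Cb_mult Cb_const Cb_sum that)
    qed (use q0 in auto)
    show "Cb (Suc k) (P l)" for l
    proof (rule Cb_SucI[OF _ _ Ppd])
      show "Cb k (\<lambda>y. d i l y * q y + - 2 * P l y * (\<Sum>l\<in>UNIV. P l y * d i l y))" for i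
        by (intro Cb_add Cb_mult Cb_const Cb_sum that)
    qed (use P0 in auto)
  qed
  have d0: "Cb 0 (d i l)" for i l using dCb[of i l] Cb_mono_Suc[of 0 "d i l"] by simp
  have "Cb (Suc 1) (P j)"
    using step[of 0] step[of 1] q0 P0 d0 dCb by auto
  moreover have "P j = (\<lambda>y. (y + \<theta> y - a) $ j / (1 + (y + \<theta> y - a) \<bullet> (y + \<theta> y - a)))"
    by (simp add: P_def[abs_def] z_def q_def)
  ultimately show ?thesis by (simp add: numeral_2_eq_2)
qed

text \<open>The perturbation is (t \<bullet> P) P with P = z / (1 + |z|^2), hence linear in
  \<open>t\<close> with the fixed fields P_j P as coefficients; \<open>M\<close> is obtained from
  the sum of their norms.\<close>

lemma perturbation_C2:
  fixes \<theta> :: "real^'n::finite \<Rightarrow> real^'n"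
  assumes \<theta>: "\<theta> \<in> C2_space"
  obtains M where "M > 0" "\<And>t. (\<lambda>y. (t \<bullet> rvec (y + \<theta> y - a)) *\<^sub>R (y + \<theta> y - a)) \<in> C2_space"
    "\<And>t. C2_norm (\<lambda>y. (t \<bullet> rvec (y + \<theta> y - a)) *\<^sub>R (y + \<theta> y - a)) \<le> norm t * M"
proof -
  define P where "P y = (1 / (1 + (y + \<theta> y - a) \<bullet> (y + \<theta> y - a))) *\<^sub>R (y + \<theta> y - a)" for y
  define W where "W j y = P y $ j *\<^sub>R P y" for j y
  have PC: "Cb 2 (\<lambda>y. P y $ j)" for j
    using Cb_normalized_field[OF \<theta>, of a j] by (simp add: P_def)
  have WC: "W j \<in> C2_space" for j
    unfolding C2_space_iff W_def by (simp add: Cb_mult PC)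
  have eq: "(\<lambda>y. (t \<bullet> rvec (y + \<theta> y - a)) *\<^sub>R (y + \<theta> y - a)) = (\<lambda>y. \<Sum>j\<in>UNIV. t $ j *\<^sub>R W j y)" for t
  proof
    fix y
    have "(\<Sum>j\<in>UNIV. t $ j *\<^sub>R W j y) = (t \<bullet> P y) *\<^sub>R P y"
      by (simp add: W_def inner_vec_def scaleR_sum_left)
    also have "\<dots> = (t \<bullet> rvec (y + \<theta> y - a)) *\<^sub>R (y + \<theta> y - a)"
      by (simp add: P_def rvec_def power2_eq_square)
    finally show "(t \<bullet> rvec (y + \<theta> y - a)) *\<^sub>R (y + \<theta> y - a) = (\<Sum>j\<in>UNIV. t $ j *\<^sub>R W j y)" by simp
  qed
  have nn: "0 \<le> C2_norm (W j)" for j by (rule C2_norm_nonneg[OF WC])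
  show ?thesis
  proof (rule that[of "1 + (\<Sum>j\<in>UNIV. C2_norm (W j))"])
    show "0 < 1 + (\<Sum>j\<in>UNIV. C2_norm (W j))" using nn by (simp add: add_pos_nonneg sum_nonneg)
    fix t :: "real^'n"
    have tW: "(\<lambda>y. t $ j *\<^sub>R W j y) \<in> C2_space" "C2_norm (\<lambda>y. t $ j *\<^sub>R W j y) \<le> \<bar>t $ j\<bar> * C2_norm (W j)" for j
      using C2_space_scale[OF WC] by auto
    note s = C2_space_sum[of UNIV "\<lambda>j y. t $ j *\<^sub>R W j y", OF finite tW(1)]
    show "(\<lambda>y. (t \<bullet> rvec (y + \<theta> y - a)) *\<^sub>R (y + \<theta> y - a)) \<in> C2_space"
      unfolding eq using s by blast
    have "C2_norm (\<lambda>y. \<Sum>j\<in>UNIV. t $ j *\<^sub>R W j y) \<le> (\<Sum>j\<in>UNIV. C2_norm (\<lambda>y. t $ j *\<^sub>R W j y))"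
      using s by blast
    also have "\<dots> \<le> (\<Sum>j\<in>UNIV. norm t * C2_norm (W j))"
      by (intro sum_mono order_trans[OF tW(2)] mult_right_mono component_le_norm_cart nn)
    also have "\<dots> \<le> norm t * (1 + (\<Sum>j\<in>UNIV. C2_norm (W j)))"
      by (simp add: sum_distrib_left[symmetric] distrib_left)
    finally show "C2_norm (\<lambda>y. (t \<bullet> rvec (y + \<theta> y - a)) *\<^sub>R (y + \<theta> y - a)) \<le> norm t * (1 + (\<Sum>j\<in>UNIV. C2_norm (W j)))"
      unfolding eq .
  qed
qed

text \<open>Undoing the radial map moves the parameter from the domain of integration into the
  integrand. The remaining set is independent of \<xi> and \<open>t\<close>, so the gradient can be
  differentiated in both.\<close>

lemma grad_psi_perturbed:
  fixes \<theta> :: "real^'n::finite \<Rightarrow> real^'n" and t a :: "real^'n"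
  defines "\<eta> \<equiv> \<lambda>y. \<theta> y + (t \<bullet> rvec (y + \<theta> y - a)) *\<^sub>R (y + \<theta> y - a)"
  assumes \<theta>: "\<theta> \<in> small_ball" and \<eta>: "\<eta> \<in> small_ball" and \<Omega>: "open \<Omega>" and t: "norm t \<le> 1/8"
    and \<xi>: "a + \<xi> \<in> deform \<Omega> \<eta>"
  shows "grad_psi (- deform \<Omega> \<eta>) (a + \<xi>) = integral {z. a + z \<notin> deform \<Omega> \<theta>} (pert (\<xi>, t))"
proof -
  let ?S = "{z. a + z \<notin> deform \<Omega> \<theta>}"
  define g where "g z = a + (1 + t \<bullet> rvec z) *\<^sub>R z" for z
  define G where "G z = (1 / (1 + z \<bullet> z)\<^sup>2) *\<^sub>R t - (4 * (t \<bullet> z) / (1 + z \<bullet> z) ^ 3) *\<^sub>R z" for z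
  define g' where "g' z h = (1 + t \<bullet> rvec z) *\<^sub>R h + (G z \<bullet> h) *\<^sub>R z" for z h
  have der: "(g has_derivative g' z) (at z within ?S)" for z
    unfolding g_def[abs_def] g'_def[abs_def] G_def
    by (rule has_derivative_at_withinI[OF radial_map_has_derivative(1)])
  \<comment> \<open>The radial map carries one deformation to the other, so its injectivity and its
    image of the complement follow from the bijectivity of the two deformations.\<close>
  have g\<eta>: "g (y + \<theta> y - a) = y + \<eta> y" for y
    by (simp add: g_def \<eta>_def algebra_simps)
  have surj\<theta>: "\<exists>y. z = y + \<theta> y - a" for z
    using bij_is_surj[OF bij_deform_map[OF \<theta>]] unfolding surj_def by (metis add_diff_cancel)
  have inj: "inj_on g ?S"
  proof (rule inj_onI)
    fix z1 z2 assume eq: "g z1 = g z2"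
    obtain y1 y2 where y: "z1 = y1 + \<theta> y1 - a" "z2 = y2 + \<theta> y2 - a" using surj\<theta> by metis
    have "y1 + \<eta> y1 = y2 + \<eta> y2" using eq by (simp add: y g\<eta>)
    then have "y1 = y2" using bij_is_inj[OF bij_deform_map[OF \<eta>]] by (auto dest: injD)
    then show "z1 = z2" by (simp add: y)
  qed
  have S_eq: "?S = (\<lambda>y. y + \<theta> y - a) ` (- \<Omega>)"
  proof -
    have "z \<in> ?S \<longleftrightarrow> a + z \<in> (\<lambda>y. y + \<theta> y) ` (- \<Omega>)" for z
      using compl_deform[OF \<theta>, of \<Omega>] by auto
    then show ?thesis by (auto simp: image_iff algebra_simps)
  qed
  have img: "g ` ?S = - deform \<Omega> \<eta>"
    unfolding S_eq compl_deform[OF \<eta>] image_image g\<eta> ..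
  have "?S = (\<lambda>z. a + z) -` (- deform \<Omega> \<theta>)" by auto
  moreover have "closed (- deform \<Omega> \<theta>)" using open_deform[OF \<theta> \<Omega>] by auto
  then have "closed ((\<lambda>z. a + z) -` (- deform \<Omega> \<theta>))"
    by (rule continuous_closed_vimage) (intro continuous_intros)
  ultimately have clS: "closed ?S" by simp
  have jac: "\<bar>jac_det (g' z)\<bar> = radial_jac CARD('n) (rbeta z) (t \<bullet> rvec z)" for z
  proof -
    have u: "\<bar>t \<bullet> rvec z\<bar> \<le> 1/8" using inner_rvec_le[of t z] t by linarith
    have "jac_det (g' z) = (1 + t \<bullet> rvec z) ^ (CARD('n) - 1) * (1 + t \<bullet> rvec z + G z \<bullet> z)"
      unfolding g'_def by (rule jac_det_scale_plus_rank_one) (use u in linarith)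
    also have "\<dots> = radial_jac CARD('n) (rbeta z) (t \<bullet> rvec z)"
      unfolding radial_jac_def G_def by (simp only: radial_map_has_derivative(2))
    finally show ?thesis using radial_jac_bounds(1)[OF u rbeta_bounds, of "CARD('n)" z] by simp
  qed
  have "(\<lambda>Y. dkernel (a + \<xi> - Y)) absolutely_integrable_on - deform \<Omega> \<eta>"
    by (rule admissible_integrable[OF admissible_dkernel open_deform[OF \<eta> \<Omega>] \<xi>])
  then have "integral ?S (\<lambda>z. \<bar>jac_det (g' z)\<bar> *\<^sub>R dkernel (a + \<xi> - g z)) = grad_psi (- deform \<Omega> \<eta>) (a + \<xi>)"
    using has_absolute_integral_change_of_variables_closed[OF clS der inj, of "\<lambda>Y. dkernel (a + \<xi> - Y)" "grad_psi (- deform \<Omega> \<eta>) (a + \<xi>)"]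
    unfolding img by (simp add: grad_psi_def)
  moreover have "\<bar>jac_det (g' z)\<bar> *\<^sub>R dkernel (a + \<xi> - g z) = pert (\<xi>, t) z" for z
    by (simp add: jac pert_def offset_def g_def)
  ultimately show ?thesis by simp
qed

text \<open>The radius \<open>s\<close> is chosen before any deformation is given. Inner radius
  \<open>d\<close> and outer radius \<open>R0\<close> of \<Omega> about \<open>x0\<close> become d/2
  and 2 R0 about the image of \<open>x0\<close>, for every \<theta> in the ball, and these feed
  \<open>negligible_degenerate_parameters\<close>.\<close>

lemma perturb_to_nondegenerate:
  fixes \<Omega> :: "(real^'n::finite) set"
  assumes \<Omega>: "open \<Omega>" "bounded \<Omega>" and x0: "x0 \<in> \<Omega>"
  obtains s where "s > 0" "cball x0 s \<subseteq> \<Omega>" "empty_interior_in_C2 small_ball (degenerate_thetas \<Omega> (cball x0 s))"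
proof -
  obtain d where d: "d > 0" "ball x0 d \<subseteq> \<Omega>"
    using \<Omega> x0 open_contains_ball by blast
  obtain R0 where R0: "R0 > 0" "\<Omega> \<subseteq> ball x0 R0"
    using bounded_subset_ballD[OF \<Omega>(2), of x0] by blast
  define r R where "r = d / 2" and "R = 2 * R0"
  have r: "r > 0" and R: "R > 0" using d R0 by (auto simp: r_def R_def)
  obtain \<epsilon>1 where \<epsilon>1: "\<epsilon>1 > 0" "2 * \<epsilon>1 \<le> 1/8" "2 * \<epsilon>1 \<le> r/4"
    and negl: "\<forall>S :: (real^'n) set. closed S \<and> (\<forall>z\<in>S. r \<le> norm z) \<and> {z. R \<le> norm z} \<subseteq> S \<longrightarrow>
     negligible {t \<in> ball 0 \<epsilon>1. \<exists>\<xi> \<in> ball 0 \<epsilon>1. integral S (pert (\<xi>, t)) = 0 \<and> \<not> inj (\<lambda>h. integral S (\<lambda>z. dpert (\<xi>, t) z (h, 0)))}"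
    using negligible_degenerate_parameters[OF r R, where 'n='n] by blast
  \<comment> \<open>A base point in the ball then gives |\<xi>| <= 2 s + |t| < \<epsilon>1, once |t|
    < \<epsilon>1 / 8.\<close>
  define s where "s = min (d / 2) (\<epsilon>1 / 8)"
  have s: "s > 0" "s \<le> \<epsilon>1 / 8" using d \<epsilon>1 by (auto simp: s_def)
  have cb: "cball x0 s \<subseteq> \<Omega>" using d by (intro subset_trans[OF _ d(2)]) (auto simp: s_def)
  have "empty_interior_in_C2 small_ball (degenerate_thetas \<Omega> (cball x0 s))"
    unfolding empty_interior_in_C2_def
  proof (intro notI, elim bexE exE conjE)
    fix \<theta>0 :: "real^'n \<Rightarrow> real^'n" and \<epsilon> :: real
    assume \<theta>0: "\<theta>0 \<in> small_ball" and \<epsilon>: "\<epsilon> > 0"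
      and sub: "{\<eta> \<in> small_ball. C2_dist \<theta>0 \<eta> < \<epsilon>} \<subseteq> degenerate_thetas \<Omega> (cball x0 s)"
    let ?\<rho> = "rho_max TYPE('n)"
    have \<rho>: "?\<rho> > 0" by (rule rho_max_pos)
    \<comment> \<open>Shrinking by 1 - k leaves room k \<rho> for the perturbation inside the closed
      ball and moves the deformation by at most \<epsilon> / 4.\<close>
    define k where "k = min (1/2) (\<epsilon> / (4 * ?\<rho>))"
    have k: "0 < k" "k \<le> 1/2" "k * ?\<rho> \<le> \<epsilon> / 4"
      using \<epsilon> \<rho> by (auto simp: k_def min_def field_simps)
    define \<theta> where "\<theta> = (\<lambda>x. (1 - k) *\<^sub>R \<theta>0 x)"
    have \<theta>C: "\<theta> \<in> C2_space" unfolding \<theta>_def by (rule C2_space_scale(1)[OF small_ball_C2[OF \<theta>0]])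
    have n0: "0 \<le> C2_norm \<theta>0" "C2_norm \<theta>0 \<le> ?\<rho>"
      using \<theta>0 C2_norm_nonneg by (auto simp: C2_ball_def)
    have \<theta>n: "C2_norm \<theta> \<le> (1 - k) * ?\<rho>"
    proof -
      have "C2_norm \<theta> \<le> \<bar>1 - k\<bar> * C2_norm \<theta>0"
        unfolding \<theta>_def by (rule C2_space_scale(2)[OF small_ball_C2[OF \<theta>0]])
      also have "\<dots> \<le> (1 - k) * ?\<rho>" using k n0 by (intro mult_mono) auto
      finally show ?thesis .
    qed
    have \<theta>: "\<theta> \<in> small_ball"
    proof -
      have "(1 - k) * ?\<rho> \<le> 1 * ?\<rho>" using k \<rho> by (intro mult_right_mono) auto
      then show ?thesis using \<theta>C \<theta>n by (simp add: C2_ball_def)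
    qed
    define a where "a = x0 + \<theta> x0"
    let ?D = "deform \<Omega> \<theta>"
    define S where "S = {z. a + z \<notin> ?D}"
    have Dop: "open ?D" by (rule open_deform[OF \<theta> \<Omega>(1)])
    have clS: "closed S"
    proof -
      have "closed (- ?D)" using Dop by auto
      then have "closed ((\<lambda>z. a + z) -` (- ?D))"
        by (rule continuous_closed_vimage) (intro continuous_intros)
      moreover have "S = (\<lambda>z. a + z) -` (- ?D)" by (auto simp: S_def)
      ultimately show ?thesis by simp
    qed
    have Sr: "r \<le> norm z" if "z \<in> S" for z
    proof (rule ccontr)
      assume "\<not> r \<le> norm z"
      then have "a + z \<in> ball a (d / 2)" by (simp add: r_def dist_norm)
      then show False
        using deform_contains_ball[OF \<theta> d(2)] that by (auto simp: a_def S_def)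
    qed
    have SR: "{z. R \<le> norm z} \<subseteq> S"
    proof
      fix z :: "real^'n" assume "z \<in> {z. R \<le> norm z}"
      then have z: "R \<le> norm z" by simp
      show "z \<in> S"
      proof (rule ccontr)
        assume "z \<notin> S"
        then obtain y where y: "y \<in> \<Omega>" "a + z = y + \<theta> y" by (auto simp: S_def deform_def)
        have "z = (y + \<theta> y) - (x0 + \<theta> x0)" using y(2) by (simp add: a_def algebra_simps)
        then have "norm z \<le> 2 * norm (y - x0)"
          using deform_map_lipschitz[OF \<theta>, of y x0] by simp
        moreover have "norm (y - x0) < R0" using y(1) R0(2) by (auto simp: dist_norm norm_minus_commute)
        ultimately show False using z by (simp add: R_def)
      qed
    qed
    obtain M where M: "M > 0" "\<And>t. (\<lambda>y. (t \<bullet> rvec (y + \<theta> y - a)) *\<^sub>R (y + \<theta> y - a)) \<in> C2_space"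
      "\<And>t. C2_norm (\<lambda>y. (t \<bullet> rvec (y + \<theta> y - a)) *\<^sub>R (y + \<theta> y - a)) \<le> norm t * M"
      using perturbation_C2[OF \<theta>C] by blast
    \<comment> \<open>The three bounds keep \<xi> and \<open>t\<close> in the range covered by
      \<open>Bad\<close>, \<eta> in the ball, and \<eta> within \<epsilon> of
      \<open>\<theta>0\<close>.\<close>
    define \<delta> where "\<delta> = min (\<epsilon>1 / 8) (min (k * ?\<rho> / M) (\<epsilon> / (4 * M)))"
    have \<delta>: "\<delta> > 0" using \<epsilon>1 k \<rho> M \<epsilon> by (simp add: \<delta>_def)
    define Bad where "Bad = {t \<in> ball 0 \<epsilon>1. \<exists>\<xi> \<in> ball 0 \<epsilon>1. integral S (pert (\<xi>, t)) = 0 \<and> \<not> inj (\<lambda>h. integral S (\<lambda>z. dpert (\<xi>, t) z (h, 0)))}"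
    have "negligible Bad" unfolding Bad_def using negl clS Sr SR by blast
    then have "\<not> ball 0 \<delta> \<subseteq> Bad"
      using open_not_negligible[OF open_ball, of "0::real^'n" \<delta>] negligible_subset \<delta> by auto
    then obtain t where t: "norm t < \<delta>" "t \<notin> Bad"
      unfolding subset_iff mem_ball_0 by blast
    have t8: "norm t < \<epsilon>1 / 8" and tk: "norm t * M \<le> k * ?\<rho>" and te: "norm t * M \<le> \<epsilon> / 4"
      using t(1) M(1) by (auto simp: \<delta>_def field_simps)
    define w where "w y = (t \<bullet> rvec (y + \<theta> y - a)) *\<^sub>R (y + \<theta> y - a)" for y
    have wC: "w \<in> C2_space" "C2_norm w \<le> norm t * M" using M(2,3)[of t] by (auto simp: w_def[abs_def])
    define \<eta> where "\<eta> = (\<lambda>y. \<theta> y + w y)"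
    have \<eta>: "\<eta> \<in> small_ball"
    proof -
      have "C2_norm \<eta> \<le> (1 - k) * ?\<rho> + k * ?\<rho>"
        unfolding \<eta>_def using C2_space_add(2)[OF \<theta>C wC(1)] \<theta>n wC(2) tk by linarith
      then show ?thesis
        using C2_space_add(1)[OF \<theta>C wC(1)] by (simp add: C2_ball_def \<eta>_def algebra_simps)
    qed
    have "C2_dist \<theta>0 \<eta> < \<epsilon>"
    proof -
      have eq: "(\<lambda>x. \<theta>0 x - \<eta> x) = (\<lambda>x. k *\<^sub>R \<theta>0 x + (- 1) *\<^sub>R w x)"
        by (auto simp: \<eta>_def \<theta>_def algebra_simps)
      have "C2_dist \<theta>0 \<eta> \<le> C2_norm (\<lambda>x. k *\<^sub>R \<theta>0 x) + C2_norm (\<lambda>x. (- 1) *\<^sub>R w x)"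
        unfolding C2_dist_def eq
        by (intro C2_space_add(2) C2_space_scale(1) small_ball_C2[OF \<theta>0] wC(1))
      also have "\<dots> \<le> \<bar>k\<bar> * C2_norm \<theta>0 + \<bar>- 1\<bar> * C2_norm w"
        by (intro add_mono C2_space_scale(2) small_ball_C2[OF \<theta>0] wC(1))
      also have "\<dots> \<le> k * ?\<rho> + norm t * M"
        using k(1) wC(2) n0(2) by (intro add_mono) auto
      also have "\<dots> < \<epsilon>" using k(3) te \<epsilon> by linarith
      finally show ?thesis .
    qed
    then have "\<eta> \<in> degenerate_thetas \<Omega> (cball x0 s)" using sub \<eta> by blast
    then obtain x where x: "x \<in> cball x0 s" "degenerate (deform \<Omega> \<eta>) (x + \<eta> x)"
      by (auto simp: degenerate_thetas_def)
    define \<xi> where "\<xi> = x + \<eta> x - a"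
    let ?E = "deform \<Omega> \<eta>"
    have X: "a + \<xi> = x + \<eta> x" by (simp add: \<xi>_def)
    have XE: "a + \<xi> \<in> ?E" using x(1) cb by (auto simp: X deform_def)
    have Eop: "open ?E" by (rule open_deform[OF \<eta> \<Omega>(1)])
    have "norm \<xi> < \<epsilon>1"
    proof -
      have "\<xi> = ((x + \<theta> x) - (x0 + \<theta> x0)) + w x" by (simp add: \<xi>_def \<eta>_def a_def)
      then have "norm \<xi> \<le> norm ((x + \<theta> x) - (x0 + \<theta> x0)) + norm (w x)"
        by (simp only: norm_triangle_ineq)
      moreover have "norm (w x) \<le> norm t"
        unfolding w_def norm_scaleR by (rule inner_rvec_mult_le)
      moreover have "norm ((x + \<theta> x) - (x0 + \<theta> x0)) \<le> 2 * norm (x - x0)"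
        by (rule deform_map_lipschitz[OF \<theta>])
      moreover have "norm (x - x0) \<le> s" using x(1) by (simp add: dist_norm norm_minus_commute)
      ultimately show ?thesis using s(2) t8 \<epsilon>1 by linarith
    qed
    then have \<xi>b: "\<xi> \<in> ball 0 \<epsilon>1" by simp
    \<comment> \<open>This holds on an open set of \<zeta> and not only at \<xi>, so both sides can
      be differentiated; uniqueness of the derivative then identifies the Hessian.\<close>
    have grad: "grad_psi (- ?E) (a + \<zeta>) = integral S (pert (\<zeta>, t))" if "a + \<zeta> \<in> ?E" for \<zeta>
      unfolding S_def using grad_psi_perturbed[OF \<theta>, where t=t and a=a and \<Omega>=\<Omega> and \<xi>=\<zeta>] \<eta> \<Omega>(1) t8 \<epsilon>1 that
      by (simp add: \<eta>_def w_def)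
    have F0: "integral S (pert (\<xi>, t)) = 0"
      using grad[OF XE] x(2) by (simp add: X degenerate_def)
    have "(\<lambda>h. integral S (\<lambda>z. dpert (\<xi>, t) z (h, 0))) = hess_psi (- ?E) (a + \<xi>)"
    proof (rule has_derivative_unique)
      have "norm (\<xi>, t) < 2 * \<epsilon>1"
        using norm_Pair_le[of \<xi> t] \<open>norm \<xi> < \<epsilon>1\<close> t8 \<epsilon>1(1) by linarith
      then have "norm (\<xi>, t) < min (r/4) (1/8)" using \<epsilon>1 by linarith
      note dF = pert_integral_has_derivative[OF clS Sr r this]
      have "((\<lambda>\<zeta>. (\<zeta>, t)) has_derivative (\<lambda>h. (h, 0))) (at \<xi>)"
        by (auto intro!: derivative_eq_intros)
      from has_derivative_compose[OF this dF]
      show "((\<lambda>\<zeta>. integral S (pert (\<zeta>, t))) has_derivative (\<lambda>h. integral S (\<lambda>z. dpert (\<xi>, t) z (h, 0)))) (at \<xi>)" .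
      show "((\<lambda>\<zeta>. integral S (pert (\<zeta>, t))) has_derivative hess_psi (- ?E) (a + \<xi>)) (at \<xi>)"
      proof (rule has_derivative_transform_within_open)
        show "((\<lambda>\<zeta>. grad_psi (- ?E) (a + \<zeta>)) has_derivative hess_psi (- ?E) (a + \<xi>)) (at \<xi>)"
        proof -
          have "((\<lambda>\<zeta>. a + \<zeta>) has_derivative (\<lambda>h. h)) (at \<xi>)" by (auto intro!: derivative_eq_intros)
          from has_derivative_compose[OF this psi_derivatives(2)[OF Eop XE]] show ?thesis .
        qed
        show "open ((\<lambda>\<zeta>. a + \<zeta>) -` ?E)" by (intro open_vimage Eop continuous_intros)
        show "\<xi> \<in> (\<lambda>\<zeta>. a + \<zeta>) -` ?E" using XE by simp
      qed (use grad in auto)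
    qed
    then have "\<not> inj (\<lambda>h. integral S (\<lambda>z. dpert (\<xi>, t) z (h, 0)))"
      using degenerate_imp_not_inj[OF Eop XE] x(2) by (simp add: X)
    then have "t \<in> Bad"
      unfolding Bad_def using F0 \<xi>b t8 \<epsilon>1 by auto
    then show False using t(2) by blast
  qed
  then show ?thesis using that s(1) cb by blast
qed

section \<open>Residuality by a countable cover\<close>

theorem theoremA1:
  fixes \<Omega> :: "(real^'n::finite) set"
  assumes "CARD('n) \<ge> 3"
    and "open \<Omega>" and "bounded \<Omega>" and "smooth_boundary \<Omega>"
  shows "\<exists>\<rho>>0. residual_in_C2 (C2_ball \<rho>)
           {\<theta>\<in>C2_ball \<rho>. morse_on (deform \<Omega> \<theta>) (psi (deform \<Omega> \<theta>))}"
proof (intro exI conjI)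
  show "rho_max TYPE('n) > 0" by (rule rho_max_pos)
  let ?A = "{\<theta>\<in>small_ball. morse_on (deform \<Omega> \<theta>) (psi (deform \<Omega> \<theta>))}"
  have "\<forall>x\<in>\<Omega>. \<exists>s>0. cball x s \<subseteq> \<Omega> \<and> empty_interior_in_C2 small_ball (degenerate_thetas \<Omega> (cball x s))"
    using perturb_to_nondegenerate[OF assms(2,3)] by metis
  then obtain s where s: "\<And>x. x \<in> \<Omega> \<Longrightarrow> s x > 0" "\<And>x. x \<in> \<Omega> \<Longrightarrow> cball x (s x) \<subseteq> \<Omega>"
    "\<And>x. x \<in> \<Omega> \<Longrightarrow> empty_interior_in_C2 small_ball (degenerate_thetas \<Omega> (cball x (s x)))"
    by metis
  \<comment> \<open>Countability is extracted from the cover by open balls; the closed balls with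
    the same centres and radii are the compact sets to which closedness applies.\<close>
  obtain \<F> where \<F>: "\<F> \<subseteq> (\<lambda>x. ball x (s x)) ` \<Omega>" "countable \<F>" "\<Union>\<F> = \<Union>((\<lambda>x. ball x (s x)) ` \<Omega>)"
    using Lindelof[of "(\<lambda>x. ball x (s x)) ` \<Omega>"] by auto
  obtain C where C: "C \<subseteq> \<Omega>" "countable C" "\<F> = (\<lambda>x. ball x (s x)) ` C"
    using countable_subset_image[of \<F> "\<lambda>x. ball x (s x)" \<Omega>] \<F>(1,2) by blast
  have cover: "\<Omega> \<subseteq> (\<Union>x\<in>C. cball x (s x))"
  proof
    fix x assume "x \<in> \<Omega>"
    then have "x \<in> \<Union>\<F>" unfolding \<F>(3) using s(1) centre_in_ball by blast
    then show "x \<in> (\<Union>x\<in>C. cball x (s x))" unfolding C(3) using ball_subset_cball by blast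
  qed
  show "residual_in_C2 small_ball ?A"
    unfolding residual_in_C2_def
  proof (intro conjI)
    \<comment> \<open>\<open>from_nat_into\<close> enumerates \<open>C\<close> only if
      \<open>C\<close> is nonempty; otherwise \<Omega> is empty, and so is every member of the
      sequence.\<close>
    define F where "F m = (if C = {} then {} else degenerate_thetas \<Omega> (cball (from_nat_into C m) (s (from_nat_into C m))))" for m
    have empty: "closed_in_C2 (small_ball :: (real^'n \<Rightarrow> real^'n) set) {}"
      "empty_interior_in_C2 (small_ball :: (real^'n \<Rightarrow> real^'n) set) {}"
    proof -
      show "closed_in_C2 (small_ball :: (real^'n \<Rightarrow> real^'n) set) {}"
        by (auto simp: closed_in_C2_def intro: exI[of _ 1])
      show "empty_interior_in_C2 (small_ball :: (real^'n \<Rightarrow> real^'n) set) {}"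
        unfolding empty_interior_in_C2_def
      proof (intro notI, elim bexE exE conjE)
        fix \<theta> :: "real^'n \<Rightarrow> real^'n" and \<epsilon> :: real
        assume \<theta>: "\<theta> \<in> small_ball" "\<epsilon> > 0" "{\<eta> \<in> small_ball. C2_dist \<theta> \<eta> < \<epsilon>} \<subseteq> {}"
        note z = small_ball_C2[OF zero_in_small_ball[where 'n='n]]
        \<comment> \<open>The empty set has empty interior because each relative ball contains its
          centre.\<close>
        have "C2_dist \<theta> \<theta> = 0"
          using C2_space_scale(2)[OF z, of 0] C2_norm_nonneg[OF z] by (simp add: C2_dist_def)
        then show False using \<theta> by auto
      qed
    qed
    have "closed_in_C2 small_ball (F m) \<and> empty_interior_in_C2 small_ball (F m)" for m
    proof (cases "C = {}")
      case False
      then have "from_nat_into C m \<in> \<Omega>" using from_nat_into[OF False, of m] C(1) by blast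
      then show ?thesis
        using False closed_degenerate_thetas[OF assms(2) compact_cball] s(2,3) by (simp add: F_def)
    qed (simp add: F_def empty)
    moreover have "small_ball - ?A = (\<Union>m. F m)"
    proof -
      have "(\<Union>m. F m) = (\<Union>x\<in>C. degenerate_thetas \<Omega> (cball x (s x)))"
      proof (cases "C = {}")
        case False
        have "(\<Union>m. F m) = (\<Union>x\<in>range (from_nat_into C). degenerate_thetas \<Omega> (cball x (s x)))"
          using False by (simp add: F_def)
        then show ?thesis unfolding range_from_nat_into[OF False C(2)] .
      qed (simp add: F_def)
      also have "\<dots> = small_ball - ?A"
      proof (intro set_eqI iffI)
        fix \<theta> assume "\<theta> \<in> (\<Union>x\<in>C. degenerate_thetas \<Omega> (cball x (s x)))"
        then obtain c x where c: "c \<in> C" "\<theta> \<in> small_ball" "x \<in> cball c (s c)" "degenerate (deform \<Omega> \<theta>) (x + \<theta> x)"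
          by (auto simp: degenerate_thetas_def)
        then have "x \<in> \<Omega>" using s(2) C(1) by blast
        then have "x + \<theta> x \<in> deform \<Omega> \<theta>" unfolding deform_def by blast
        then show "\<theta> \<in> small_ball - ?A"
          using c morse_on_psi_iff[OF open_deform[OF c(2) assms(2)]] by auto
      next
        fix \<theta> assume "\<theta> \<in> small_ball - ?A"
        then have \<theta>: "\<theta> \<in> small_ball" "\<not> morse_on (deform \<Omega> \<theta>) (psi (deform \<Omega> \<theta>))" by auto
        then obtain x where "x \<in> \<Omega>" "degenerate (deform \<Omega> \<theta>) (x + \<theta> x)"
          using morse_on_psi_iff[OF open_deform[OF \<theta>(1) assms(2)]] by (auto simp: deform_def)
        then show "\<theta> \<in> (\<Union>x\<in>C. degenerate_thetas \<Omega> (cball x (s x)))"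
          using cover \<theta>(1) by (fastforce simp: degenerate_thetas_def)
      qed
      finally show ?thesis ..
    qed
    ultimately show "\<exists>F. (\<forall>m. closed_in_C2 small_ball (F m) \<and> empty_interior_in_C2 small_ball (F m)) \<and> small_ball - ?A = (\<Union>m::nat. F m)"
      by blast
  qed auto
qed

end
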